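(* Define integers $L_n$ for $n\ge 1$ by $L_1=0$, $L_2=1$, and, for $n\ge 3$, $$L_n=2q_n(L_{n-1}+1),\qquad q_n=4n^2r_n,\qquad r_n=\lceil\log_2 n\rceil .$$ Then for every $n\ge1$ and every graph $G$ on $n$ vertices, $$\mathcal P(G)=\mathcal P_{L_n}(G).$$ Moreover, for every $n\ge 2$, $$L_n\le 16^{\,n-2}\left(\frac{n!}{2}\right)^2\lceil\log_2 n\rceil^{\,n-2},$$ the right-hand side equals $\exp\bigl(2n\log n+n\log\log n+O(n)\bigr)$ as $n\to\infty$, and hence $L_n\le n^{(2+o(1))n}$ as $n\to\infty$. In particular, for every $G$ the set $\mathcal P(G)$ is a rational polytope.
   Context: All graphs are finite and simple, with nonempty vertex set, and are not assumed connected. Let $G=(V,E)$ be a graph. A nonempty set $S\subseteq V$ is called connected if the induced subgraph $G[S]$ is connected. For such $S$, the averaging operator $A_S\in\mathbb R^{V\times V}$ is defined by $(A_Sz)_v=|S|^{-1}\sum_{u\in S}z_u$ if $v\in S$ and $(A_Sz)_v=z_v$ if $v\notin S$. A strategy is a finite (possibly empty) sequence $\sigma=(S_1,\ldots,S_k)$ of nonempty connected sets, listed in chronological order; its length is $|\sigma|=k$ and its operator is $A_\sigma=A_{S_k}\cdots A_{S_1}$ (the identity if $k=0$). For $d\ge0$ put $$\mathcal A_d(G)=\{A_\sigma:|\sigma|\le d\},\qquad \mathcal P_d(G)=\operatorname{conv}\mathcal A_d(G),\qquad \mathcal P(G)=\operatorname{conv}\bigcup_{d\ge0}\mathcal A_d(G),$$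 where $\operatorname{conv}$ is the set of finite convex combinations in $\mathbb R^{V\times V}$. A rational polytope is the convex hull of finitely many points with rational coordinates. $\log$ is the natural logarithm. *)

theory Defs
  imports
    "HOL-Analysis.Analysis"
    "HOL-Library.Landau_Symbols"
    "Graph_Theory.Digraph_Component"
begin

text \<open>
  Graphs are those of the locale \<^locale>\<open>graph\<close> (finite, simple, symmetric digraphs). Matrices
  indexed by the vertices have type \<^typ>\<open>real^'v^'v\<close>, so a graph with vertex set \<open>V\<close> is one whose
  vertex set is all of the finite type \<open>'v\<close>; its order is then \<open>CARD('v)\<close>.
\<close>

definition connected_vertex_set :: "('v, 'e) pre_digraph \<Rightarrow> 'v set \<Rightarrow> bool" where
  "connected_vertex_set G S \<longleftrightarrow>
     S \<noteq> {} \<and> S \<subseteq> verts G \<and> Digraph_Component.connected (G \<restriction> S)"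

definition averaging_op :: "'v::finite set \<Rightarrow> real^'v^'v" where
  "averaging_op S =
     matrix (\<lambda>z. \<chi> v. if v \<in> S then (\<Sum>u\<in>S. z $ u) / real (card S) else z $ v)"

lemma averaging_op_mult_vec:
  fixes S :: "'v::finite set" and z :: "real^'v"
  shows "(averaging_op S *v z) $ v = (if v \<in> S then (\<Sum>u\<in>S. z $ u) / real (card S) else z $ v)"
proof -
  have "linear (\<lambda>z::real^'v. \<chi> v. if v \<in> S then (\<Sum>u\<in>S. z $ u) / real (card S) else z $ v)"
    by (rule linearI)
      (auto simp: vec_eq_iff sum.distrib add_divide_distrib sum_distrib_left)
  then show ?thesis
    by (simp add: averaging_op_def matrix_works)
qed

definition strategy :: "('v, 'e) pre_digraph \<Rightarrow> 'v set list \<Rightarrow> bool" where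
  "strategy G \<sigma> \<longleftrightarrow> (\<forall>S \<in> set \<sigma>. connected_vertex_set G S)"

text \<open>The head of the list acts first, i.e. it is the rightmost factor of the product.\<close>

definition strategy_op :: "'v::finite set list \<Rightarrow> real^'v^'v" where
  "strategy_op \<sigma> = fold (\<lambda>S M. averaging_op S ** M) \<sigma> (mat 1)"

definition strategy_ops :: "('v::finite, 'e) pre_digraph \<Rightarrow> nat \<Rightarrow> (real^'v^'v) set" where
  "strategy_ops G d = {strategy_op \<sigma> | \<sigma>. strategy G \<sigma> \<and> length \<sigma> \<le> d}"

definition bounded_strategy_hull :: "('v::finite, 'e) pre_digraph \<Rightarrow> nat \<Rightarrow> (real^'v^'v) set" where
  "bounded_strategy_hull G d = convex hull (strategy_ops G d)"

definition strategy_hull :: "('v::finite, 'e) pre_digraph \<Rightarrow> (real^'v^'v) set" where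
  "strategy_hull G = convex hull (\<Union>d. strategy_ops G d)"

definition rational_polytope :: "(real^'m^'n) set \<Rightarrow> bool" where
  "rational_polytope P \<longleftrightarrow>
     (\<exists>F. finite F \<and> (\<forall>M \<in> F. \<forall>i j. M $ i $ j \<in> \<rat>) \<and> P = convex hull F)"

definition length_bound_r :: "nat \<Rightarrow> nat" where
  "length_bound_r n = nat \<lceil>log 2 (real n)\<rceil>"

definition length_bound_q :: "nat \<Rightarrow> nat" where
  "length_bound_q n = 4 * n ^ 2 * length_bound_r n"

text \<open>The sequence \<open>L\<^sub>n\<close>; the value at \<open>n = 0\<close> is arbitrary.\<close>

function length_bound :: "nat \<Rightarrow> nat" where
  "length_bound n =
     (if n \<le> 1 then 0
      else if n = 2 then 1
      else 2 * length_bound_q n * (length_bound (n - 1) + 1))"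
  by auto
termination by (relation "Wellfounded.measure id") auto

declare length_bound.simps [simp del]

definition explicit_length_bound :: "nat \<Rightarrow> real" where
  "explicit_length_bound n =
     16 ^ (n - 2) * (fact n / 2) ^ 2 * real_of_int \<lceil>log 2 (real n)\<rceil> ^ (n - 2)"

end

theory Submission
  imports Defs "HOL-Real_Asymp.Real_Asymp"
begin

text \<open>
  Induction on the number \<open>n\<close> of vertices. A word of averages that leaves some vertex cut uncrossed
  splits into words on two smaller vertex sets, so a long word is, up to convex combination, a
  product of blocks of length at most \<open>L\<^bsub>n-1\<^esub> + 1\<close>, each of which crosses every cut. With fewer than
  \<open>2 q\<^sub>n\<close> blocks the length is at most \<open>L\<^sub>n\<close>. A crossing block contracts the variance by \<open>1 - 2/n\<^sup>2\<close>, so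
  \<open>2 q\<^sub>n\<close> blocks bring the operator within \<open>n\<^bsup>-11\<^esup>\<close> of the full average \<open>J\<close>.

  If the graph is connected and not a path, then \<open>J\<close> is an interior point of the hull of the words of
  length at most 8, quantitatively: averaging over the two sides of a connected bipartition is \<open>J\<close> plus
  a rank-one matrix, products of such operators give rank-one perturbations of either sign, and these
  span all deviations from \<open>J\<close>. On a path this fails, since monotone vectors stay monotone. There
  the identity \<open>A\<^sub>S A\<^sub>T A\<^sub>S = l A\<^sub>S A\<^bsub>T-S\<^esub> + (1-l) A\<^bsub>S \<union> T\<^esub>\<close> shows that averages involving the first vertex
  are needed at most once, so that length \<open>2\<^bsup>n-1\<^esup> - 1\<close> suffices.
\<close>

section \<open>Products of averaging operators\<close>

text \<open>The constants fit together as follows. With n = |W|, a product over sides starts with a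
  rank-one coefficient of at least 1/n and loses at most a factor n^2 in each of at most three
  further steps; so size n^-7 is reached by words of length 8. A deviation expands into at most n^2
  such terms, with second differences of its entries as coefficients, which costs a further 4 \<le>
  n^2: hence n^-11. Entries are bounded by the square root of the energy, so 2 q_n blocks give the
  factor (1 - 2/n^2)^q_n \<le> exp (- 8 r_n) \<le> n^-11. The neighbourhood argument needs inner
  products of sides bounded away from zero, so only bipartitions that do not cross may be
  multiplied, and it needs a source of negative signs: three pairwise disjoint sides. An induced
  path has no such triple and every other connected graph has one; this is the dichotomy. The path
  induction is stated for chains of blocks because the first two vertices get merged on the
  way.\<close>

lemma strategy_op_fold:
  fixes X :: "real^'v^'v::finite"
  shows "fold (\<lambda>S M. averaging_op S ** M) \<sigma> X = strategy_op \<sigma> ** X"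
proof (induction \<sigma> arbitrary: X)
  case (Cons S \<sigma>)
  have "strategy_op (S # \<sigma>) = strategy_op \<sigma> ** averaging_op S"
    using Cons[of "averaging_op S"] by (simp add: strategy_op_def)
  then show ?case
    using Cons[of "averaging_op S ** X"] by (simp add: matrix_mul_assoc)
qed (simp add: strategy_op_def)

lemma strategy_op_append: "strategy_op (\<sigma> @ \<tau>) = strategy_op \<tau> ** strategy_op \<sigma>"
  unfolding strategy_op_def by (simp add: strategy_op_fold)

lemma strategy_op_Nil [simp]: "strategy_op [] = mat 1"
  by (simp add: strategy_op_def)

lemma strategy_op_single [simp]: "strategy_op [S] = averaging_op S"
  by (simp add: strategy_op_def)

lemma strategy_op_Cons: "strategy_op (S # \<sigma>) = strategy_op \<sigma> ** averaging_op S"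
  using strategy_op_append[of "[S]" \<sigma>] by simp

lemma sum_averaging_op:
  fixes z :: "real^'v::finite"
  assumes "S \<subseteq> T \<or> S \<inter> T = {}"
  shows "(\<Sum>u\<in>T. (averaging_op S *v z) $ u) = (\<Sum>u\<in>T. z $ u)"
proof (cases "S \<subseteq> T")
  case True
  have "(\<Sum>u\<in>T. (averaging_op S *v z) $ u)
      = (\<Sum>u\<in>S. (averaging_op S *v z) $ u) + (\<Sum>u\<in>T - S. (averaging_op S *v z) $ u)"
    using True by (metis add.commute finite sum.subset_diff)
  also have "(\<Sum>u\<in>S. (averaging_op S *v z) $ u) = (\<Sum>u\<in>S. z $ u)"
    by (cases "S = {}") (simp_all add: averaging_op_mult_vec)
  also have "(\<Sum>u\<in>T - S. (averaging_op S *v z) $ u) = (\<Sum>u\<in>T - S. z $ u)"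
    by (intro sum.cong) (auto simp: averaging_op_mult_vec)
  also have "(\<Sum>u\<in>S. z $ u) + (\<Sum>u\<in>T - S. z $ u) = (\<Sum>u\<in>T. z $ u)"
    using True by (metis add.commute finite sum.subset_diff)
  finally show ?thesis .
next
  case False
  with assms show ?thesis
    by (intro sum.cong) (auto simp: averaging_op_mult_vec)
qed

text \<open>A vector constant on T is unchanged by averaging over a part of T, and such averaging
  leaves the sum over T alone.\<close>

lemma averaging_op_absorb:
  fixes S T :: "'v::finite set"
  assumes "S \<subseteq> T"
  shows "averaging_op T ** averaging_op S = averaging_op T"
    and "averaging_op S ** averaging_op T = averaging_op T"
proof -
  have "averaging_op T *v (averaging_op S *v z) = averaging_op T *v z" for z :: "real^'v"
    using assms sum_averaging_op[of S T z]
    by (auto simp: vec_eq_iff averaging_op_mult_vec[of T] averaging_op_mult_vec[of S])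
  then show "averaging_op T ** averaging_op S = averaging_op T"
    by (simp add: matrix_eq matrix_vector_mul_assoc)
  have "averaging_op S *v (averaging_op T *v z) = averaging_op T *v z" for z :: "real^'v"
  proof -
    have "(\<Sum>u\<in>S. (averaging_op T *v z) $ u) = real (card S) * ((\<Sum>u\<in>T. z $ u) / real (card T))"
      using assms by (subst sum_constant [symmetric], intro sum.cong) (auto simp: averaging_op_mult_vec)
    then show ?thesis
      using assms by (auto simp: vec_eq_iff averaging_op_mult_vec[of S] averaging_op_mult_vec[of T])
  qed
  then show "averaging_op S ** averaging_op T = averaging_op T"
    by (simp add: matrix_eq matrix_vector_mul_assoc)
qed

lemma averaging_op_commute:
  fixes S T :: "'v::finite set"
  assumes "S \<subseteq> T \<or> T \<subseteq> S \<or> S \<inter> T = {}"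
  shows "averaging_op S ** averaging_op T = averaging_op T ** averaging_op S"
proof -
  consider "S \<subseteq> T" | "T \<subseteq> S" | "S \<inter> T = {}" using assms by blast
  then show ?thesis
  proof cases
    case 3
    have "averaging_op S *v (averaging_op T *v z) = averaging_op T *v (averaging_op S *v z)"
      for z :: "real^'v"
      using 3 sum_averaging_op[of S T z] sum_averaging_op[of T S z]
      by (auto simp: vec_eq_iff averaging_op_mult_vec Int_commute split: if_splits)
    then show ?thesis
      by (simp add: matrix_eq matrix_vector_mul_assoc)
  qed (simp_all add: averaging_op_absorb)
qed

text \<open>Products are kept right-associated for rewriting; this form lets a rule for
  \<open>A ** B\<close> fire at the head of a longer product.\<close>

lemma matrix_mul_eq_assoc:
  assumes "A ** B = C"
  shows "A ** (B ** X) = C ** X"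
  using assms by (simp add: matrix_mul_assoc)

lemma matrix_mul_eq_assoc2:
  assumes "A ** B = C ** D"
  shows "A ** (B ** X) = C ** (D ** X)"
  using assms by (simp add: matrix_mul_assoc)

lemma averaging_op_singleton [simp]: "averaging_op {v} = mat 1"
  by (auto simp: matrix_eq vec_eq_iff averaging_op_mult_vec)

lemma averaging_op_strategy_op_commute:
  assumes "\<And>T. T \<in> set \<sigma> \<Longrightarrow> S \<subseteq> T \<or> T \<subseteq> S \<or> S \<inter> T = {}"
  shows "averaging_op S ** strategy_op \<sigma> = strategy_op \<sigma> ** averaging_op S"
  using assms
proof (induction \<sigma>)
  case (Cons T \<sigma>)
  have "averaging_op S ** averaging_op T = averaging_op T ** averaging_op S"
    using Cons.prems by (intro averaging_op_commute) simp
  moreover have "averaging_op S ** strategy_op \<sigma> = strategy_op \<sigma> ** averaging_op S"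
    using Cons by simp
  ultimately show ?case
    by (simp add: strategy_op_Cons matrix_mul_assoc) (simp add: matrix_mul_assoc [symmetric])
qed simp

lemma strategy_op_commute:
  assumes "\<And>S T. S \<in> set \<sigma> \<Longrightarrow> T \<in> set \<tau> \<Longrightarrow> S \<subseteq> T \<or> T \<subseteq> S \<or> S \<inter> T = {}"
  shows "strategy_op \<sigma> ** strategy_op \<tau> = strategy_op \<tau> ** strategy_op \<sigma>"
  using assms
proof (induction \<sigma>)
  case (Cons S \<sigma>)
  have "averaging_op S ** strategy_op \<tau> = strategy_op \<tau> ** averaging_op S"
    using Cons.prems by (intro averaging_op_strategy_op_commute) simp
  moreover have "strategy_op \<sigma> ** strategy_op \<tau> = strategy_op \<tau> ** strategy_op \<sigma>"
    using Cons by simp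
  note matrix_mul_eq_assoc2[OF this]
  ultimately show ?case
    by (simp add: strategy_op_Cons matrix_mul_assoc [symmetric])
qed simp

lemma strategy_op_absorb:
  assumes "\<And>S. S \<in> set \<sigma> \<Longrightarrow> S \<subseteq> T"
  shows "averaging_op T ** strategy_op \<sigma> = averaging_op T"
    and "strategy_op \<sigma> ** averaging_op T = averaging_op T"
  using assms
proof (induction \<sigma>)
  case (Cons S \<sigma>)
  { case 1 with Cons show ?case
      by (simp add: strategy_op_Cons matrix_mul_assoc averaging_op_absorb) }
  { case 2 with Cons show ?case
      by (simp add: strategy_op_Cons matrix_mul_assoc [symmetric] averaging_op_absorb) }
qed simp_all

text \<open>All three products send z to a vector that is constant on S and on T - S, equals z
  elsewhere and keeps the sum over S \<union> T. Such vectors form a line, and l locates the left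
  side between the two products on the right, independently of z. An average over T between two
  averages over S is thereby either made disjoint from S or extended over S.\<close>

lemma averaging_op_sandwich:
  fixes S T :: "'v::finite set"
  assumes "S \<inter> T \<noteq> {}"
  obtains l where "0 \<le> l" "l \<le> 1"
    "averaging_op S ** averaging_op T ** averaging_op S
       = l *\<^sub>R (averaging_op S ** averaging_op (T - S)) + (1 - l) *\<^sub>R averaging_op (S \<union> T)"
proof -
  define p s t where "p = real (card (S \<inter> T))" and "s = real (card S)" and "t = real (card (T - S))"
  \<comment> \<open>The ratio by which the left side shrinks the deviation of the mean on S from the
    mean on S \<union> T. If T lies in S, then \<open>l = 0\<close> and T - S is empty.\<close>
  define l where "l = t * (s - p) / ((p + t) * s)"
  have p: "p > 0" using assms by (simp add: p_def card_gt_0_iff)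
  have ps: "p \<le> s" unfolding p_def s_def by (simp add: card_mono)
  have t: "t \<ge> 0" by (simp add: t_def)
  have cT: "real (card T) = p + t"
    unfolding p_def t_def by (metis Int_commute card_Diff_subset_Int card_mono finite inf_le1 le_add_diff_inverse of_nat_add)
  have cU: "real (card (S \<union> T)) = s + t"
    unfolding s_def t_def using card_Un_disjoint[of S "T - S"] by auto
  have l0: "0 \<le> l" unfolding l_def using p ps t by auto
  have "t * (s - p) \<le> (p + t) * s" using p ps t by (simp add: algebra_simps)
  then have l1: "l \<le> 1" unfolding l_def using p ps t by (simp add: divide_le_eq)
  have eq: "averaging_op S *v (averaging_op T *v (averaging_op S *v z))
      = l *\<^sub>R (averaging_op S *v (averaging_op (T - S) *v z)) + (1 - l) *\<^sub>R (averaging_op (S \<union> T) *v z)"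
    (is "?L = ?R") for z :: "real^'v"
  proof -
    define a b where "a = (\<Sum>u\<in>S. z $ u)" and "b = (\<Sum>u\<in>T - S. z $ u)"
    define y where "y = averaging_op S *v z"
    define \<tau> where "\<tau> = (p * (a / s) + b) / (p + t)"
    have y: "y $ v = (if v \<in> S then a / s else z $ v)" for v
      unfolding y_def a_def s_def by (simp add: averaging_op_mult_vec)
    have sT: "(\<Sum>u\<in>T. y $ u) = p * (a / s) + b"
    proof -
      have "(\<Sum>u\<in>T. y $ u) = (\<Sum>u\<in>S \<inter> T. y $ u) + (\<Sum>u\<in>T - S. y $ u)"
        by (metis Int_commute finite sum.Int_Diff)
      moreover have "(\<Sum>u\<in>S \<inter> T. y $ u) = p * (a / s)"
        unfolding p_def by (subst sum_constant [symmetric], intro sum.cong) (auto simp: y)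
      moreover have "(\<Sum>u\<in>T - S. y $ u) = b"
        unfolding b_def by (intro sum.cong) (auto simp: y)
      ultimately show ?thesis by simp
    qed
    define x where "x = averaging_op T *v y"
    have x: "x $ v = (if v \<in> T then \<tau> else if v \<in> S then a / s else z $ v)" for v
      unfolding x_def \<tau>_def averaging_op_mult_vec sT cT by (simp add: y)
    have sS: "(\<Sum>u\<in>S. x $ u) = p * \<tau> + (s - p) * (a / s)"
    proof -
      have "(\<Sum>u\<in>S. x $ u) = (\<Sum>u\<in>S \<inter> T. x $ u) + (\<Sum>u\<in>S - T. x $ u)"
        by (metis finite sum.Int_Diff)
      moreover have "(\<Sum>u\<in>S \<inter> T. x $ u) = p * \<tau>"
        unfolding p_def by (subst sum_constant [symmetric], intro sum.cong) (auto simp: x)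
      moreover have "(\<Sum>u\<in>S - T. x $ u) = real (card (S - T)) * (a / s)"
        by (subst sum_constant [symmetric], intro sum.cong) (auto simp: x)
      moreover have "real (card (S - T)) = s - p"
        unfolding p_def s_def
        by (metis card_Diff_subset_Int card_mono finite inf_le1 of_nat_diff)
      ultimately show ?thesis by simp
    qed
    have sU: "(\<Sum>u\<in>S \<union> T. z $ u) = a + b"
      unfolding a_def b_def using sum.union_disjoint[of S "T - S" "($) z"] by auto
    have s: "s > 0" and pt: "p + t > 0" using p ps t by linarith+
    have L: "?L $ v = (if v \<in> S then (p * \<tau> + (s - p) * (a / s)) / s else if v \<in> T then \<tau> else z $ v)" for v
    proof -
      have "?L $ v = (averaging_op S *v x) $ v" by (simp add: x_def y_def)
      also have "\<dots> = (if v \<in> S then (p * \<tau> + (s - p) * (a / s)) / s else x $ v)"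
        unfolding averaging_op_mult_vec sS s_def by simp
      finally show ?thesis by (simp add: x)
    qed
    have sS': "(\<Sum>u\<in>S. (averaging_op (T - S) *v z) $ u) = a"
      unfolding a_def by (intro sum_averaging_op) auto
    have R: "?R $ v = l * (if v \<in> S then a / s else if v \<in> T then b / t else z $ v)
         + (1 - l) * (if v \<in> S \<union> T then (a + b) / (s + t) else z $ v)" for v
      by (auto simp: averaging_op_mult_vec[of S "averaging_op (T - S) *v _"] sS'
            averaging_op_mult_vec[of "S \<union> T"] averaging_op_mult_vec[of "T - S"] sU cU s_def a_def b_def t_def)
    have lc: "1 - l = p * (s + t) / ((p + t) * s)"
      unfolding l_def using p s t pt by (simp add: divide_simps) (simp add: algebra_simps)
    have h: "(1 - l) * ((a + b) / (s + t)) = p * (a + b) / ((p + t) * s)"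
      unfolding lc using s t by simp
    have e1: "\<tau> = l * (b / t) + (1 - l) * ((a + b) / (s + t))" if "t \<noteq> 0"
    proof -
      have lb: "l * (b / t) = (s - p) * b / ((p + t) * s)" unfolding l_def using that by simp
      show ?thesis unfolding h lb \<tau>_def using s pt
        by (simp add: divide_simps) (simp add: algebra_simps)
    qed
    have e2: "(p * \<tau> + (s - p) * (a / s)) / s = l * (a / s) + (1 - l) * ((a + b) / (s + t))"
    proof -
      have la: "l * (a / s) = t * (s - p) * a / ((p + t) * s * s)"
        unfolding l_def by simp
      have p\<tau>: "p * \<tau> = p * (p * a + s * b) / ((p + t) * s)"
        unfolding \<tau>_def using s pt by (simp add: divide_simps)
      show ?thesis unfolding h la p\<tau> using s pt
        by (simp add: divide_simps) (simp add: algebra_simps)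
    qed
    \<comment> \<open>For t = 0 the quotient b / t is a default value, which no vertex
      takes.\<close>
    have t0: "T - S = {}" if "t = 0" using that by (simp add: t_def)
    show ?thesis
      unfolding vec_eq_iff
    proof
      fix v
      consider "v \<in> S" | "v \<notin> S" "v \<in> T" | "v \<notin> S" "v \<notin> T" by blast
      then show "?L $ v = ?R $ v"
      proof cases
        case 1
        then show ?thesis unfolding L R e2 by simp
      next
        case 2
        then have "t \<noteq> 0" using t0 by blast
        with 2 show ?thesis unfolding L R using e1 by simp
      next
        case 3
        then show ?thesis unfolding L R by (simp add: algebra_simps)
      qed
    qed
  qed
  have "averaging_op S ** averaging_op T ** averaging_op S
       = l *\<^sub>R (averaging_op S ** averaging_op (T - S)) + (1 - l) *\<^sub>R averaging_op (S \<union> T)"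
    using eq by (simp add: matrix_eq matrix_vector_mul_assoc [symmetric] matrix_vector_mult_add_rdistrib
        scaleR_matrix_vector_assoc [symmetric])
  with l0 l1 that show thesis by blast
qed

lemma convex_hull_linear_mem:
  assumes "linear f" "\<And>x. x \<in> X \<Longrightarrow> f x \<in> convex hull Z" "M \<in> convex hull X"
  shows "f M \<in> convex hull Z"
proof -
  have "f ` (convex hull X) = convex hull (f ` X)"
    using assms(1) by (simp add: convex_hull_linear_image)
  also have "\<dots> \<subseteq> convex hull Z"
    using assms(2) by (intro hull_minimal) auto
  finally show ?thesis using assms(3) by blast
qed

lemma linear_matrix_mult_left: "linear (\<lambda>X :: real^'n^'m. (A :: real^'m^'k) ** X)"
  by (intro linearI)
    (simp_all add: vec_eq_iff matrix_matrix_mult_def sum.distrib algebra_simps sum_distrib_left)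

lemma linear_matrix_mult_right: "linear (\<lambda>X :: real^'m^'k. X ** (A :: real^'n^'m))"
  by (intro linearI)
    (simp_all add: vec_eq_iff matrix_matrix_mult_def sum.distrib algebra_simps sum_distrib_left)

lemma convex_hull_matrix_mult:
  fixes X :: "(real^'m^'k) set" and Y :: "(real^'n^'m) set"
  assumes "\<And>x y. x \<in> X \<Longrightarrow> y \<in> Y \<Longrightarrow> x ** y \<in> convex hull Z"
    and "M \<in> convex hull X" "N \<in> convex hull Y"
  shows "M ** N \<in> convex hull Z"
proof (rule convex_hull_linear_mem[OF linear_matrix_mult_left _ assms(3)])
  show "M ** y \<in> convex hull Z" if "y \<in> Y" for y
    using that assms by (intro convex_hull_linear_mem[OF linear_matrix_mult_right _ assms(2)]) auto
qed

section \<open>Chains of blocks\<close>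

text \<open>The path is a chain of blocks, at first single vertices; merging neighbouring blocks
  keeps the setting closed. Contiguous unions play the role of connected sets.\<close>

definition contiguous_union :: "'a set list \<Rightarrow> 'a set \<Rightarrow> bool" where
  "contiguous_union Qs I \<longleftrightarrow> (\<exists>xs ys zs. Qs = xs @ ys @ zs \<and> ys \<noteq> [] \<and> I = \<Union>(set ys))"

primrec disjoint_blocks :: "'a set list \<Rightarrow> bool" where
  "disjoint_blocks [] \<longleftrightarrow> True"
| "disjoint_blocks (Q # Qs) \<longleftrightarrow> Q \<noteq> {} \<and> Q \<inter> \<Union>(set Qs) = {} \<and> disjoint_blocks Qs"

text \<open>At most one letter meets the first block, flanked by reduced words of the remaining
  chain. It cannot be the first block alone (\<open>ys \<noteq> []\<close>), since the initial
  \<open>strategy_op Qs\<close> in \<open>reduced_hull\<close> already averages over it.\<close>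

primrec reduced_words :: "'a set list \<Rightarrow> 'a set list set" where
  "reduced_words [] = {[]}"
| "reduced_words (Q # Qs) = reduced_words Qs \<union>
     {\<tau>\<^sub>1 @ [Q \<union> \<Union>(set ys)] @ \<tau>\<^sub>2 |\<tau>\<^sub>1 \<tau>\<^sub>2 ys zs.
        \<tau>\<^sub>1 \<in> reduced_words Qs \<and> \<tau>\<^sub>2 \<in> reduced_words Qs \<and> Qs = ys @ zs \<and> ys \<noteq> []}"

lemma contiguous_union_Nil [simp]: "\<not> contiguous_union [] I"
  by (simp add: contiguous_union_def)

lemma contiguous_union_Cons:
  "contiguous_union (Q # Qs) I \<longleftrightarrow>
     I = Q \<or> (\<exists>ys zs. Qs = ys @ zs \<and> ys \<noteq> [] \<and> I = Q \<union> \<Union>(set ys)) \<or> contiguous_union Qs I"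
  (is "?L \<longleftrightarrow> ?A \<or> ?B \<or> ?C")
proof
  assume ?L
  then obtain xs ys zs where *: "Q # Qs = xs @ ys @ zs" "ys \<noteq> []" "I = \<Union>(set ys)"
    unfolding contiguous_union_def by blast
  show "?A \<or> ?B \<or> ?C"
  proof (cases xs)
    case Nil
    with *(1,2) have ys: "ys = Q # tl ys" "Qs = tl ys @ zs"
      by (cases ys; simp)+
    then have I: "I = Q \<union> \<Union>(set (tl ys))" using *(3) by (metis Union_insert list.simps(15))
    show ?thesis
    proof (cases "tl ys = []")
      case True
      then show ?thesis using I by simp
    next
      case False
      then show ?thesis using ys(2) I by blast
    qed
  next
    case (Cons x xs')
    with *(1) have "Qs = xs' @ ys @ zs" by simp
    with *(2,3) show ?thesis unfolding contiguous_union_def by blast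
  qed
next
  assume "?A \<or> ?B \<or> ?C"
  then show ?L
  proof (elim disjE)
    assume ?A
    then have "Q # Qs = [] @ [Q] @ Qs" "I = \<Union>(set [Q])" by auto
    then show ?L unfolding contiguous_union_def by blast
  next
    assume ?B
    then obtain ys zs where "Qs = ys @ zs" "I = Q \<union> \<Union>(set ys)" by blast
    then have "Q # Qs = [] @ (Q # ys) @ zs" "I = \<Union>(set (Q # ys))" by auto
    then show ?L unfolding contiguous_union_def by blast
  next
    assume ?C
    then show ?L unfolding contiguous_union_def by (metis append_Cons)
  qed
qed

lemma contiguous_union_subset: "contiguous_union Qs I \<Longrightarrow> I \<subseteq> \<Union>(set Qs)"
  by (auto simp: contiguous_union_def)

lemma contiguous_union_block:
  assumes "disjoint_blocks Qs" "contiguous_union Qs I" "Q \<in> set Qs"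
  shows "Q \<subseteq> I \<or> Q \<inter> I = {}"
  using assms
proof (induction Qs)
  case (Cons R Qs)
  consider "I = R" | ys zs where "Qs = ys @ zs" "I = R \<union> \<Union>(set ys)" | "contiguous_union Qs I"
    using Cons.prems(2) unfolding contiguous_union_Cons by blast
  note I = this
  have R: "Q = R \<or> Q \<in> set Qs" "disjoint_blocks Qs" "R \<inter> \<Union>(set Qs) = {}"
    using Cons.prems by auto
  from I show ?case
  proof cases
    case 1
    then show ?thesis using R by blast
  next
    case 2
    have "Q \<subseteq> \<Union>(set ys) \<or> Q \<inter> \<Union>(set ys) = {}" if "disjoint_blocks (ys @ zs)" "Q \<in> set (ys @ zs)"
      using that by (induction ys) auto
    then show ?thesis using R 2 by (elim disjE) blast+
  next
    case 3
    then have "I \<subseteq> \<Union>(set Qs)" by (rule contiguous_union_subset)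
    with R Cons.IH[OF R(2) 3] show ?thesis by blast
  qed
qed simp

lemma Nil_in_reduced_words [simp]: "[] \<in> reduced_words Qs"
  by (induction Qs) auto

lemma contiguous_union_reduced_words:
  "\<tau> \<in> reduced_words Qs \<Longrightarrow> S \<in> set \<tau> \<Longrightarrow> contiguous_union Qs S"
proof (induction Qs arbitrary: \<tau>)
  case (Cons Q Qs)
  show ?case
  proof (cases "contiguous_union Qs S")
    case False
    then have "S \<notin> set \<tau>'" if "\<tau>' \<in> reduced_words Qs" for \<tau>'
      using Cons.IH[OF that] by blast
    with Cons.prems(2) have "\<tau> \<notin> reduced_words Qs" by blast
    with Cons.prems(1) obtain \<tau>\<^sub>1 \<tau>\<^sub>2 ys zs where
      \<tau>: "\<tau> = \<tau>\<^sub>1 @ [Q \<union> \<Union>(set ys)] @ \<tau>\<^sub>2" "\<tau>\<^sub>1 \<in> reduced_words Qs" "\<tau>\<^sub>2 \<in> reduced_words Qs"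
      and ys: "Qs = ys @ zs" "ys \<noteq> []"
      unfolding reduced_words.simps by blast
    then have "S \<notin> set \<tau>\<^sub>1" "S \<notin> set \<tau>\<^sub>2" by (simp_all add: \<open>\<And>\<tau>'. \<tau>' \<in> reduced_words Qs \<Longrightarrow> S \<notin> set \<tau>'\<close>)
    with Cons.prems(2) \<tau>(1) have "S = Q \<union> \<Union>(set ys)" by simp
    with ys show ?thesis unfolding contiguous_union_Cons by blast
  qed (simp add: contiguous_union_Cons)
qed simp

text \<open>The maximal length starts at 0 for one block, where no nonempty \<open>ys\<close>
  exists, and then follows x -> 2 x + 1.\<close>

lemma length_reduced_words:
  "\<tau> \<in> reduced_words Qs \<Longrightarrow> length \<tau> < 2 ^ (length Qs - 1)"
proof (induction Qs arbitrary: \<tau>)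
  case (Cons Q Qs)
  then consider "\<tau> \<in> reduced_words Qs" | \<tau>\<^sub>1 \<tau>\<^sub>2 I where "\<tau> = \<tau>\<^sub>1 @ [I] @ \<tau>\<^sub>2"
    "\<tau>\<^sub>1 \<in> reduced_words Qs" "\<tau>\<^sub>2 \<in> reduced_words Qs" "Qs \<noteq> []"
    by auto
  then show ?case
  proof cases
    case 1
    have "2 ^ (length Qs - 1) \<le> (2::nat) ^ (length (Q # Qs) - 1)"
      by (intro power_increasing) auto
    then show ?thesis using Cons.IH[OF 1] by linarith
  next
    case 2
    then have "2 ^ (length (Q # Qs) - 1) = (2::nat) * 2 ^ (length Qs - 1)"
      by (cases Qs) auto
    then show ?thesis using Cons.IH[OF 2(2)] Cons.IH[OF 2(3)] 2(1) by simp
  qed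
qed simp

text \<open>Averages over disjoint blocks are commuting projections.\<close>

lemma strategy_op_blocks_idem:
  fixes Qs :: "'v::finite set list"
  assumes "disjoint_blocks Qs"
  shows "strategy_op Qs ** strategy_op Qs = strategy_op Qs"
  using assms
proof (induction Qs)
  case (Cons Q Qs)
  have "averaging_op Q ** strategy_op Qs = strategy_op Qs ** averaging_op Q"
    using Cons.prems by (intro averaging_op_strategy_op_commute) auto
  note 1 = matrix_mul_eq_assoc2[OF this]
  have "strategy_op Qs ** strategy_op Qs = strategy_op Qs"
    using Cons by simp
  note 2 = matrix_mul_eq_assoc[OF this]
  show ?case
    by (simp add: strategy_op_Cons matrix_mul_assoc [symmetric] averaging_op_absorb 1 2)
qed simp

text \<open>The factor \<open>strategy_op Qs\<close> acts first and makes the input constant on each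
  block, which allows merged blocks to be treated like vertices. It is the identity when all blocks
  are singletons.\<close>

definition reduced_hull :: "'v::finite set list \<Rightarrow> (real^'v^'v) set" where
  "reduced_hull Qs = convex hull ((\<lambda>\<tau>. strategy_op \<tau> ** strategy_op Qs) ` reduced_words Qs)"

text \<open>Between two averages that involve the first block, inductively at most one involves the second.
  The sandwich identity removes it or extends it to the first block; after that the first two blocks
  always move together and can be lumped, which shortens the chain.\<close>

theorem contiguous_word_in_reduced_hull:
  fixes Qs \<sigma> :: "'v::finite set list"
  assumes "disjoint_blocks Qs" "\<And>S. S \<in> set \<sigma> \<Longrightarrow> contiguous_union Qs S"
  shows "strategy_op \<sigma> ** strategy_op Qs \<in> reduced_hull Qs"
  using assms
\<comment> \<open>Two shorter chains occur: the tail \<open>Qs1\<close>, and \<open>R\<close> with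
  the first two blocks merged.\<close>
proof (induction "length Qs" arbitrary: Qs \<sigma> rule: less_induct)
  case less
  show ?case
  proof (cases Qs)
    case Nil
    with less.prems(2) have "\<sigma> = []" by (cases \<sigma>) auto
    with Nil show ?thesis by (simp add: reduced_hull_def)
  next
    case (Cons Q Qs1)
    define E0 where "E0 = strategy_op Qs"
    have disj1: "disjoint_blocks Qs1" and QQs1: "Q \<inter> \<Union>(set Qs1) = {}"
      using less.prems(1) Cons by auto
    have up: "contiguous_union Qs S" if "contiguous_union Qs1 S" for S
      using that by (simp add: Cons contiguous_union_Cons)
    note contig1 = contiguous_union_reduced_words[where Qs = Qs1]
    have IH1: "strategy_op \<omega> ** strategy_op Qs1 \<in> reduced_hull Qs1"
      if "\<And>S. S \<in> set \<omega> \<Longrightarrow> contiguous_union Qs1 S" for \<omega>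
      using less.hyps[of Qs1 \<omega>] that disj1 by (simp add: Cons)
    have memI: "strategy_op \<tau> ** E0 \<in> reduced_hull Qs" if "\<tau> \<in> reduced_words Qs" for \<tau>
      using that by (auto simp: reduced_hull_def E0_def intro!: hull_inc)
    have red1: "\<tau> \<in> reduced_words Qs" if "\<tau> \<in> reduced_words Qs1" for \<tau>
      using that by (simp add: Cons)
    have red2: "\<tau>\<^sub>1 @ [Q \<union> \<Union>(set ys)] @ \<tau>\<^sub>2 \<in> reduced_words Qs"
      if "\<tau>\<^sub>1 \<in> reduced_words Qs1" "\<tau>\<^sub>2 \<in> reduced_words Qs1" "Qs1 = ys @ zs" "ys \<noteq> []"
      for \<tau>\<^sub>1 \<tau>\<^sub>2 ys zs using that unfolding Cons reduced_words.simps by blast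
    \<comment> \<open>Block averages commute with averages over contiguous unions, so they can be
      moved to the right end and absorbed by \<open>E0\<close>.\<close>
    have absorb: "strategy_op Rs ** strategy_op \<omega> ** E0 = strategy_op \<omega> ** E0"
      if "\<And>S. S \<in> set \<omega> \<Longrightarrow> contiguous_union Qs S" "set Rs \<subseteq> set Qs" "strategy_op Rs ** E0 = E0" for \<omega> Rs
    proof -
      have "strategy_op Rs ** strategy_op \<omega> = strategy_op \<omega> ** strategy_op Rs"
        using that contiguous_union_block[OF less.prems(1)] by (intro strategy_op_commute) blast
      from matrix_mul_eq_assoc2[OF this, of E0] show ?thesis
        using that(3) by (simp add: matrix_mul_assoc [symmetric])
    qed
    have E0: "E0 = strategy_op Qs1 ** averaging_op Q"
      by (simp add: E0_def Cons strategy_op_Cons)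
    have EE0: "strategy_op Qs1 ** E0 = E0"
      by (simp add: E0 matrix_mul_assoc strategy_op_blocks_idem disj1)

    \<comment> \<open>A middle segment over the tail chain may be replaced by reduced words. The
      factor \<open>strategy_op Qs1\<close> that the induction hypothesis demands is drawn from
      \<open>E0\<close> through \<mu>.\<close>
    have push: "strategy_op (\<mu> @ \<omega> @ \<rho>) ** E0 \<in> reduced_hull Qs"
      if \<omega>: "\<And>S. S \<in> set \<omega> \<Longrightarrow> contiguous_union Qs1 S"
        and \<mu>: "\<And>S. S \<in> set \<mu> \<Longrightarrow> contiguous_union Qs S"
        and *: "\<And>\<tau>. \<tau> \<in> reduced_words Qs1 \<Longrightarrow> strategy_op (\<mu> @ \<tau> @ \<rho>) ** E0 \<in> reduced_hull Qs"
      for \<mu> \<omega> \<rho>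
    proof -
      define f where "f X = strategy_op \<rho> ** X ** (strategy_op \<mu> ** E0)" for X :: "real^'v^'v"
      have "linear f"
        unfolding f_def
        using linear_compose[OF linear_matrix_mult_left linear_matrix_mult_right] by (simp add: o_def)
      have "strategy_op Qs1 ** strategy_op \<mu> ** E0 = strategy_op \<mu> ** E0"
        using \<mu> EE0 by (intro absorb) (auto simp: Cons)
      then have f: "f (strategy_op \<tau> ** strategy_op Qs1) = strategy_op (\<mu> @ \<tau> @ \<rho>) ** E0" for \<tau>
        by (simp add: f_def strategy_op_append matrix_mul_assoc [symmetric])
      have "f (strategy_op \<omega> ** strategy_op Qs1) \<in> reduced_hull Qs"
        unfolding reduced_hull_def[of Qs]
        by (rule convex_hull_linear_mem[OF \<open>linear f\<close> _ IH1[unfolded reduced_hull_def]])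
          (use * f \<omega> in \<open>auto simp: reduced_hull_def\<close>)
      then show ?thesis by (simp add: f)
    qed

    \<comment> \<open>It suffices to append one letter to a reduced word, since left multiplication
      is linear; \<open>closed\<close> then builds up the whole word.\<close>
    have gen: "averaging_op I ** (strategy_op \<tau> ** E0) \<in> reduced_hull Qs"
      if I: "contiguous_union Qs I" and \<tau>: "\<tau> \<in> reduced_words Qs" for I \<tau>
    proof -
      have eq: "averaging_op I ** (strategy_op \<tau> ** E0) = strategy_op (\<tau> @ [I]) ** E0"
        by (simp add: strategy_op_append matrix_mul_assoc)
      consider (inner) "\<tau> \<in> reduced_words Qs1" | (outer) \<tau>\<^sub>1 \<tau>\<^sub>2 ys zs where
          "\<tau> = \<tau>\<^sub>1 @ [Q \<union> \<Union>(set ys)] @ \<tau>\<^sub>2" "\<tau>\<^sub>1 \<in> reduced_words Qs1"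
          "\<tau>\<^sub>2 \<in> reduced_words Qs1" "Qs1 = ys @ zs" "ys \<noteq> []"
        using \<tau> unfolding Cons reduced_words.simps by blast
      note \<tau>_cases = this
      consider (single) "I = Q" | (first) ys zs where "Qs1 = ys @ zs" "ys \<noteq> []" "I = Q \<union> \<Union>(set ys)"
        | (tail) "contiguous_union Qs1 I"
        using I unfolding Cons contiguous_union_Cons by blast
      then show ?thesis
      proof cases
        \<comment> \<open>No effect: the average over Q alone commutes down to \<open>E0\<close>, or
          is absorbed by the letter that contains Q.\<close>
        case single
        have comm: "averaging_op Q ** strategy_op \<omega> = strategy_op \<omega> ** averaging_op Q"
          if "\<omega> \<in> reduced_words Qs1" for \<omega>
          using contiguous_union_reduced_words[OF that] contiguous_union_subset QQs1
          by (intro averaging_op_strategy_op_commute) blast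
        have QE: "averaging_op Q ** E0 = E0"
        proof -
          have "averaging_op Q ** strategy_op Qs1 = strategy_op Qs1 ** averaging_op Q"
            using QQs1 by (intro averaging_op_strategy_op_commute) auto
          from matrix_mul_eq_assoc2[OF this, of "averaging_op Q"] show ?thesis unfolding E0
            by (simp add: averaging_op_absorb)
        qed
        have "averaging_op Q ** (strategy_op \<tau> ** E0) = strategy_op \<tau> ** E0"
          using \<tau>_cases
        proof cases
          case inner
          then show ?thesis using matrix_mul_eq_assoc2[OF comm, of \<tau> E0] QE by simp
        next
          case outer
          have "averaging_op Q ** averaging_op (Q \<union> \<Union>(set ys)) = averaging_op (Q \<union> \<Union>(set ys))"
            by (simp add: averaging_op_absorb)
          note QI = matrix_mul_eq_assoc[OF this]
          have "averaging_op Q ** strategy_op \<tau> = strategy_op \<tau>"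
            by (simp add: outer(1) strategy_op_append strategy_op_Cons matrix_mul_assoc [symmetric]
                QI matrix_mul_eq_assoc2[OF comm[OF outer(3)]])
          then show ?thesis by (simp add: matrix_mul_assoc)
        qed
        then show ?thesis using memI[OF \<tau>] single by simp
      next
        case tail
        show ?thesis
          using \<tau>_cases
        proof cases
          case inner
          have "strategy_op ([] @ (\<tau> @ [I]) @ []) ** E0 \<in> reduced_hull Qs"
          proof (rule push)
            show "contiguous_union Qs1 S" if "S \<in> set (\<tau> @ [I])" for S
              using that contig1[OF inner] tail by auto
            show "strategy_op ([] @ \<tau>' @ []) ** E0 \<in> reduced_hull Qs" if "\<tau>' \<in> reduced_words Qs1" for \<tau>'
              using memI[OF red1[OF that]] by simp
          qed simp
          then show ?thesis unfolding eq by simp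
        next
          case outer
          have "strategy_op ((\<tau>\<^sub>1 @ [Q \<union> \<Union>(set ys)]) @ (\<tau>\<^sub>2 @ [I]) @ []) ** E0 \<in> reduced_hull Qs"
          proof (rule push)
            have "contiguous_union Qs (Q \<union> \<Union>(set ys))"
              unfolding Cons contiguous_union_Cons using outer(4,5) by blast
            then show "contiguous_union Qs S" if "S \<in> set (\<tau>\<^sub>1 @ [Q \<union> \<Union>(set ys)])" for S
              using that up[OF contig1[OF outer(2)]] by auto
          next
            show "contiguous_union Qs1 S" if "S \<in> set (\<tau>\<^sub>2 @ [I])" for S
              using that contig1[OF outer(3)] tail by auto
          next
            fix \<tau>' assume "\<tau>' \<in> reduced_words Qs1"
            then show "strategy_op ((\<tau>\<^sub>1 @ [Q \<union> \<Union> (set ys)]) @ \<tau>' @ []) ** E0 \<in> reduced_hull Qs"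
              using memI[OF red2[OF outer(2) _ outer(4,5)]] by simp
          qed
          then show ?thesis unfolding eq by (simp add: outer(1))
        qed
      next
        case first
        show ?thesis
          using \<tau>_cases
        proof cases
          case inner
          then show ?thesis
            unfolding eq using memI[OF red2[OF inner _ first(1,2)], of "[]"] first(3) by simp
        next
          \<comment> \<open>Two letters contain Q, and since they reach beyond Q they contain
            \<open>Q2\<close> as well. Between them \<open>\<tau>\<^sub>2\<close> has at most one
            letter meeting \<open>Q2\<close>, the only obstacle to merging Q and
            \<open>Q2\<close>.\<close>
          case outer
          obtain Q2 Qs' where Qs1: "Qs1 = Q2 # Qs'"
            using first(1,2) by (metis append_is_Nil_conv list.exhaust)
          define Q12 where "Q12 = Q \<union> Q2"
          define R where "R = Q12 # Qs'"
          have Q2: "Q2 \<noteq> {}" "Q2 \<inter> \<Union>(set Qs') = {}" "disjoint_blocks Qs'"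
            using disj1 Qs1 by auto
          have Q12: "Q12 \<inter> \<Union>(set Qs') = {}" "Q12 \<noteq> {}"
            using Q2 QQs1 Qs1 by (auto simp: Q12_def)
          have disjR: "disjoint_blocks R" unfolding R_def using Q12 Q2 by simp
          have Q12_contig: "contiguous_union Qs Q12"
            unfolding Cons contiguous_union_Cons Qs1 Q12_def
            by (intro disjI2 disjI1 exI[of _ "[Q2]"] exI[of _ Qs']) simp
          have PR: "strategy_op R = strategy_op Qs' ** averaging_op Q12"
            by (simp add: R_def strategy_op_Cons)
          have EE1: "strategy_op Qs' ** E0 = E0"
            by (simp add: E0 Qs1 strategy_op_Cons matrix_mul_assoc strategy_op_blocks_idem Q2)
          have comm12: "averaging_op Q12 ** strategy_op \<omega> = strategy_op \<omega> ** averaging_op Q12"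
            if "\<omega> \<in> reduced_words Qs'" for \<omega>
            using contiguous_union_reduced_words[OF that] contiguous_union_subset Q12
            by (intro averaging_op_strategy_op_commute) blast
          have red': "\<omega> \<in> reduced_words Qs1" if "\<omega> \<in> reduced_words Qs'" for \<omega>
            using that by (simp add: Qs1)
          \<comment> \<open>Once an average over \<open>Q12\<close> has been made, a word over the
            merged chain R is reduced by the induction hypothesis, and the outcome is rewritten as a
            combination of reduced words over Qs.\<close>
          have lump: "strategy_op (\<mu> @ [Q12] @ \<omega>) ** E0 \<in> reduced_hull Qs"
            if \<omega>: "\<And>S. S \<in> set \<omega> \<Longrightarrow> contiguous_union R S" and \<mu>: "\<mu> \<in> reduced_words Qs1"
            for \<mu> \<omega>
          proof -
            have contig: "contiguous_union Qs S" if "S \<in> set (\<mu> @ [Q12])" for S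
              using that Q12_contig up[OF contig1[OF \<mu>]] by auto
            define f where "f X = X ** (strategy_op \<mu> ** E0)" for X :: "real^'v^'v"
            have "linear f" unfolding f_def by (rule linear_matrix_mult_right)
            have "strategy_op Qs' ** strategy_op (\<mu> @ [Q12]) ** E0 = strategy_op (\<mu> @ [Q12]) ** E0"
              by (rule absorb[OF contig _ EE1]) (auto simp: Cons Qs1)
            then have f: "f (strategy_op \<tau> ** strategy_op R) = strategy_op (\<mu> @ [Q12] @ \<tau>) ** E0" for \<tau>
              by (simp add: f_def PR strategy_op_append strategy_op_Cons matrix_mul_assoc [symmetric])
            have lumped: "strategy_op (\<mu> @ [Q12] @ \<rho>) ** E0 \<in> reduced_hull Qs" if \<rho>: "\<rho> \<in> reduced_words R" for \<rho>
            proof -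
              consider "\<rho> \<in> reduced_words Qs'" | \<rho>\<^sub>1 \<rho>\<^sub>2 ys zs where
                "\<rho> = \<rho>\<^sub>1 @ [Q12 \<union> \<Union>(set ys)] @ \<rho>\<^sub>2" "\<rho>\<^sub>1 \<in> reduced_words Qs'"
                "\<rho>\<^sub>2 \<in> reduced_words Qs'" "Qs' = ys @ zs"
                using \<rho> unfolding R_def reduced_words.simps by blast
              then show ?thesis
              proof cases
                case 1
                then show ?thesis
                  using memI[OF red2[OF \<mu> red', of \<rho> "[Q2]" Qs']] by (simp add: Qs1 Q12_def)
              next
                case 2
                \<comment> \<open>\<open>I1\<close> absorbs the earlier \<open>Q12\<close>, which
                  frees \<open>\<mu> @ \<rho>\<^sub>1\<close> from Q, so \<open>push\<close>
                  applies.\<close>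
                define I1 where "I1 = Q12 \<union> \<Union>(set ys)"
                have "averaging_op I1 ** averaging_op Q12 = averaging_op I1"
                  by (simp add: I1_def averaging_op_absorb)
                then have "averaging_op I1 ** (strategy_op \<rho>\<^sub>1 ** averaging_op Q12) = averaging_op I1 ** strategy_op \<rho>\<^sub>1"
                  by (simp add: comm12[OF 2(2), symmetric] matrix_mul_assoc)
                note absorb12 = matrix_mul_eq_assoc[OF this]
                have "strategy_op (\<mu> @ [Q12] @ \<rho>) = strategy_op ([] @ (\<mu> @ \<rho>\<^sub>1) @ ([I1] @ \<rho>\<^sub>2))"
                  unfolding 2(1) I1_def[symmetric]
                  by (simp add: strategy_op_append strategy_op_Cons matrix_mul_assoc [symmetric]
                      absorb12[unfolded matrix_mul_assoc[symmetric]])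
                moreover have "strategy_op ([] @ (\<mu> @ \<rho>\<^sub>1) @ ([I1] @ \<rho>\<^sub>2)) ** E0 \<in> reduced_hull Qs"
                proof (rule push)
                  show "contiguous_union Qs1 S" if "S \<in> set (\<mu> @ \<rho>\<^sub>1)" for S
                    using that contig1[OF \<mu>] contig1[OF red'[OF 2(2)]] by auto
                  show "strategy_op ([] @ \<tau>' @ [I1] @ \<rho>\<^sub>2) ** E0 \<in> reduced_hull Qs"
                    if "\<tau>' \<in> reduced_words Qs1" for \<tau>'
                    using memI[OF red2[OF that red'[OF 2(3)], of "Q2 # ys" zs]] 2(4)
                    by (simp add: Qs1 I1_def Q12_def Un_assoc)
                qed simp
                ultimately show ?thesis by simp
              qed
            qed
            have "f (strategy_op \<omega> ** strategy_op R) \<in> reduced_hull Qs"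
              unfolding reduced_hull_def[of Qs]
            proof (rule convex_hull_linear_mem[OF \<open>linear f\<close>])
              show "strategy_op \<omega> ** strategy_op R \<in>
                  convex hull ((\<lambda>\<tau>. strategy_op \<tau> ** strategy_op R) ` reduced_words R)"
                using less.hyps[OF _ disjR \<omega>] unfolding reduced_hull_def by (simp add: R_def Cons Qs1)
              show "f X \<in> convex hull ((\<lambda>\<tau>. strategy_op \<tau> ** strategy_op Qs) ` reduced_words Qs)"
                if "X \<in> (\<lambda>\<tau>. strategy_op \<tau> ** strategy_op R) ` reduced_words R" for X
                using that lumped f unfolding reduced_hull_def by auto
            qed
            then show ?thesis by (simp add: f)
          qed
          have contigR: "contiguous_union R S" if "contiguous_union Qs' S" for S
            using that by (simp add: R_def contiguous_union_Cons)
          define I0 where "I0 = Q \<union> \<Union>(set ys)"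
          have lump_contig: "contiguous_union R (Q \<union> \<Union>(set us)) \<and> Q12 \<subseteq> Q \<union> \<Union>(set us)"
            if us: "Qs1 = us @ vs" "us \<noteq> []" for us vs
          proof -
            obtain us0 where "us = Q2 # us0" "Qs' = us0 @ vs" using us Qs1 by (metis append_eq_Cons_conv)
            then have "Q \<union> \<Union>(set us) = Q12 \<union> \<Union>(set us0)" "Qs' = us0 @ vs"
              by (auto simp: Q12_def)
            then show ?thesis unfolding R_def contiguous_union_Cons
              by (cases "us0 = []") auto
          qed
          have I0: "contiguous_union R I0" "Q12 \<subseteq> I0"
            using lump_contig[OF outer(4,5)] by (auto simp: I0_def)
          have IR: "contiguous_union R I" "Q12 \<subseteq> I"
            using lump_contig[OF first(1,2)] first(3) by auto
          have I0Q: "averaging_op I0 ** averaging_op Q12 = averaging_op I0"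
            "averaging_op Q12 ** averaging_op I0 = averaging_op I0"
            and IQ: "averaging_op I ** averaging_op Q12 = averaging_op I"
            using I0 IR by (auto simp: averaging_op_absorb)
          have \<tau>: "\<tau> = \<tau>\<^sub>1 @ [I0] @ \<tau>\<^sub>2" by (simp add: outer(1) I0_def)
          consider (none) "\<tau>\<^sub>2 \<in> reduced_words Qs'" | (some) \<sigma>\<^sub>1 \<sigma>\<^sub>2 us vs where
            "\<tau>\<^sub>2 = \<sigma>\<^sub>1 @ [Q2 \<union> \<Union>(set us)] @ \<sigma>\<^sub>2" "\<sigma>\<^sub>1 \<in> reduced_words Qs'"
            "\<sigma>\<^sub>2 \<in> reduced_words Qs'" "Qs' = us @ vs" "us \<noteq> []"
            using outer(3) unfolding Qs1 reduced_words.simps by blast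
          then show ?thesis
          proof cases
            case none
            \<comment> \<open>\<open>I0\<close> absorbs \<open>Q12\<close>, so inserting
              \<open>Q12\<close> before it changes nothing, and all later letters respect the merged
              chain.\<close>
            have "strategy_op (\<tau>\<^sub>1 @ [Q12] @ ([I0] @ \<tau>\<^sub>2 @ [I])) ** E0 \<in> reduced_hull Qs"
            proof (rule lump)
              show "contiguous_union R S" if "S \<in> set ([I0] @ \<tau>\<^sub>2 @ [I])" for S
                using that I0(1) IR(1) contigR[OF contiguous_union_reduced_words[OF none]] by auto
            qed (rule outer(2))
            moreover have "strategy_op (\<tau>\<^sub>1 @ [Q12] @ ([I0] @ \<tau>\<^sub>2 @ [I])) = strategy_op (\<tau> @ [I])"
              unfolding \<tau> by (simp add: strategy_op_append strategy_op_Cons matrix_mul_assoc [symmetric]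
                  matrix_mul_eq_assoc[OF I0Q(1)])
            ultimately show ?thesis unfolding eq by simp
          next
            case some
            define T where "T = Q2 \<union> \<Union>(set us)"
            define U where "U = \<Union>(set us)"
            define V where "V = Q12 \<union> U"
            have "Q12 \<inter> T \<noteq> {}" using Q2 by (auto simp: T_def Q12_def)
            then obtain l where l: "0 \<le> l" "l \<le> 1" and
              sand: "averaging_op Q12 ** averaging_op T ** averaging_op Q12
                 = l *\<^sub>R (averaging_op Q12 ** averaging_op (T - Q12)) + (1 - l) *\<^sub>R averaging_op (Q12 \<union> T)"
              by (rule averaging_op_sandwich)
            have TU: "T - Q12 = U" "Q12 \<union> T = V"
              using Q12 some(4) by (auto simp: T_def U_def V_def Q12_def)
            have U: "contiguous_union R U" "contiguous_union R V"
            proof -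
              have "contiguous_union Qs' U"
                unfolding contiguous_union_def U_def using some(4,5) by (metis append_Nil)
              then show "contiguous_union R U" by (rule contigR)
              show "contiguous_union R V"
                unfolding R_def contiguous_union_Cons V_def U_def using some(4,5) by blast
            qed
            \<comment> \<open>\<open>X Y\<close> is the word with Y in place of T.
              \<open>Q12\<close> may be inserted on either side of Y: it commutes with
              \<open>\<sigma>\<^sub>1\<close> and \<open>\<sigma>\<^sub>2\<close> and is absorbed by
              \<open>I0\<close> and \<open>I\<close>. This puts T between two averages over
              \<open>Q12\<close>, as the sandwich identity requires.\<close>
            define X where "X Y = averaging_op I ** strategy_op \<sigma>\<^sub>2 ** Y ** (strategy_op \<sigma>\<^sub>1 ** averaging_op I0 ** strategy_op \<tau>\<^sub>1 ** E0)" for Y :: "real^'v^'v"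
            have "linear X"
              unfolding X_def
              using linear_compose[OF linear_matrix_mult_left linear_matrix_mult_right] by (simp add: o_def)
            have l12: "averaging_op I ** strategy_op \<sigma>\<^sub>2 ** averaging_op Q12 = averaging_op I ** strategy_op \<sigma>\<^sub>2"
              by (simp add: comm12[OF some(3), symmetric] matrix_mul_eq_assoc[OF IQ]
                  matrix_mul_assoc [symmetric])
            have r12: "averaging_op Q12 ** (strategy_op \<sigma>\<^sub>1 ** averaging_op I0 ** strategy_op \<tau>\<^sub>1 ** E0)
                = strategy_op \<sigma>\<^sub>1 ** averaging_op I0 ** strategy_op \<tau>\<^sub>1 ** E0"
              by (simp add: matrix_mul_assoc [symmetric] matrix_mul_eq_assoc2[OF comm12[OF some(2)]]
                  matrix_mul_eq_assoc[OF I0Q(2)])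
            have X12: "X (averaging_op Q12 ** Y) = X Y" "X (Y ** averaging_op Q12) = X Y" for Y
            proof -
              show "X (averaging_op Q12 ** Y) = X Y" unfolding X_def
                using matrix_mul_eq_assoc[OF l12] by (simp only: matrix_mul_assoc [symmetric])
              show "X (Y ** averaging_op Q12) = X Y" unfolding X_def
                using r12 by (simp only: matrix_mul_assoc [symmetric])
            qed
            have XS: "X (averaging_op S) = strategy_op (\<tau>\<^sub>1 @ [Q12] @ ([I0] @ \<sigma>\<^sub>1 @ [S] @ \<sigma>\<^sub>2 @ [I])) ** E0" for S
              unfolding X_def by (simp add: strategy_op_append strategy_op_Cons matrix_mul_assoc [symmetric]
                  matrix_mul_eq_assoc[OF I0Q(1)])
            have XK: "X (averaging_op S) \<in> reduced_hull Qs" if "contiguous_union R S" for S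
              unfolding XS
            proof (rule lump)
              show "contiguous_union R S'" if "S' \<in> set ([I0] @ \<sigma>\<^sub>1 @ [S] @ \<sigma>\<^sub>2 @ [I])" for S'
                using that \<open>contiguous_union R S\<close> I0(1) IR(1)
                  contigR[OF contiguous_union_reduced_words[OF some(2)]]
                  contigR[OF contiguous_union_reduced_words[OF some(3)]] by auto
            qed (rule outer(2))
            have "averaging_op I ** (strategy_op \<tau> ** E0) = X (averaging_op T)"
              unfolding X_def \<tau> some(1) T_def by (simp add: strategy_op_append strategy_op_Cons matrix_mul_assoc)
            also have "\<dots> = X (averaging_op Q12 ** averaging_op T ** averaging_op Q12)"
              by (simp add: X12)
            also have "\<dots> = l *\<^sub>R X (averaging_op U) + (1 - l) *\<^sub>R X (averaging_op V)"
              unfolding sand TU by (simp add: linear_add[OF \<open>linear X\<close>] linear_scale[OF \<open>linear X\<close>] X12)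
            also have "\<dots> \<in> reduced_hull Qs"
              using XK[OF U(1)] XK[OF U(2)] l unfolding reduced_hull_def
              by (intro convexD[OF convex_convex_hull]) auto
            finally show ?thesis .
          qed
        qed
      qed
    qed
    have closed: "averaging_op I ** M \<in> reduced_hull Qs"
      if "contiguous_union Qs I" "M \<in> reduced_hull Qs" for I M
      using that gen[OF that(1)] unfolding reduced_hull_def E0_def
      by (intro convex_hull_linear_mem[OF linear_matrix_mult_left _ that(2)[unfolded reduced_hull_def]]) auto
    show ?thesis
      using less.prems(2)
    proof (induction \<sigma> rule: rev_induct)
      case Nil
      show ?case using memI[of "[]"] by (simp add: E0_def)
    next
      case (snoc S \<sigma>)
      then show ?case using closed by (simp add: strategy_op_append matrix_mul_assoc [symmetric])
    qed
  qed
qed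

section \<open>Paths and branching graphs\<close>

text \<open>Stated by cuts and for an arbitrary relation, so that sets are enlarged or shown
  disconnected without handling walks.\<close>

definition linked :: "('a \<Rightarrow> 'a \<Rightarrow> bool) \<Rightarrow> 'a set \<Rightarrow> bool" where
  "linked E S \<longleftrightarrow> S \<noteq> {} \<and> (\<forall>H. H \<subset> S \<longrightarrow> H \<noteq> {} \<longrightarrow> (\<exists>u\<in>H. \<exists>v\<in>S - H. E u v))"

lemma linkedD: "linked E S \<Longrightarrow> H \<subset> S \<Longrightarrow> H \<noteq> {} \<Longrightarrow> \<exists>u\<in>H. \<exists>v\<in>S - H. E u v"
  by (simp add: linked_def)

lemma linked_nonempty: "linked E S \<Longrightarrow> S \<noteq> {}"
  by (simp add: linked_def)

text \<open>The vertices reachable from u form a part that no edge leaves; conversely reachability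
  cannot leave such a part. The symmetric closure in \<open>connected\<close> adds nothing, as the
  arcs of a \<open>graph\<close> are symmetric.\<close>

lemma connected_vertex_set_iff_linked:
  assumes "graph G" "verts G = UNIV"
  shows "connected_vertex_set G S \<longleftrightarrow> linked (\<lambda>u v. (u, v) \<in> arcs_ends G) S"
proof -
  interpret graph G by fact
  define r where "r = (arcs_ends (G \<restriction> S))\<^sup>s"
  have r: "(u, v) \<in> r \<longleftrightarrow> u \<in> S \<and> v \<in> S \<and> (u, v) \<in> arcs_ends G" for u v
  proof -
    have "(u, v) \<in> arcs_ends (G \<restriction> S) \<longleftrightarrow> u \<in> S \<and> v \<in> S \<and> (u, v) \<in> arcs_ends G" for u v
      by (auto simp: arcs_ends_def arc_to_ends_def image_iff)
    then show ?thesis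
      unfolding r_def symcl_def using graph_symmetric by auto
  qed
  have "(\<forall>u\<in>S. \<forall>v\<in>S. (u, v) \<in> rtrancl_on S r) \<longleftrightarrow>
        (\<forall>H. H \<subset> S \<longrightarrow> H \<noteq> {} \<longrightarrow> (\<exists>u\<in>H. \<exists>v\<in>S - H. (u, v) \<in> arcs_ends G))"
  proof (intro iffI allI impI ballI)
    fix H assume all: "\<forall>u\<in>S. \<forall>v\<in>S. (u, v) \<in> rtrancl_on S r" and H: "H \<subset> S" "H \<noteq> {}"
    obtain u v where uv: "u \<in> H" "v \<in> S" "v \<notin> H" using H by blast
    show "\<exists>u\<in>H. \<exists>v\<in>S - H. (u, v) \<in> arcs_ends G"
    proof (rule ccontr)
      assume no: "\<not> ?thesis"
      have "(u, v) \<in> rtrancl_on S r" using all H uv by blast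
      then have "u \<in> H \<longrightarrow> v \<in> H"
        by (induction rule: rtrancl_on_induct) (use no r in auto)
      with uv show False by blast
    qed
  next
    fix u v assume cut: "\<forall>H. H \<subset> S \<longrightarrow> H \<noteq> {} \<longrightarrow> (\<exists>u\<in>H. \<exists>v\<in>S - H. (u, v) \<in> arcs_ends G)"
      and uv: "u \<in> S" "v \<in> S"
    define H where "H = {w \<in> S. (u, w) \<in> rtrancl_on S r}"
    have "H = S"
    proof (rule ccontr)
      assume "H \<noteq> S"
      moreover have "u \<in> H" using uv by (simp add: H_def rtrancl_on_refl)
      ultimately obtain x y where "x \<in> H" "y \<in> S - H" "(x, y) \<in> arcs_ends G"
        using cut[rule_format, of H] by (auto simp: H_def)
      then show False
        using r by (auto simp: H_def intro: rtrancl_on_into_rtrancl_on)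
    qed
    then show "(u, v) \<in> rtrancl_on S r" using uv by (auto simp: H_def)
  qed
  then show ?thesis
    unfolding connected_vertex_set_def linked_def connected_conv
    by (simp add: assms(2) r_def)
qed

lemma linked_singleton [simp]: "linked E {v}"
  by (auto simp: linked_def)

lemma linked_Un:
  assumes "linked E S" "linked E T" "u \<in> S" "v \<in> T" "E u v" "symp E"
  shows "linked E (S \<union> T)"
  unfolding linked_def
proof (intro conjI allI impI)
  fix H assume H: "H \<subset> S \<union> T" "H \<noteq> {}"
  \<comment> \<open>If H splits neither S nor T, it is one of them and avoids the other, so the edge
    between u and v leaves it.\<close>
  consider "H \<inter> S \<noteq> {}" "\<not> S \<subseteq> H" | "H \<inter> T \<noteq> {}" "\<not> T \<subseteq> H" | "H = S" "T \<inter> H = {}" | "H = T" "S \<inter> H = {}"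
    using H by blast
  then show "\<exists>u\<in>H. \<exists>v\<in>S \<union> T - H. E u v"
  proof cases
    case 1
    then have "H \<inter> S \<subset> S" by blast
    then show ?thesis using linkedD[OF assms(1), of "H \<inter> S"] 1 by blast
  next
    case 2
    then have "H \<inter> T \<subset> T" by blast
    then show ?thesis using linkedD[OF assms(2), of "H \<inter> T"] 2 by blast
  next
    case 3
    then show ?thesis using assms by blast
  next
    case 4
    then show ?thesis using assms by (blast dest: sympD)
  qed
qed (use assms in auto)

lemma linked_insert:
  assumes "linked E S" "p \<in> S" "E x p" "symp E"
  shows "linked E (insert x S)"
  using linked_Un[of E "{x}" S x p] assms by simp

lemma linked_grow:
  assumes "linked E W" "U \<subset> W" "U \<noteq> {}" "symp E"
  obtains x p where "x \<in> W - U" "p \<in> U" "E x p"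
  using linkedD[OF assms(1-3)] assms(4) by (meson sympD)

text \<open>Existence of a vertex that is not a cut vertex: a connected proper subset of maximal
  size can be grown by a neighbour, so it misses only one vertex.\<close>

lemma linked_remove_vertex:
  assumes "linked E W" "finite W" "card W \<ge> 2" "symp E"
  obtains l where "l \<in> W" "linked E (W - {l})"
proof -
  define \<U> where "\<U> = {U. U \<subset> W \<and> linked E U}"
  obtain w where "w \<in> W" using linked_nonempty[OF assms(1)] by blast
  have "{w} \<noteq> W" using assms(3) by auto
  with \<open>w \<in> W\<close> have "{w} \<in> \<U>" by (auto simp: \<U>_def)
  moreover have "finite \<U>"
    using assms(2) by (auto simp: \<U>_def intro: finite_subset[of _ "Pow W"])
  ultimately have "Max (card ` \<U>) \<in> card ` \<U>" by (intro Max_in) auto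
  then obtain U where U: "U \<in> \<U>" "card U = Max (card ` \<U>)" by auto
  have max: "card U' \<le> card U" if "U' \<in> \<U>" for U'
    using that U(2) \<open>finite \<U>\<close> by simp
  have UW: "U \<subset> W" "linked E U" using U(1) by (auto simp: \<U>_def)
  obtain x p where xp: "x \<in> W - U" "p \<in> U" "E x p"
    using linked_grow[OF assms(1) UW(1) linked_nonempty[OF UW(2)] assms(4)] by blast
  have "insert x U \<notin> \<U>"
  proof
    assume "insert x U \<in> \<U>"
    from max[OF this] show False
      using xp finite_subset[of U W] UW assms(2) by auto
  qed
  moreover have "linked E (insert x U)"
    using UW xp assms(4) by (intro linked_insert)
  ultimately have "W = insert x U" using UW xp by (auto simp: \<U>_def)
  then have "W - {x} = U" using xp by auto
  then show thesis using that[of x] UW xp by auto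
qed

section \<open>Induced paths\<close>

text \<open>The equivalence makes this an induced path: chords are excluded, so that the connected
  subsets are exactly the segments.\<close>

definition path_order :: "('a \<Rightarrow> 'a \<Rightarrow> bool) \<Rightarrow> 'a list \<Rightarrow> bool" where
  "path_order E ps \<longleftrightarrow> distinct ps \<and>
     (\<forall>i<length ps. \<forall>j<length ps. E (ps ! i) (ps ! j) \<longleftrightarrow> i = Suc j \<or> j = Suc i)"

lemma path_order_iff:
  "path_order E ps \<Longrightarrow> i < length ps \<Longrightarrow> j < length ps \<Longrightarrow>
     E (ps ! i) (ps ! j) \<longleftrightarrow> i = Suc j \<or> j = Suc i"
  by (simp add: path_order_def)

lemma path_order_rev: "path_order E ps \<Longrightarrow> path_order E (rev ps)"
  unfolding path_order_def by (auto simp: rev_nth Suc_diff_Suc)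

lemma path_order_Cons:
  assumes "path_order E ps" "l \<notin> set ps" "\<not> E l l" "symp E"
    and "\<And>i. i < length ps \<Longrightarrow> E l (ps ! i) \<longleftrightarrow> i = 0"
  shows "path_order E (l # ps)"
  unfolding path_order_def
proof (intro conjI allI impI)
  have sym: "E (ps ! k) l \<longleftrightarrow> E l (ps ! k)" for k using assms(4) by (blast dest: sympD)
  fix i j assume "i < length (l # ps)" "j < length (l # ps)"
  then show "E ((l # ps) ! i) ((l # ps) ! j) \<longleftrightarrow> i = Suc j \<or> j = Suc i"
    using path_order_iff[OF assms(1)] assms(3,5) sym
    by (cases i; cases j) auto
qed (use assms in \<open>auto simp: path_order_def\<close>)

lemma linked_path_segment:
  assumes "path_order E ps" "symp E" "i < j" "j \<le> length ps"
  shows "linked E ((!) ps ` {i..<j})"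
  using assms(3,4)
proof (induction j)
  case (Suc j)
  show ?case
  proof (cases "i = j")
    case False
    then have "i < j" using Suc.prems by simp
    then have eq: "(!) ps ` {i..<Suc j} = insert (ps ! j) ((!) ps ` {i..<j})"
      by (auto simp: less_Suc_eq image_iff)
    show ?thesis unfolding eq
    proof (rule linked_insert)
      show "E (ps ! j) (ps ! (j - 1))"
        using path_order_iff[OF assms(1), of j "j - 1"] Suc.prems \<open>i < j\<close> by auto
    qed (use Suc \<open>i < j\<close> assms in auto)
  qed simp
qed simp

lemma set_take_drop_nth:
  assumes "a + k \<le> length ps"
  shows "set (take k (drop a ps)) = (!) ps ` {a..<a + k}"
proof -
  have "set (take k (drop a ps)) = (!) (drop a ps) ` {0..<k}"
    using assms by (subst nth_image) simp_all
  also have "\<dots> = (\<lambda>i. ps ! (a + i)) ` {0..<k}"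
    using assms by (intro image_cong) auto
  also have "\<dots> = (!) ps ` ((+) a ` {0..<k})"
    by (simp only: image_image)
  finally show ?thesis by (simp add: add.commute)
qed

text \<open>If an index between the least and the greatest index of S were missing, the members of S
  before it would have no edge to the rest of S.\<close>

lemma linked_subset_path_contiguous:
  assumes "path_order E ps" "linked E S" "S \<subseteq> set ps"
  shows "contiguous_union (map (\<lambda>p. {p}) ps) S"
proof -
  define I where "I = {i. i < length ps \<and> ps ! i \<in> S}"
  have S: "S = (!) ps ` I"
  proof (intro equalityI subsetI)
    fix x assume "x \<in> S"
    then obtain i where "i < length ps" "x = ps ! i" using assms(3) by (metis in_set_conv_nth subsetD)
    with \<open>x \<in> S\<close> show "x \<in> (!) ps ` I" by (auto simp: I_def)
  qed (auto simp: I_def)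
  have distinct: "distinct ps" using assms(1) by (simp add: path_order_def)
  have fin: "finite I" by (simp add: I_def)
  have "I \<noteq> {}" using S linked_nonempty[OF assms(2)] by blast
  define a b where "a = Min I" and "b = Max I"
  have ab: "a \<in> I" "b \<in> I" "\<And>i. i \<in> I \<Longrightarrow> a \<le> i" "\<And>i. i \<in> I \<Longrightarrow> i \<le> b"
    using fin \<open>I \<noteq> {}\<close> by (auto simp: a_def b_def)
  have inj: "inj_on ((!) ps) I"
    using distinct by (auto simp: I_def inj_on_def nth_eq_iff_index_eq)
  have mid: "k \<in> I" if k: "a \<le> k" "k \<le> b" for k
  proof (rule ccontr)
    assume "k \<notin> I"
    with ab have "k \<noteq> a" "k \<noteq> b" by auto
    with k have ak: "a < k" "k < b" by auto
    define H where "H = (!) ps ` {i \<in> I. i < k}"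
    have "H \<subseteq> S" "H \<noteq> {}" using S ab ak by (auto simp: H_def)
    moreover have "ps ! b \<in> S" using ab(2) unfolding S by blast
    moreover have "ps ! b \<notin> H"
    proof
      assume "ps ! b \<in> H"
      then obtain i where "i \<in> I" "i < k" "ps ! b = ps ! i" unfolding H_def by blast
      then show False using inj_onD[OF inj, of b i] ab(2) ak by simp
    qed
    ultimately have "H \<subset> S" by blast
    from linkedD[OF assms(2) this \<open>H \<noteq> {}\<close>] obtain u v where uv: "u \<in> H" "v \<in> S - H" "E u v"
      by blast
    obtain i where i: "i \<in> I" "i < k" "u = ps ! i" using uv(1) unfolding H_def by blast
    obtain j where j: "j \<in> I" "v = ps ! j" using uv(2) unfolding S by blast
    have "\<not> j < k" using uv(2) j unfolding H_def by blast
    note ij = i j(1) this j(2)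
    have "j \<noteq> k" "j \<ge> k" using ij \<open>k \<notin> I\<close> by auto
    then have "\<not> (i = Suc j \<or> j = Suc i)" using ij(2) by linarith
    then show False
      using path_order_iff[OF assms(1), of i j] ij(1,4) uv(3) unfolding ij(3,6) I_def by blast
  qed
  have I: "I = {a..b}"
    using ab(3,4) mid unfolding set_eq_iff atLeastAtMost_iff by blast
  define ys where "ys = take (Suc b - a) (drop a ps)"
  have b: "b < length ps" "a \<le> b" using ab by (auto simp: I_def)
  have "set ys = S"
  proof -
    have "set ys = (!) ps ` {a..<Suc b}"
    proof -
      have "a + (Suc b - a) = Suc b" "a + (Suc b - a) \<le> length ps" using b by linarith+
      then show ?thesis unfolding ys_def by (metis set_take_drop_nth)
    qed
    also have "\<dots> = S" unfolding S I atLeastLessThanSuc_atLeastAtMost ..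
    finally show ?thesis .
  qed
  have "take a ps @ ys @ drop (Suc b - a) (drop a ps) = ps"
    unfolding ys_def by (simp only: append_take_drop_id)
  note eq = arg_cong[OF this, of "map (\<lambda>p. {p})", unfolded map_append, symmetric]
  show ?thesis
    unfolding contiguous_union_def
  proof (intro exI conjI)
    show "map (\<lambda>p. {p}) ps = map (\<lambda>p. {p}) (take a ps) @ map (\<lambda>p. {p}) ys
        @ map (\<lambda>p. {p}) (drop (Suc b - a) (drop a ps))"
      by (rule eq)
    show "map (\<lambda>p. {p}) ys \<noteq> []" using b by (simp add: ys_def)
    show "S = \<Union>(set (map (\<lambda>p. {p}) ys))" unfolding \<open>set ys = S\<close>[symmetric] by simp
  qed
qed

lemma contiguous_path_linked:
  assumes "path_order E ps" "symp E" "contiguous_union (map (\<lambda>p. {p}) ps) S"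
  shows "linked E S" "S \<subseteq> set ps"
proof -
  obtain xs ys zs where *: "map (\<lambda>p. {p}) ps = xs @ ys @ zs" "ys \<noteq> []" "S = \<Union>(set ys)"
    using assms(3) unfolding contiguous_union_def by blast
  obtain us rs where rs: "ps = us @ rs" "map (\<lambda>p. {p}) rs = ys @ zs"
    using *(1) map_eq_append_conv[of "\<lambda>p. {p}" ps xs "ys @ zs"] by metis
  obtain vs ws where "rs = vs @ ws" "ys = map (\<lambda>p. {p}) vs"
    using rs(2) map_eq_append_conv[of "\<lambda>p. {p}" rs ys zs] by metis
  with rs(1) have ps: "ps = us @ vs @ ws" "ys = map (\<lambda>p. {p}) vs" by simp_all
  have S: "S = set vs" unfolding *(3) ps(2) by simp
  have len: "length us + length vs \<le> length ps" "0 < length vs" using ps *(2) by auto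
  have "take (length vs) (drop (length us) ps) = vs" by (simp add: ps(1))
  then have vs: "set vs = (!) ps ` {length us..<length us + length vs}"
    using set_take_drop_nth[OF len(1)] by simp
  show "linked E S"
    unfolding S vs using len by (intro linked_path_segment[OF assms(1,2)]) auto
  show "S \<subseteq> set ps" unfolding S ps(1) by auto
qed

section \<open>Sides and branching graphs\<close>

text \<open>Half of a partition of W into two connected parts, both nonempty by
  \<open>linked\<close>. Averaging over both parts is then a word of length 2.\<close>

definition side :: "('a \<Rightarrow> 'a \<Rightarrow> bool) \<Rightarrow> 'a set \<Rightarrow> 'a set \<Rightarrow> bool" where
  "side E W C \<longleftrightarrow> C \<subseteq> W \<and> linked E C \<and> linked E (W - C)"

text \<open>For subsets of W, the partitions {C, W - C} and {D, W - D} do not cross: one of the four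
  intersections of their parts is empty.\<close>

definition cross_free :: "'a set \<Rightarrow> 'a set \<Rightarrow> 'a set \<Rightarrow> bool" where
  "cross_free W C D \<longleftrightarrow> C \<inter> D = {} \<or> C \<subseteq> D \<or> D \<subseteq> C \<or> C \<union> D = W"

text \<open>The model is a spanning tree with root r: each tree edge from b to its child a yields
  the side C beyond it, and z v - z r telescopes along the branch to v. Only the resulting expansion
  is kept, so that without cut vertices the singletons, with differences to r, serve as
  well.\<close>

definition spanning_sides ::
    "('a \<Rightarrow> 'a \<Rightarrow> bool) \<Rightarrow> 'a set \<Rightarrow> 'a \<Rightarrow> ('a set \<times> 'a \<times> 'a) list \<Rightarrow> bool" where
  "spanning_sides E W r F \<longleftrightarrow> r \<in> W \<and> length F \<le> card W \<and>
     (\<forall>(C, a, b) \<in> set F. side E W C \<and> a \<in> W \<and> b \<in> W) \<and>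
     (\<forall>z :: 'a \<Rightarrow> real. \<forall>v\<in>W. z v = z r + (\<Sum>(C, a, b)\<leftarrow>F. if v \<in> C then z a - z b else 0))"

text \<open>The spanning family expands every deviation from the full average; X, Y, Z serve to
  switch signs. On a path all sides are initial or final segments, so no three are pairwise
  disjoint.\<close>

definition branching :: "('a \<Rightarrow> 'a \<Rightarrow> bool) \<Rightarrow> 'a set \<Rightarrow> bool" where
  "branching E W \<longleftrightarrow> linked E W \<and>
     (\<exists>r F X Y Z. spanning_sides E W r F \<and>
        side E W X \<and> side E W Y \<and> side E W Z \<and> X \<inter> Y = {} \<and> X \<inter> Z = {} \<and> Y \<inter> Z = {} \<and>
        (\<forall>C a b. (C, a, b) \<in> set F \<longrightarrow> cross_free W C X \<and> cross_free W C Y \<and> cross_free W C Z))"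

lemma branchingI:
  assumes "linked E W" "spanning_sides E W r F" "side E W X" "side E W Y" "side E W Z"
    and "X \<inter> Y = {}" "X \<inter> Z = {}" "Y \<inter> Z = {}"
    and "\<And>C a b. (C, a, b) \<in> set F \<Longrightarrow> cross_free W C X \<and> cross_free W C Y \<and> cross_free W C Z"
  shows "branching E W"
  unfolding branching_def using assms
  by (intro conjI exI[of _ r] exI[of _ F] exI[of _ X] exI[of _ Y] exI[of _ Z]) auto

lemma branchingE:
  assumes "branching E W"
  obtains r F X Y Z where "linked E W" "spanning_sides E W r F"
    "side E W X" "side E W Y" "side E W Z" "X \<inter> Y = {}" "X \<inter> Z = {}" "Y \<inter> Z = {}"
    "\<And>C a b. (C, a, b) \<in> set F \<Longrightarrow> cross_free W C X \<and> cross_free W C Y \<and> cross_free W C Z"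
  using assms unfolding branching_def by blast

lemma side_insert:
  assumes "side E U C" "x \<notin> U" "p \<in> U" "E x p" "symp E"
  shows "side E (insert x U) (if p \<in> C then insert x C else C)"
proof (cases "p \<in> C")
  case True
  then have "insert x U - insert x C = U - C" using assms(2) by auto
  with True show ?thesis using assms linked_insert[of E C p x] by (auto simp: side_def)
next
  case False
  then have "insert x U - C = insert x (U - C)" using assms(1,2) by (auto simp: side_def)
  with False show ?thesis using assms linked_insert[of E "U - C" p x] by (auto simp: side_def)
qed

text \<open>The new vertex x is made a twin of p in every set, so an empty intersection of parts
  stays empty.\<close>

lemma cross_free_insert:
  assumes "cross_free U C D" "C \<subseteq> U" "D \<subseteq> U" "x \<notin> U" "p \<in> U"
  shows "cross_free (insert x U) (if p \<in> C then insert x C else C) (if p \<in> D then insert x D else D)"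
proof -
  consider "C \<inter> D = {}" | "C \<subseteq> D" | "D \<subseteq> C" | "C \<union> D = U"
    using assms(1) unfolding cross_free_def by blast
  then show ?thesis
  proof cases
    case 1
    then have "(if p \<in> C then insert x C else C) \<inter> (if p \<in> D then insert x D else D) = {}"
      using assms(2-5) by auto
    then show ?thesis by (simp add: cross_free_def)
  next
    case 2
    then have "(if p \<in> C then insert x C else C) \<subseteq> (if p \<in> D then insert x D else D)"
      by auto
    then show ?thesis by (simp add: cross_free_def)
  next
    case 3
    then have "(if p \<in> D then insert x D else D) \<subseteq> (if p \<in> C then insert x C else C)"
      by auto
    then show ?thesis by (simp add: cross_free_def)
  next
    case 4
    then have "(if p \<in> C then insert x C else C) \<union> (if p \<in> D then insert x D else D) = insert x U"
      using assms(5) by auto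
    then show ?thesis by (simp add: cross_free_def)
  qed
qed

text \<open>Only the edge from x to p is used: old sides are extended with x as a twin of p, and the
  new side {x} supplies the difference between x and p. A singleton crosses nothing.\<close>

lemma branching_insert:
  assumes "branching E U" "finite U" "x \<notin> U" "p \<in> U" "E x p" "symp E"
  shows "branching E (insert x U)"
proof -
  from assms(1) obtain r F X Y Z where U: "linked E U" and F: "spanning_sides E U r F"
    and XYZ: "side E U X" "side E U Y" "side E U Z" "X \<inter> Y = {}" "X \<inter> Z = {}" "Y \<inter> Z = {}"
    and cf: "\<And>C a b. (C, a, b) \<in> set F \<Longrightarrow> cross_free U C X \<and> cross_free U C Y \<and> cross_free U C Z"
    by (rule branchingE) blast
  define ext where "ext C = (if p \<in> C then insert x C else C)" for C
  define F' where "F' = ({x}, x, p) # map (\<lambda>(C, a, b). (ext C, a, b)) F"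
  note Fd = F[unfolded spanning_sides_def]
  have sideF: "side E U C" "a \<in> U" "b \<in> U" if "(C, a, b) \<in> set F" for C a b
    using Fd that by auto
  have sub: "C \<subseteq> U" if "side E U C" for C using that by (simp add: side_def)
  have ext_side: "side E (insert x U) (ext C)" if "side E U C" for C
    unfolding ext_def using that assms by (intro side_insert) auto
  have x_side: "side E (insert x U) {x}"
    using U assms(3) by (simp add: side_def)
  have linked: "linked E (insert x U)" using U assms by (intro linked_insert) auto
  have cfx: "cross_free (insert x U) {x} (ext D)" for D
    by (auto simp: cross_free_def)
  have span: "spanning_sides E (insert x U) r F'"
    unfolding spanning_sides_def
  proof (intro conjI ballI allI)
    show "r \<in> insert x U" "length F' \<le> card (insert x U)"
      using Fd assms(2,3) by (auto simp: F'_def)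
    show "case t of (C, a, b) \<Rightarrow> side E (insert x U) C \<and> a \<in> insert x U \<and> b \<in> insert x U"
      if "t \<in> set F'" for t
      using that x_side assms(4) sideF ext_side by (auto simp: F'_def)
    fix z :: "'a \<Rightarrow> real" and v assume v: "v \<in> insert x U"
    have S: "(\<Sum>(C, a, b)\<leftarrow>F'. if v \<in> C then z a - z b else 0)
        = (if v = x then z x - z p else 0) + (\<Sum>(C, a, b)\<leftarrow>F. if v \<in> ext C then z a - z b else 0)" for v
    proof -
      have "(\<Sum>(C, a, b)\<leftarrow>map (\<lambda>(C, a, b). (ext C, a, b)) F. if v \<in> C then z a - z b else 0)
          = (\<Sum>(C, a, b)\<leftarrow>F. if v \<in> ext C then z a - z b else 0)"
        by (induction F) auto
      then show ?thesis by (simp add: F'_def)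
    qed
    define w where "w = (if v = x then p else v)"
    have w: "w \<in> U" using v assms(4) by (auto simp: w_def)
    have "(\<Sum>(C, a, b)\<leftarrow>F. if v \<in> ext C then z a - z b else 0)
        = (\<Sum>(C, a, b)\<leftarrow>F. if w \<in> C then z a - z b else 0)"
    proof (rule arg_cong[where f = sum_list], rule map_cong[OF refl], clarify)
      fix C a b assume "(C, a, b) \<in> set F"
      then have "C \<subseteq> U" using sideF sub by blast
      then have "v \<in> ext C \<longleftrightarrow> w \<in> C"
        using assms(3) v by (auto simp: ext_def w_def)
      then show "(if v \<in> ext C then z a - z b else 0) = (if w \<in> C then z a - z b else 0)" by simp
    qed
    moreover have "z w = z r + (\<Sum>(C, a, b)\<leftarrow>F. if w \<in> C then z a - z b else 0)"
      using Fd w by blast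
    ultimately show "z v = z r + (\<Sum>(C, a, b)\<leftarrow>F'. if v \<in> C then z a - z b else 0)"
      unfolding S by (auto simp: w_def)
  qed
  have cfX: "cross_free (insert x U) C (ext X) \<and> cross_free (insert x U) C (ext Y) \<and> cross_free (insert x U) C (ext Z)"
    if mem: "(C, a, b) \<in> set F'" for C a b
  proof -
    consider "C = {x}" | C' where "C = ext C'" "(C', a, b) \<in> set F" using mem by (auto simp: F'_def)
    then show ?thesis
    proof cases
      case 2
      have "cross_free (insert x U) (ext C') (ext D)" if "cross_free U C' D" "side E U D" for D
        unfolding ext_def using that sideF(1)[OF 2(2)] sub assms by (intro cross_free_insert) auto
      then show ?thesis using cf[OF 2(2)] XYZ 2(1) by blast
    qed (use cfx in blast)
  qed
  have "ext C \<inter> ext D = {}" if "C \<inter> D = {}" "side E U C" "side E U D" for C D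
    using that sub assms(3) by (auto simp: ext_def)
  then have extXYZ: "ext X \<inter> ext Y = {}" "ext X \<inter> ext Z = {}" "ext Y \<inter> ext Z = {}"
    using XYZ by blast+
  show ?thesis
    by (rule branchingI[OF linked span ext_side ext_side ext_side extXYZ cfX]) (rule XYZ | assumption)+
qed

lemma branching_mono:
  assumes "branching E U" "U \<subseteq> W" "linked E W" "finite W" "symp E"
  shows "branching E W"
  using assms(1,2)
proof (induction "card (W - U)" arbitrary: U)
  case 0
  then show ?case using assms(4) by auto
next
  case (Suc n)
  then have "linked E U" by (simp add: branching_def)
  then have "U \<noteq> {}" by (rule linked_nonempty)
  moreover have "U \<noteq> W" using Suc.hyps(2) by auto
  ultimately have "U \<subset> W" "U \<noteq> {}" using Suc.prems by auto
  then obtain x p where xp: "x \<in> W - U" "p \<in> U" "E x p"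
    using linked_grow[OF assms(3) _ _ assms(5)] by metis
  have "W - insert x U = W - U - {x}" by auto
  then have "n = card (W - insert x U)" using Suc.hyps(2) xp(1) assms(4) by simp
  moreover have "branching E (insert x U)"
    using Suc.prems xp assms finite_subset by (intro branching_insert) auto
  ultimately show ?case using Suc.hyps(1) Suc.prems(2) xp(1) by blast
qed

text \<open>Deleting a leaf leaves the rest connected through c, so the singleton leaves are sides.
  Edges between leaves do no harm, hence the claw need not be induced.\<close>

lemma branching_claw:
  assumes "E c x" "E c y" "E c z" "distinct [c, x, y, z]" "symp E"
  shows "branching E {c, x, y, z}"
proof -
  have E: "E x c" "E y c" "E z c" using assms by (auto dest: sympD)
  have l3: "linked E {c, u, v}" if "E u c" "E v c" for u v
    using linked_insert[OF linked_insert[OF linked_singleton _ that(2) assms(5)] _ that(1) assms(5), of c]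
    by (simp add: insert_commute)
  have l4: "linked E {c, x, y, z}"
    using linked_insert[OF l3[OF E(2,3)] _ E(1) assms(5)] by (simp add: insert_commute)
  have "{c, x, y, z} - {x} = {c, y, z}" "{c, x, y, z} - {y} = {c, x, z}" "{c, x, y, z} - {z} = {c, x, y}"
    using assms(4) by auto
  then have s: "side E {c, x, y, z} {x}" "side E {c, x, y, z} {y}" "side E {c, x, y, z} {z}"
    using l3 E by (auto simp: side_def)
  have span: "spanning_sides E {c, x, y, z} c [({x}, x, c), ({y}, y, c), ({z}, z, c)]"
    unfolding spanning_sides_def using s assms(4) by auto
  have cf: "cross_free {c, x, y, z} C {x} \<and> cross_free {c, x, y, z} C {y} \<and> cross_free {c, x, y, z} C {z}"
    if "(C, a, b) \<in> set [({x}, x, c), ({y}, y, c), ({z}, z, c)]" for C a b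
    using that by (auto simp: cross_free_def)
  have "{x} \<inter> {y} = {}" "{x} \<inter> {z} = {}" "{y} \<inter> {z} = {}" using assms(4) by auto
  from branchingI[OF l4 span s this cf] show ?thesis .
qed

text \<open>Without cut vertices all singletons are sides, so the differences to the one vertex x
  form a spanning family; singletons never cross.\<close>

lemma branching_two_connected:
  assumes "linked E W" "\<And>v. v \<in> W \<Longrightarrow> linked E (W - {v})" "finite W" "distinct [x, y, z]"
    and "{x, y, z} \<subseteq> W"
  shows "branching E W"
proof -
  obtain vs where vs: "set vs = W" "distinct vs" using finite_distinct_list[OF assms(3)] by blast
  define F where "F = map (\<lambda>v. ({v}, v, x)) vs"
  have s: "side E W {v}" if "v \<in> W" for v using assms(2) that by (simp add: side_def)
  have span: "spanning_sides E W x F"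
    unfolding spanning_sides_def
  proof (intro conjI ballI allI)
    show "length F \<le> card W" using vs by (auto simp: F_def distinct_card[symmetric])
    fix f :: "'a \<Rightarrow> real" and v assume v: "v \<in> W"
    have "(\<Sum>(C, a, b)\<leftarrow>F. if v \<in> C then f a - f b else 0) = (\<Sum>w\<leftarrow>vs. if w = v then f v - f x else 0)"
      by (auto simp: F_def o_def intro!: arg_cong[where f = sum_list])
    also have "\<dots> = (\<Sum>w\<in>W. if w = v then f v - f x else 0)"
      using vs by (simp add: sum_list_distinct_conv_sum_set)
    also have "\<dots> = f v - f x" using v assms(3) by simp
    finally show "f v = f x + (\<Sum>(C, a, b)\<leftarrow>F. if v \<in> C then f a - f b else 0)" by simp
  qed (use s assms(5) vs in \<open>auto simp: F_def\<close>)
  have cf: "cross_free W C {x} \<and> cross_free W C {y} \<and> cross_free W C {z}"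
    if "(C, a, b) \<in> set F" for C a b
    using that by (auto simp: F_def cross_free_def)
  have "side E W {x}" "side E W {y}" "side E W {z}" using s assms(5) by auto
  moreover have "{x} \<inter> {y} = {}" "{x} \<inter> {z} = {}" "{y} \<inter> {z} = {}" using assms(4) by auto
  ultimately show ?thesis by (rule branchingI[OF assms(1) span _ _ _ _ _ _ cf])
qed

text \<open>A cycle through l, with chords at l permitted: after deleting another vertex, the
  remaining segments are still attached to l by their ends.\<close>

lemma branching_cycle:
  assumes "path_order E ps" "symp E" "l \<notin> set ps" "length ps \<ge> 2"
    and "E l (ps ! 0)" "E l (ps ! (length ps - 1))"
  shows "branching E (insert l (set ps))"
proof (rule branching_two_connected)
  define n where "n = length ps"
  have n: "n \<ge> 2" using assms(4) by (simp add: n_def)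
  have set_ps: "set ps = (!) ps ` {0..<n}" by (auto simp: set_conv_nth n_def image_iff)
  have seg: "linked E ((!) ps ` {i..<j})" if "i < j" "j \<le> n" for i j
    using linked_path_segment[OF assms(1,2)] that by (simp add: n_def)
  have lps: "linked E (set ps)" using seg[of 0 n] n by (simp add: set_ps)
  show "linked E (insert l (set ps))"
    using lps assms(2,4,5) by (intro linked_insert[where p = "ps ! 0"]) (auto intro: nth_mem)
  show "linked E (insert l (set ps) - {v})" if v: "v \<in> insert l (set ps)" for v
  proof (cases "v = l")
    case True
    then show ?thesis using lps assms(3) by simp
  next
    case False
    with v obtain i where i: "i < n" "v = ps ! i" by (auto simp: in_set_conv_nth n_def)
    have inj: "ps ! j = ps ! i \<longleftrightarrow> j = i" if "j < n" for j
      using that i assms(1) by (auto simp: path_order_def nth_eq_iff_index_eq n_def)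
    have rem: "insert l (set ps) - {v} = insert l ((!) ps ` {0..<i} \<union> (!) ps ` {Suc i..<n})"
      (is "_ = insert l (?A \<union> ?B)")
    proof -
      have "{0..<n} = insert i ({0..<i} \<union> {Suc i..<n})" using i by auto
      then have "set ps = insert v (?A \<union> ?B)" by (simp add: set_ps i(2) image_Un)
      moreover have "v \<notin> ?A \<union> ?B"
      proof
        assume "v \<in> ?A \<union> ?B"
        then obtain j where "j \<in> {0..<i} \<union> {Suc i..<n}" "v = ps ! j" by blast
        then show False using inj[of j] i by auto
      qed
      ultimately have "set ps - {v} = ?A \<union> ?B" by blast
      then show ?thesis using False by auto
    qed
    have A: "linked E (insert l ?A)"
    proof (cases "i = 0")
      case False
      then show ?thesis using seg[of 0 i] i assms(2,5) by (intro linked_insert[where p = "ps ! 0"]) auto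
    qed simp
    have B: "linked E (insert l ?B)"
    proof (cases "Suc i = n")
      case False
      then show ?thesis
        using seg[of "Suc i" n] i assms(2,6)
        by (intro linked_insert[where p = "ps ! (n - 1)"] imageI) (auto simp: n_def)
    qed simp
    show ?thesis
    proof (cases "i = 0")
      case True
      then show ?thesis unfolding rem using B by simp
    next
      case False
      have "linked E (insert l ?B \<union> ?A)"
        using seg[of 0 i] i False B assms(2,5) by (intro linked_Un[where u = l and v = "ps ! 0"]) auto
      then show ?thesis unfolding rem by (simp add: Un_commute)
    qed
  qed
  show "distinct [l, ps ! 0, ps ! (n - 1)]"
  proof -
    have "ps ! 0 \<in> set ps" "ps ! (n - 1) \<in> set ps" using n by (auto simp: n_def intro!: nth_mem)
    moreover have "ps ! 0 \<noteq> ps ! (n - 1)"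
    proof
      assume eq: "ps ! 0 = ps ! (n - 1)"
      have "distinct ps" using assms(1) by (simp add: path_order_def)
      moreover have "0 < length ps" "n - 1 < length ps" using n unfolding n_def by linarith+
      ultimately have "0 = n - 1" using eq by (metis nth_eq_iff_index_eq)
      then show False using n by simp
    qed
    ultimately show ?thesis using assms(3) by auto
  qed
  show "{l, ps ! 0, ps ! (n - 1)} \<subseteq> insert l (set ps)"
    using nth_mem[of 0 ps] nth_mem[of "n - 1" ps] n unfolding n_def by fastforce
qed simp

text \<open>Delete a vertex l that is not a cut vertex. If the rest is a path, a neighbour of l in
  its interior is the centre of a claw, adjacency to both ends closes a cycle, and adjacency to one
  end only prolongs the path.\<close>

lemma path_or_branching:
  assumes "linked E W" "finite W" "symp E" "\<And>x. \<not> E x x"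
  shows "(\<exists>ps. path_order E ps \<and> set ps = W) \<or> branching E W"
  using assms(1,2)
proof (induction "card W" arbitrary: W rule: less_induct)
  case less
  show ?case
  proof (cases "card W \<ge> 2")
    case False
    moreover have "card W \<noteq> 0" using less.prems linked_nonempty by auto
    ultimately have "card W = 1" by linarith
    then obtain w where "W = {w}" by (auto simp: card_1_singleton_iff)
    moreover have "path_order E [w]" using assms(4) by (auto simp: path_order_def)
    ultimately show ?thesis by (metis list.set(1) list.simps(15))
  next
    case True
    then obtain l where l: "l \<in> W" "linked E (W - {l})"
      using linked_remove_vertex less.prems assms(3) by metis
    have W: "W = insert l (W - {l})" using l by auto
    have "card (W - {l}) < card W" using l less.prems(2) by (meson card_Diff1_less)
    then consider "branching E (W - {l})" | ps where "path_order E ps" "set ps = W - {l}"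
      using less.hyps l(2) less.prems(2) by (metis finite_Diff)
    then show ?thesis
    proof cases
      case 1
      then show ?thesis using branching_mono[of E "W - {l}" W] less.prems assms(3) by blast
    next
      case 2
      have lps: "l \<notin> set ps" "insert l (set ps) = W" using 2 W by auto
      obtain i0 where i0: "i0 < length ps" "E l (ps ! i0)"
      proof -
        obtain u v where "u \<in> {l}" "v \<in> W - {l}" "E u v"
          using linkedD[OF less.prems(1), of "{l}"] l W linked_nonempty[OF l(2)] by blast
        then show thesis using that 2(2) by (metis in_set_conv_nth singletonD)
      qed
      show ?thesis
      proof (cases "\<exists>i. 0 < i \<and> Suc i < length ps \<and> E l (ps ! i)")
        case True
        then obtain i where i: "0 < i" "Suc i < length ps" "E l (ps ! i)" by blast
        have "E (ps ! i) (ps ! (i - 1))" "E (ps ! i) (ps ! Suc i)"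
          using path_order_iff[OF 2(1)] i by auto
        moreover have "distinct [ps ! i, ps ! (i - 1), ps ! Suc i, l]"
          using 2(1) lps(1) i nth_mem[of i ps] nth_mem[of "i - 1" ps] nth_mem[of "Suc i" ps]
          by (auto simp: path_order_def nth_eq_iff_index_eq)
        ultimately have "branching E {ps ! i, ps ! (i - 1), ps ! Suc i, l}"
          using i(3) assms(3) by (intro branching_claw) (auto dest: sympD)
        moreover have "{ps ! i, ps ! (i - 1), ps ! Suc i, l} \<subseteq> W"
          using i lps(2) by auto
        ultimately show ?thesis using branching_mono less.prems assms(3) by blast
      next
        case False
        have ends: "i = 0 \<or> i = length ps - 1" if "i < length ps" "E l (ps ! i)" for i
        proof -
          have "\<not> (0 < i \<and> Suc i < length ps)" using False that(2) by blast
          then show ?thesis using that(1) by auto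
        qed
        \<comment> \<open>On a one-vertex path both ends coincide, and l then prolongs the
          path.\<close>
        show ?thesis
        proof (cases "length ps \<ge> 2 \<and> E l (ps ! 0) \<and> E l (ps ! (length ps - 1))")
          case True
          then show ?thesis using branching_cycle[OF 2(1) assms(3) lps(1)] lps(2) by auto
        next
          case False
          then consider "\<And>i. i < length ps \<Longrightarrow> E l (ps ! i) \<longleftrightarrow> i = 0"
            | "\<And>i. i < length ps \<Longrightarrow> E l (ps ! i) \<longleftrightarrow> i = length ps - 1"
          proof (cases "E l (ps ! 0)")
            case True
            have "E l (ps ! i) \<longleftrightarrow> i = 0" if "i < length ps" for i
            proof (cases "length ps \<ge> 2")
              case True
              then show ?thesis using ends[OF that] False \<open>E l (ps ! 0)\<close> by auto
            next
              case False
              then have "i = 0" using that by linarith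
              then show ?thesis using \<open>E l (ps ! 0)\<close> by simp
            qed
            then show ?thesis using that by blast
          next
            case False
            then have "E l (ps ! (length ps - 1))" using ends[OF i0] i0 by auto
            with False have "E l (ps ! i) \<longleftrightarrow> i = length ps - 1" if "i < length ps" for i
              using ends[OF that] by auto
            then show ?thesis using that by blast
          qed
          then have "\<exists>ps'. path_order E (l # ps') \<and> set ps' = set ps"
          proof cases
            case 1
            then show ?thesis using path_order_Cons[OF 2(1) lps(1) assms(4,3)] by blast
          next
            case 2
            then have "path_order E (l # rev ps)"
              using path_order_rev[OF \<open>path_order E ps\<close>] lps(1) assms(3,4)
              by (intro path_order_Cons) (auto simp: rev_nth)
            then show ?thesis by (metis set_rev)
          qed
          then show ?thesis using lps(2) by (metis list.simps(15))
        qed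
      qed
    qed
  qed
qed

section \<open>Contraction\<close>

definition energy :: "'v::finite set \<Rightarrow> real^'v \<Rightarrow> real" where
  "energy W z = (\<Sum>v\<in>W. (z $ v)\<^sup>2)"

text \<open>Averaging over S is an orthogonal projection, so by Pythagoras the loss is the squared
  distance to the mean on S.\<close>

lemma energy_averaging_op:
  fixes z :: "real^'v::finite"
  assumes "S \<subseteq> W"
  shows "energy W (averaging_op S *v z)
    = energy W z - (\<Sum>v\<in>S. (z $ v - (\<Sum>u\<in>S. z $ u) / card S)\<^sup>2)"
proof -
  define m where "m = (\<Sum>u\<in>S. z $ u) / card S"
  have sum: "(\<Sum>u\<in>S. z $ u) = card S * m" by (cases "S = {}") (simp_all add: m_def)
  have split: "energy W y = (\<Sum>v\<in>S. (y $ v)\<^sup>2) + (\<Sum>v\<in>W - S. (y $ v)\<^sup>2)" for y :: "real^'v"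
    unfolding energy_def using assms by (metis add.commute finite sum.subset_diff)
  have "(\<Sum>v\<in>S. (z $ v - m)\<^sup>2) = (\<Sum>v\<in>S. (z $ v)\<^sup>2) - 2 * m * (\<Sum>v\<in>S. z $ v) + card S * m\<^sup>2"
    by (simp add: power2_diff sum.distrib sum_subtractf sum_distrib_left algebra_simps)
  also have "\<dots> = (\<Sum>v\<in>S. (z $ v)\<^sup>2) - card S * m\<^sup>2"
    unfolding sum by (simp add: power2_eq_square)
  finally have var: "(\<Sum>v\<in>S. (z $ v - m)\<^sup>2) = (\<Sum>v\<in>S. (z $ v)\<^sup>2) - card S * m\<^sup>2" .
  have "(\<Sum>v\<in>S. ((averaging_op S *v z) $ v)\<^sup>2) = card S * m\<^sup>2"
    by (simp add: averaging_op_mult_vec m_def)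
  moreover have "(\<Sum>v\<in>W - S. ((averaging_op S *v z) $ v)\<^sup>2) = (\<Sum>v\<in>W - S. (z $ v)\<^sup>2)"
    by (intro sum.cong) (auto simp: averaging_op_mult_vec)
  ultimately show ?thesis
    unfolding split[of z] split[of "averaging_op S *v z"] m_def[symmetric] var by simp
qed

lemma energy_averaging_op_le:
  fixes z :: "real^'v::finite"
  assumes "S \<subseteq> W"
  shows "energy W (averaging_op S *v z) \<le> energy W z"
  using energy_averaging_op[OF assms, of z] by (simp add: sum_nonneg)

text \<open>Only a and b are kept in the loss, and (x - y)^2 \<le> 2 (x^2 + y^2).\<close>

lemma energy_averaging_op_drop:
  fixes z :: "real^'v::finite"
  assumes "S \<subseteq> W" "a \<in> S" "b \<in> S"
  shows "(z $ a - z $ b)\<^sup>2 \<le> 2 * (energy W z - energy W (averaging_op S *v z))"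
proof (cases "a = b")
  case True
  then show ?thesis using energy_averaging_op_le[OF assms(1), of z] by simp
next
  case False
  define m where "m = (\<Sum>u\<in>S. z $ u) / card S"
  have "(\<Sum>v\<in>{a, b}. (z $ v - m)\<^sup>2) \<le> (\<Sum>v\<in>S. (z $ v - m)\<^sup>2)"
    using assms by (intro sum_mono2) auto
  then have "(z $ a - m)\<^sup>2 + (z $ b - m)\<^sup>2 \<le> energy W z - energy W (averaging_op S *v z)"
    using False energy_averaging_op[OF assms(1), of z] by (simp add: m_def)
  moreover have "(z $ a - z $ b)\<^sup>2 \<le> 2 * ((z $ a - m)\<^sup>2 + (z $ b - m)\<^sup>2)"
    using zero_le_power2[of "(z $ a - m) + (z $ b - m)"] by (simp add: power2_eq_square algebra_simps)
  ultimately show ?thesis by (meson mult_left_mono order_trans zero_le_numeral)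
qed

lemma energy_strategy_op_le:
  fixes z :: "real^'v::finite"
  assumes "\<And>S. S \<in> set \<sigma> \<Longrightarrow> S \<subseteq> W"
  shows "energy W (strategy_op \<sigma> *v z) \<le> energy W z"
  using assms
proof (induction \<sigma> arbitrary: z)
  case (Cons S \<sigma>)
  have "energy W (strategy_op \<sigma> *v (averaging_op S *v z)) \<le> energy W (averaging_op S *v z)"
    using Cons by simp
  also have "\<dots> \<le> energy W z" using Cons.prems by (intro energy_averaging_op_le) simp
  finally show ?case by (simp add: strategy_op_Cons matrix_vector_mul_assoc)
qed simp

lemma sum_strategy_op:
  fixes z :: "real^'v::finite"
  assumes "\<And>S. S \<in> set \<sigma> \<Longrightarrow> S \<subseteq> W"
  shows "(\<Sum>v\<in>W. (strategy_op \<sigma> *v z) $ v) = (\<Sum>v\<in>W. z $ v)"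
  using assms
proof (induction \<sigma> arbitrary: z)
  case (Cons S \<sigma>)
  then show ?case
    using sum_averaging_op[of S W z] by (simp add: strategy_op_Cons matrix_vector_mul_assoc [symmetric])
qed simp

lemma sum_power2_le_power2_sum:
  fixes g :: "'a \<Rightarrow> real"
  assumes "finite I" "\<And>i. i \<in> I \<Longrightarrow> 0 \<le> g i"
  shows "(\<Sum>i\<in>I. (g i)\<^sup>2) \<le> (\<Sum>i\<in>I. g i)\<^sup>2"
  using assms
proof (induction I rule: finite_induct)
  case (insert x F)
  then have "0 \<le> g x * sum g F" by (simp add: sum_nonneg)
  then show ?case using insert by (simp add: power2_sum)
qed simp

text \<open>Each gap between consecutive values is charged to the first set that crosses it; until then no
  average can enter the gap.\<close>

lemma gap_energy:
  fixes x :: "real^'v::finite" and f :: "nat \<Rightarrow> real"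
  assumes "mono f" "finite I" "\<And>S. S \<in> set \<sigma> \<Longrightarrow> S \<subseteq> W"
    and "\<And>i v. i \<in> I \<Longrightarrow> v \<in> W \<Longrightarrow> v \<in> H i \<Longrightarrow> f (Suc i) \<le> x $ v"
    and "\<And>i v. i \<in> I \<Longrightarrow> v \<in> W \<Longrightarrow> v \<notin> H i \<Longrightarrow> x $ v \<le> f i"
    and "\<And>i. i \<in> I \<Longrightarrow> \<exists>S\<in>set \<sigma>. S \<inter> H i \<noteq> {} \<and> \<not> S \<subseteq> H i"
  shows "(\<Sum>i\<in>I. (f (Suc i) - f i)\<^sup>2) \<le> 2 * (energy W x - energy W (strategy_op \<sigma> *v x))"
  using assms(2-)
proof (induction \<sigma> arbitrary: x I)
  case Nil
  then have "I = {}" by auto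
  then show ?case by simp
next
  case (Cons S \<sigma>)
  define y where "y = averaging_op S *v x"
  \<comment> \<open>The gaps first crossed by S; for all others the separating bounds survive the
    averaging.\<close>
  define I1 where "I1 = {i \<in> I. S \<inter> H i \<noteq> {} \<and> \<not> S \<subseteq> H i}"
  have SW: "S \<subseteq> W" using Cons.prems(2) by simp
  have mono: "0 \<le> f (Suc i) - f i" for i using assms(1) by (simp add: mono_def)
  have rest: "(\<Sum>i\<in>I - I1. (f (Suc i) - f i)\<^sup>2) \<le> 2 * (energy W y - energy W (strategy_op \<sigma> *v y))"
  proof (rule Cons.IH)
    show "finite (I - I1)" using Cons.prems(1) by simp
    show "S' \<subseteq> W" if "S' \<in> set \<sigma>" for S' using Cons.prems(2) that by simp
    show "\<exists>S\<in>set \<sigma>. S \<inter> H i \<noteq> {} \<and> \<not> S \<subseteq> H i" if "i \<in> I - I1" for i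
      using Cons.prems(5)[of i] that by (auto simp: I1_def)
    fix i v assume i: "i \<in> I - I1" and v: "v \<in> W"
    have i': "i \<in> I" "S \<inter> H i = {} \<or> S \<subseteq> H i" using i by (auto simp: I1_def)
    have card: "v \<in> S \<Longrightarrow> real (card S) > 0" using card_gt_0_iff[of S] by auto
    show "f (Suc i) \<le> y $ v" if "v \<in> H i"
    proof (cases "v \<in> S")
      case True
      then have "S \<subseteq> H i" using i'(2) that by auto
      then have "of_nat (card S) * f (Suc i) \<le> (\<Sum>u\<in>S. x $ u)"
        using Cons.prems(3)[OF i'(1)] SW by (intro sum_bounded_below) auto
      then show ?thesis using True card by (simp add: y_def averaging_op_mult_vec field_simps)
    next
      case False
      then show ?thesis using Cons.prems(3)[OF i'(1) v that] by (simp add: y_def averaging_op_mult_vec)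
    qed
    show "y $ v \<le> f i" if "v \<notin> H i"
    proof (cases "v \<in> S")
      case True
      then have "S \<inter> H i = {}" using i'(2) that by auto
      then have "(\<Sum>u\<in>S. x $ u) \<le> of_nat (card S) * f i"
        using Cons.prems(4)[OF i'(1)] SW by (intro sum_bounded_above) auto
      then show ?thesis using True card by (simp add: y_def averaging_op_mult_vec field_simps)
    next
      case False
      then show ?thesis using Cons.prems(4)[OF i'(1) v that] by (simp add: y_def averaging_op_mult_vec)
    qed
  qed
  have first: "(\<Sum>i\<in>I1. (f (Suc i) - f i)\<^sup>2) \<le> 2 * (energy W x - energy W y)"
  proof (cases "I1 = {}")
    case True
    then show ?thesis using energy_averaging_op_le[OF SW, of x] by (simp add: y_def)
  next
    case False
    have fin: "finite I1" using Cons.prems(1) by (simp add: I1_def)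
    define p q where "p = Min I1" and "q = Max I1"
    have pq: "p \<in> I1" "q \<in> I1" "I1 \<subseteq> {p..q}"
      using False fin by (auto simp: p_def q_def)
    \<comment> \<open>S has a vertex below the lowest and one above the highest of these gaps, so
      one squared difference pays for all of them at once.\<close>
    obtain b where b: "b \<in> S" "b \<notin> H p" using pq(1) by (auto simp: I1_def)
    obtain a where a: "a \<in> S" "a \<in> H q" using pq(2) by (auto simp: I1_def)
    have xb: "x $ b \<le> f p" using Cons.prems(4) pq(1) b SW by (auto simp: I1_def)
    have xa: "f (Suc q) \<le> x $ a" using Cons.prems(3) pq(2) a SW by (auto simp: I1_def)
    have "(\<Sum>i\<in>I1. f (Suc i) - f i) \<le> (\<Sum>i\<in>{p..q}. f (Suc i) - f i)"
      using pq(3) mono by (intro sum_mono2) auto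
    also have "\<dots> = f (Suc q) - f p"
      using pq by (intro sum_Suc_diff) (auto simp: subset_iff)
    also have "\<dots> \<le> x $ a - x $ b" using xa xb by linarith
    finally have le: "(\<Sum>i\<in>I1. f (Suc i) - f i) \<le> x $ a - x $ b" .
    have "(\<Sum>i\<in>I1. (f (Suc i) - f i)\<^sup>2) \<le> (\<Sum>i\<in>I1. f (Suc i) - f i)\<^sup>2"
      using fin mono by (intro sum_power2_le_power2_sum) auto
    also have "\<dots> \<le> (x $ a - x $ b)\<^sup>2"
      using le mono by (intro power_mono) (auto intro: sum_nonneg)
    also have "\<dots> \<le> 2 * (energy W x - energy W y)"
      unfolding y_def by (rule energy_averaging_op_drop[OF SW a(1) b(1)])
    finally show ?thesis .
  qed
  have "(\<Sum>i\<in>I. (f (Suc i) - f i)\<^sup>2)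
      = (\<Sum>i\<in>I - I1. (f (Suc i) - f i)\<^sup>2) + (\<Sum>i\<in>I1. (f (Suc i) - f i)\<^sup>2)"
    using Cons.prems(1) by (intro sum.subset_diff) (auto simp: I1_def)
  with rest first show ?case
    by (simp add: strategy_op_Cons matrix_vector_mul_assoc [symmetric] y_def)
qed

section \<open>Contraction by crossing words\<close>

text \<open>Connectedness of the hypergraph on W whose edges are the letters of the word; their
  order does not matter.\<close>

definition crossing :: "'a set \<Rightarrow> 'a set list \<Rightarrow> bool" where
  "crossing W \<sigma> \<longleftrightarrow> (\<forall>H. H \<subset> W \<longrightarrow> H \<noteq> {} \<longrightarrow> (\<exists>S\<in>set \<sigma>. S \<inter> H \<noteq> {} \<and> \<not> S \<subseteq> H))"

text \<open>The sets \<open>H i\<close> are the upper level sets of z between consecutive values.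
  Crossing makes \<open>gap_energy\<close> apply to all gaps, of which there are fewer than |W|, and
  Cauchy-Schwarz passes from their squares to the square of the spread.\<close>

lemma crossing_spread:
  fixes z :: "real^'v::finite"
  assumes "crossing W \<sigma>" "\<And>S. S \<in> set \<sigma> \<Longrightarrow> S \<subseteq> W" "W \<noteq> {}"
  obtains lo hi :: real where "\<And>v. v \<in> W \<Longrightarrow> lo \<le> z $ v \<and> z $ v \<le> hi"
    "(hi - lo)\<^sup>2 \<le> 2 * real (card W) * (energy W z - energy W (strategy_op \<sigma> *v z))"
proof -
  define vals where "vals = sorted_list_of_set (($) z ` W)"
  define m where "m = length vals"
  have set: "set vals = ($) z ` W" and sorted: "sorted_wrt (<) vals"
    by (auto simp: vals_def)
  have m: "m > 0" "m \<le> card W"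
    using assms(3) by (auto simp: m_def vals_def card_gt_0_iff card_image_le)
  \<comment> \<open>Constant from the last value on, so that f is monotone on all natural
    numbers.\<close>
  define f where "f i = vals ! (min i (m - 1))" for i
  have strict: "vals ! i < vals ! j" if "i < j" "j < m" for i j
    using sorted that by (simp add: sorted_wrt_iff_nth_less m_def)
  have le: "vals ! i \<le> vals ! j" if "i \<le> j" "j < m" for i j
    using strict[of i j] that by (cases "i = j") auto
  have "mono f"
    unfolding f_def using m by (intro monoI le) auto
  define I where "I = {..<m - 1}"
  define H where "H i = {v \<in> W. f (Suc i) \<le> z $ v}" for i
  have idx: "\<exists>k<m. z $ v = vals ! k" if "v \<in> W" for v
    using set that by (metis image_eqI in_set_conv_nth m_def)
  have vtx: "\<exists>v\<in>W. z $ v = vals ! k" if "k < m" for k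
    using set that by (metis image_iff m_def nth_mem)
  have fI: "f i = vals ! i" "f (Suc i) = vals ! Suc i" "Suc i < m" if "i \<in> I" for i
    using that by (auto simp: f_def I_def min_def)
  have gap: "(\<Sum>i\<in>I. (f (Suc i) - f i)\<^sup>2) \<le> 2 * (energy W z - energy W (strategy_op \<sigma> *v z))"
  proof (rule gap_energy[where H = H])
    fix i v assume i: "i \<in> I" and v: "v \<in> W" "v \<notin> H i"
    obtain k where k: "k < m" "z $ v = vals ! k" using idx v(1) by blast
    have "vals ! k < vals ! Suc i" using v k fI[OF i] by (auto simp: H_def)
    then have "\<not> Suc i \<le> k" using le[of "Suc i" k] k(1) by auto
    then show "z $ v \<le> f i" using le[of k i] fI[OF i] k(2) by auto
  next
    fix i assume i: "i \<in> I"
    obtain u v where "u \<in> W" "z $ u = vals ! i" "v \<in> W" "z $ v = vals ! Suc i"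
      using vtx[of i] vtx[of "Suc i"] fI(3)[OF i] by auto
    then have "u \<notin> H i" "v \<in> H i" "u \<in> W"
      using strict[of i "Suc i"] fI[OF i] by (auto simp: H_def)
    then have "H i \<subset> W" "H i \<noteq> {}" by (auto simp: H_def)
    then show "\<exists>S\<in>set \<sigma>. S \<inter> H i \<noteq> {} \<and> \<not> S \<subseteq> H i"
      using assms(1) by (simp add: crossing_def)
  qed (use \<open>mono f\<close> assms(2) in \<open>auto simp: I_def H_def\<close>)
  have "(\<Sum>i\<in>I. f (Suc i) - f i) = f (m - 1) - f 0"
    unfolding I_def by (rule sum_lessThan_telescope)
  then have "(f (m - 1) - f 0)\<^sup>2 \<le> (\<Sum>i\<in>I. (f (Suc i) - f i)\<^sup>2) * card I"
    using sum_squared_le_sum_of_squares[of "\<lambda>i. f (Suc i) - f i" I] by simp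
  also have "\<dots> \<le> (2 * (energy W z - energy W (strategy_op \<sigma> *v z))) * card W"
    using gap m by (intro mult_mono) (auto simp: I_def sum_nonneg energy_strategy_op_le assms(2))
  finally have "(f (m - 1) - f 0)\<^sup>2 \<le> 2 * real (card W) * (energy W z - energy W (strategy_op \<sigma> *v z))"
    by (simp add: mult_ac)
  moreover have "f 0 \<le> z $ v \<and> z $ v \<le> f (m - 1)" if "v \<in> W" for v
    using idx[OF that] le m by (auto simp: f_def)
  ultimately show thesis using that by blast
qed

text \<open>Popoviciu's inequality for the variance, from summing (z - lo) (hi - z) \<ge> 0.\<close>

lemma energy_le_spread:
  fixes z :: "real^'v::finite" and lo hi :: real
  assumes "(\<Sum>v\<in>W. z $ v) = 0" "\<And>v. v \<in> W \<Longrightarrow> lo \<le> z $ v \<and> z $ v \<le> hi"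
  shows "4 * energy W z \<le> card W * (hi - lo)\<^sup>2"
proof -
  have "0 \<le> (\<Sum>v\<in>W. (z $ v - lo) * (hi - z $ v))"
    using assms(2) by (intro sum_nonneg) auto
  also have "\<dots> = (lo + hi) * (\<Sum>v\<in>W. z $ v) - energy W z - card W * (lo * hi)"
  proof -
    have "(z $ v - lo) * (hi - z $ v) = (lo + hi) * z $ v - (z $ v)\<^sup>2 - lo * hi" for v
      by (simp add: power2_eq_square algebra_simps)
    moreover have "(\<Sum>v\<in>W. lo * hi) = card W * (lo * hi)" by simp
    ultimately show ?thesis
      by (simp only: sum_subtractf sum_distrib_left[of "lo + hi", symmetric] energy_def)
  qed
  finally have "energy W z \<le> card W * (- (lo * hi))" using assms(1) by simp
  also have "\<dots> \<le> card W * ((hi - lo)\<^sup>2 / 4)"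
    using zero_le_power2[of "lo + hi"]
    by (intro mult_left_mono) (auto simp: power2_eq_square algebra_simps)
  finally show ?thesis by simp
qed

text \<open>Popoviciu's inequality bounds 4 times the energy by n (hi - lo)^2, and (hi - lo)^2 is at
  most 2 n times the loss; so the relative loss is at least 2/n^2.\<close>

lemma crossing_contraction:
  fixes z :: "real^'v::finite"
  assumes "crossing W \<sigma>" "\<And>S. S \<in> set \<sigma> \<Longrightarrow> S \<subseteq> W" "W \<noteq> {}" "(\<Sum>v\<in>W. z $ v) = 0"
  shows "energy W (strategy_op \<sigma> *v z) \<le> (1 - 2 / (card W)\<^sup>2) * energy W z"
proof -
  define n where "n = real (card W)"
  have n: "n > 0" using assms(3) by (simp add: n_def card_gt_0_iff)
  show ?thesis
  proof (rule crossing_spread[of W \<sigma> z])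
    fix lo hi :: real
    assume lohi: "\<And>v. v \<in> W \<Longrightarrow> lo \<le> z $ v \<and> z $ v \<le> hi"
      and drop: "(hi - lo)\<^sup>2 \<le> 2 * real (card W) * (energy W z - energy W (strategy_op \<sigma> *v z))"
    from assms(4) lohi have "4 * energy W z \<le> n * (hi - lo)\<^sup>2"
      unfolding n_def by (rule energy_le_spread)
    also have "\<dots> \<le> n * (2 * n * (energy W z - energy W (strategy_op \<sigma> *v z)))"
      using drop n by (intro mult_left_mono) (auto simp: n_def)
    finally have "2 * energy W z \<le> n\<^sup>2 * (energy W z - energy W (strategy_op \<sigma> *v z))"
      by (simp add: power2_eq_square)
    then have "2 * energy W z / n\<^sup>2 \<le> energy W z - energy W (strategy_op \<sigma> *v z)"
      using n by (simp add: divide_le_eq mult.commute)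
    then have "energy W (strategy_op \<sigma> *v z) \<le> energy W z - 2 * energy W z / n\<^sup>2" by linarith
    also have "\<dots> = (1 - 2 / n\<^sup>2) * energy W z"
      by (simp only: left_diff_distrib times_divide_eq_left mult_1_left)
    finally show ?thesis by (simp only: n_def of_nat_power)
  qed (use assms in auto)
qed

lemma crossing_blocks_contraction:
  fixes z :: "real^'v::finite"
  assumes "\<And>b. b \<in> set bs \<Longrightarrow> crossing W b \<and> (\<forall>S\<in>set b. S \<subseteq> W)"
    and "card W \<ge> 2" "(\<Sum>v\<in>W. z $ v) = 0"
  shows "energy W (strategy_op (concat bs) *v z) \<le> (1 - 2 / (card W)\<^sup>2) ^ length bs * energy W z"
  using assms(1,3)
proof (induction bs arbitrary: z)
  case (Cons b bs)
  define c where "c = 1 - 2 / real ((card W)\<^sup>2)"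
  \<comment> \<open>Two vertices ensure that the factor 1 - 2/n^2 is nonnegative.\<close>
  have "(2::real)\<^sup>2 \<le> (real (card W))\<^sup>2" using assms(2) by (intro power_mono) auto
  then have c: "c \<ge> 0" by (simp add: c_def divide_le_eq)
  have b: "crossing W b" "\<And>S. S \<in> set b \<Longrightarrow> S \<subseteq> W" using Cons.prems(1)[of b] by auto
  have "W \<noteq> {}" using assms(2) by auto
  have "energy W (strategy_op (concat bs) *v (strategy_op b *v z)) \<le> c ^ length bs * energy W (strategy_op b *v z)"
    unfolding c_def using Cons.prems sum_strategy_op[of b W z] b(2) by (intro Cons.IH) auto
  also have "\<dots> \<le> c ^ length bs * (c * energy W z)"
    unfolding c_def using crossing_contraction[of W b z] b \<open>W \<noteq> {}\<close> Cons.prems(2) c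
    by (intro mult_left_mono) (auto simp: c_def)
  finally show ?case
    by (simp add: strategy_op_append matrix_vector_mul_assoc c_def mult_ac)
qed simp

section \<open>Deviation from the full average\<close>

lemma strategy_op_outside:
  fixes z :: "real^'v::finite"
  assumes "\<And>S. S \<in> set \<sigma> \<Longrightarrow> S \<subseteq> W" "v \<notin> W"
  shows "(strategy_op \<sigma> *v z) $ v = z $ v"
  using assms
proof (induction \<sigma> arbitrary: z)
  case (Cons S \<sigma>)
  then have "v \<notin> S" by auto
  with Cons show ?case
    by (simp add: strategy_op_Cons matrix_vector_mul_assoc [symmetric] averaging_op_mult_vec)
qed simp

lemma strategy_op_zero_inside:
  fixes z :: "real^'v::finite"
  assumes "\<And>S. S \<in> set \<sigma> \<Longrightarrow> S \<subseteq> W" "\<And>u. u \<in> W \<Longrightarrow> z $ u = 0" "v \<in> W"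
  shows "(strategy_op \<sigma> *v z) $ v = 0"
  using assms(1,2)
proof (induction \<sigma> arbitrary: z)
  case (Cons S \<sigma>)
  have "(strategy_op \<sigma> *v (averaging_op S *v z)) $ v = 0"
  proof (rule Cons.IH)
    show "(averaging_op S *v z) $ u = 0" if "u \<in> W" for u
      using that Cons.prems by (auto simp: averaging_op_mult_vec subset_iff intro!: sum.neutral)
  qed (use Cons.prems in auto)
  then show ?case by (simp add: strategy_op_Cons matrix_vector_mul_assoc)
qed (use assms(3) in simp)

lemma strategy_op_const:
  "strategy_op \<sigma> *v (\<chi> _. c) = ((\<chi> _. c) :: real^'v::finite)"
proof (induction \<sigma>)
  case (Cons S \<sigma>)
  have "averaging_op S *v (\<chi> _. c) = ((\<chi> _. c) :: real^'v)"
    by (auto simp: vec_eq_iff averaging_op_mult_vec)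
  then show ?case using Cons by (simp add: strategy_op_Cons matrix_vector_mul_assoc [symmetric])
qed simp

lemma matrix_entry: "(M :: real^'n^'m) $ v $ w = (M *v axis w 1) $ v"
  by (simp add: matrix_vector_mult_basis column_def)

text \<open>Every word over W fixes the coordinates off W, fixes constants and preserves the sum
  over W. The full average is the word \<open>[W]\<close>, so these effects cancel in the
  difference.\<close>

lemma strategy_op_deviation:
  fixes \<sigma> :: "'v::finite set list"
  assumes \<sigma>: "\<And>S. S \<in> set \<sigma> \<Longrightarrow> S \<subseteq> W"
  defines "N \<equiv> strategy_op \<sigma> - averaging_op W"
  shows "v \<notin> W \<Longrightarrow> N $ v $ w = 0" "v \<in> W \<Longrightarrow> w \<notin> W \<Longrightarrow> N $ v $ w = 0"
    "(\<Sum>u\<in>W. N $ v $ u) = 0" "(\<Sum>u\<in>W. N $ u $ w) = 0"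
proof -
  have N: "N $ v $ w = (strategy_op \<sigma> *v axis w 1) $ v - (strategy_op [W] *v axis w 1) $ v" for v w
    by (simp add: N_def matrix_entry matrix_vector_mult_diff_rdistrib)
  show out: "N $ v $ w = 0" if "v \<notin> W" for v w
    unfolding N using strategy_op_outside[of \<sigma> W v] strategy_op_outside[of "[W]" W v] \<sigma> that by simp
  show out2: "N $ v $ w = 0" if "v \<in> W" "w \<notin> W" for v w
  proof -
    have "(axis w 1 :: real^'v) $ u = 0" if "u \<in> W" for u
      using that \<open>w \<notin> W\<close> by (auto simp: axis_def)
    then show ?thesis
      unfolding N using strategy_op_zero_inside[of \<sigma> W "axis w 1" v]
        strategy_op_zero_inside[of "[W]" W "axis w 1" v] \<sigma> that by simp
  qed
  have "(\<Sum>u\<in>UNIV. N $ v $ u) = (N *v (\<chi> _. 1)) $ v"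
    by (simp add: matrix_vector_mult_def)
  also have "\<dots> = 0"
    using strategy_op_const[of \<sigma> 1] strategy_op_const[of "[W]" 1]
    by (simp add: N_def matrix_vector_mult_diff_rdistrib)
  finally have "(\<Sum>u\<in>UNIV. N $ v $ u) = 0" .
  moreover have "(\<Sum>u\<in>UNIV. N $ v $ u) = (\<Sum>u\<in>W. N $ v $ u)"
    using out out2 by (intro sum.mono_neutral_right) auto
  ultimately show "(\<Sum>u\<in>W. N $ v $ u) = 0" by simp
  show "(\<Sum>u\<in>W. N $ u $ w) = 0"
    unfolding N sum_subtractf
    using sum_strategy_op[of \<sigma> W "axis w 1"] sum_strategy_op[of "[W]" W "axis w 1"] \<sigma> by simp
qed

text \<open>A column of the deviation is the image of a centred unit vector, of energy at most 1,
  and an entry is at most the square root of the resulting energy: hence 2 q blocks for the power q.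
  The tail \<rho> can only lose energy.\<close>

lemma deviation_entry_bound:
  fixes bs :: "'v::finite set list list"
  assumes bs: "\<And>b. b \<in> set bs \<Longrightarrow> crossing W b" and W: "card W \<ge> 2"
    and \<sigma>: "\<And>S. S \<in> set (concat bs @ \<rho>) \<Longrightarrow> S \<subseteq> W"
    and len: "length bs = 2 * q" and vw: "v \<in> W" "w \<in> W"
  shows "\<bar>(strategy_op (concat bs @ \<rho>) - averaging_op W) $ v $ w\<bar> \<le> (1 - 2 / (card W)\<^sup>2) ^ q"
proof -
  define c where "c = 1 - 2 / real ((card W)\<^sup>2)"
  have "(2::real)\<^sup>2 \<le> (real (card W))\<^sup>2" using W by (intro power_mono) auto
  then have c: "c \<ge> 0" by (simp add: c_def divide_le_eq)
  define n where "n = real (card W)"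
  have n: "n > 0" using W by (simp add: n_def)
  define e where "e = (axis w 1 :: real^'v)"
  define z where "z = e - averaging_op W *v e"
  have ze: "z $ u = (if u = w then 1 else 0) - 1 / n" if "u \<in> W" for u
  proof -
    have "(\<Sum>x\<in>W. e $ x) = 1" using vw(2) by (simp add: e_def axis_def)
    then show ?thesis using that by (auto simp: z_def e_def averaging_op_mult_vec axis_def n_def)
  qed
  have z0: "(\<Sum>u\<in>W. z $ u) = 0"
  proof -
    have "(\<Sum>u\<in>W. z $ u) = (\<Sum>u\<in>W. (if u = w then 1 else 0)) - (\<Sum>u\<in>W. 1 / n)"
      using ze by (simp add: sum_subtractf)
    moreover have "W \<noteq> {}" using vw(2) by blast
    ultimately show ?thesis using n vw(2) by (simp add: n_def)
  qed
  have "energy W z = (\<Sum>u\<in>W. (if u = w then 1 - 2 / n else 0) + 1 / n\<^sup>2)"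
    unfolding energy_def using ze by (intro sum.cong) (auto simp: power2_diff power_divide)
  also have "\<dots> = 1 - 1 / n"
    using vw(2) n by (simp add: sum.distrib n_def[symmetric] power2_eq_square)
  also have "\<dots> \<le> 1" using n by simp
  finally have ez: "energy W z \<le> 1" .
  have \<rho>: "S \<subseteq> W" if "S \<in> set \<rho>" for S using \<sigma> that by simp
  have "energy W (strategy_op (concat bs @ \<rho>) *v z) \<le> energy W (strategy_op (concat bs) *v z)"
    using energy_strategy_op_le[of \<rho> W "strategy_op (concat bs) *v z"] \<rho>
    by (simp add: strategy_op_append matrix_vector_mul_assoc)
  also have "\<dots> \<le> c ^ (2 * q) * energy W z"
    unfolding c_def using crossing_blocks_contraction[of bs W z] bs \<sigma> W z0 len by auto
  also have "\<dots> \<le> (c ^ q)\<^sup>2"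
  proof -
    have "c ^ (2 * q) * energy W z \<le> c ^ (2 * q) * 1" using ez c by (intro mult_left_mono) auto
    then show ?thesis by (simp add: power_mult[symmetric] mult.commute)
  qed
  finally have e: "energy W (strategy_op (concat bs @ \<rho>) *v z) \<le> (c ^ q)\<^sup>2" .
  have "strategy_op (concat bs @ \<rho>) ** averaging_op W = averaging_op W"
    using \<sigma> by (rule strategy_op_absorb)
  then have "strategy_op (concat bs @ \<rho>) *v z = (strategy_op (concat bs @ \<rho>) - averaging_op W) *v e"
    by (simp add: z_def matrix_vector_mult_diff_distrib matrix_vector_mult_diff_rdistrib matrix_vector_mul_assoc)
  then have entry: "(strategy_op (concat bs @ \<rho>) - averaging_op W) $ v $ w = (strategy_op (concat bs @ \<rho>) *v z) $ v"
    by (simp only: matrix_entry e_def)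
  have "((strategy_op (concat bs @ \<rho>) *v z) $ v)\<^sup>2 \<le> energy W (strategy_op (concat bs @ \<rho>) *v z)"
    unfolding energy_def using vw(1) by (intro member_le_sum) auto
  with e have "((strategy_op (concat bs @ \<rho>) *v z) $ v)\<^sup>2 \<le> (c ^ q)\<^sup>2" by linarith
  then have "\<bar>(strategy_op (concat bs @ \<rho>) *v z) $ v\<bar> \<le> \<bar>c ^ q\<bar>"
    by (simp only: abs_le_square_iff)
  with c have "\<bar>(strategy_op (concat bs @ \<rho>) *v z) $ v\<bar> \<le> c ^ q" by simp
  then show ?thesis unfolding entry c_def .
qed

lemma length_bound_r_power: "n \<ge> 1 \<Longrightarrow> n \<le> 2 ^ length_bound_r n"
proof -
  assume n: "n \<ge> 1"
  have "log 2 (real n) \<le> real (length_bound_r n)"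
    unfolding length_bound_r_def using n by (simp add: of_nat_nat)
  then have "real n \<le> 2 powr real (length_bound_r n)" using n by (simp add: log_le_iff)
  then have "real n \<le> real (2 ^ length_bound_r n)" by (simp add: powr_realpow)
  then show ?thesis by (simp only: of_nat_le_iff)
qed

text \<open>The factor 4 in \<open>length_bound_q\<close> is made for this: 1 - x \<le> exp (- x)
  gives exp (- 8 r), and 8 > 11 ln 2.\<close>

lemma contraction_rate:
  assumes "n \<ge> 2"
  shows "(1 - 2 / (real n)\<^sup>2) ^ length_bound_q n \<le> 1 / real n ^ 11"
proof -
  define r where "r = length_bound_r n"
  have "(2::real)\<^sup>2 \<le> (real n)\<^sup>2" using assms by (intro power_mono) auto
  then have n: "(2::real)\<^sup>2 \<le> (real n)\<^sup>2" "n > 0" using assms by auto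
  have e: "(2::real) ^ 11 \<le> exp 8"
  proof -
    \<comment> \<open>Taylor at 1/2 gives exp (1/2) \<ge> 13/8, and (13/8)^16 still exceeds
      2^11.\<close>
    have "1 + (1/2) + (1/2)\<^sup>2 / 2 \<le> exp (1/2 :: real)"
      by (rule exp_lower_Taylor_quadratic) simp
    then have "(13/8 :: real) ^ 16 \<le> exp (1/2) ^ 16" by (intro power_mono) (auto simp: power2_eq_square)
    also have "\<dots> = exp 8" by (simp flip: exp_of_nat_mult)
    finally have "(13/8 :: real) ^ 16 \<le> exp 8" .
    moreover have "(2::real) ^ 11 \<le> (13/8) ^ 16" by (simp add: power_divide)
    ultimately show ?thesis by linarith
  qed
  have "(1 - 2 / (real n)\<^sup>2) ^ length_bound_q n \<le> exp (- 2 / (real n)\<^sup>2) ^ length_bound_q n"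
    using n exp_ge_add_one_self[of "- 2 / (real n)\<^sup>2"] by (intro power_mono) (auto simp: divide_le_eq)
  also have "\<dots> = exp (real (length_bound_q n) * (- 2 / (real n)\<^sup>2))"
    by (simp only: exp_of_nat_mult)
  also have "real (length_bound_q n) * (- 2 / (real n)\<^sup>2) = - (real r * 8)"
    using n by (simp add: length_bound_q_def r_def)
  also have "exp (- (real r * 8)) = 1 / exp 8 ^ r"
    by (simp add: exp_minus exp_of_nat_mult inverse_eq_divide)
  also have "\<dots> \<le> 1 / (2 ^ 11) ^ r"
    using e by (intro divide_left_mono power_mono) auto
  also have "(2 ^ 11) ^ r = ((2::real) ^ r) ^ 11"
    by (simp only: power_mult[symmetric] mult.commute)
  also have "1 / ((2::real) ^ r) ^ 11 \<le> 1 / real n ^ 11"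
  proof -
    have "real n \<le> real (2 ^ r)"
      using length_bound_r_power[of n] assms unfolding r_def by (intro of_nat_mono) simp
    then have "real n \<le> 2 ^ r" by simp
    then show ?thesis using n by (intro divide_left_mono power_mono) auto
  qed
  finally show ?thesis .
qed

section \<open>A neighbourhood of the full average\<close>

text \<open>Relative to a vertex subset W, so that the induction descends to subsets while all
  matrices keep one type.\<close>

definition words :: "('v \<Rightarrow> 'v \<Rightarrow> bool) \<Rightarrow> 'v set \<Rightarrow> 'v set list set" where
  "words E W = {\<sigma>. \<forall>S\<in>set \<sigma>. linked E S \<and> S \<subseteq> W}"

definition word_hull :: "('v::finite \<Rightarrow> 'v \<Rightarrow> bool) \<Rightarrow> 'v set \<Rightarrow> nat \<Rightarrow> (real^'v^'v) set" where
  "word_hull E W d = convex hull (strategy_op ` {\<sigma> \<in> words E W. length \<sigma> \<le> d})"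

lemma word_hull_mem: "\<sigma> \<in> words E W \<Longrightarrow> length \<sigma> \<le> d \<Longrightarrow> strategy_op \<sigma> \<in> word_hull E W d"
  unfolding word_hull_def by (intro hull_inc) blast

lemma word_hull_mono: "W \<subseteq> W' \<Longrightarrow> d \<le> d' \<Longrightarrow> word_hull E W d \<subseteq> word_hull E W' d'"
  unfolding word_hull_def by (intro hull_mono image_mono) (auto simp: words_def)

lemma convex_word_hull: "convex (word_hull E W d)"
  by (simp add: word_hull_def)

lemma words_append [simp]: "\<sigma> @ \<tau> \<in> words E W \<longleftrightarrow> \<sigma> \<in> words E W \<and> \<tau> \<in> words E W"
  by (auto simp: words_def)

lemma word_hull_mult:
  assumes "M \<in> word_hull E W a" "N \<in> word_hull E W b"
  shows "M ** N \<in> word_hull E W (a + b)"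
  unfolding word_hull_def
proof (rule convex_hull_matrix_mult[OF _ assms[unfolded word_hull_def]])
  fix x y
  assume "x \<in> strategy_op ` {\<sigma> \<in> words E W. length \<sigma> \<le> a}"
    and "y \<in> strategy_op ` {\<sigma> \<in> words E W. length \<sigma> \<le> b}"
  then obtain \<sigma> \<tau> where "x = strategy_op \<sigma>" "\<sigma> \<in> words E W" "length \<sigma> \<le> a"
    "y = strategy_op \<tau>" "\<tau> \<in> words E W" "length \<tau> \<le> b"
    by blast
  then show "x ** y \<in> convex hull (strategy_op ` {\<sigma> \<in> words E W. length \<sigma> \<le> a + b})"
    using word_hull_mem[of "\<tau> @ \<sigma>" E W "a + b"] by (simp add: strategy_op_append word_hull_def)
qed

section \<open>Rank-one deviations from sides\<close>

definition outer :: "real^'m \<Rightarrow> real^'n \<Rightarrow> real^'n^'m" where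
  "outer x y = (\<chi> i j. x $ i * y $ j)"

lemma outer_mult_vec: "outer x y *v z = (y \<bullet> z) *\<^sub>R x"
  by (simp add: vec_eq_iff outer_def matrix_vector_mult_def inner_vec_def sum_distrib_left mult_ac)

text \<open>The indicator of C made orthogonal to the constants on W.\<close>

definition side_vec :: "'v::finite set \<Rightarrow> 'v set \<Rightarrow> real^'v" where
  "side_vec W C = (\<chi> v. if v \<in> W then of_bool (v \<in> C) - card C / card W else 0)"

lemma inner_side_vec:
  assumes "C \<subseteq> W" "W \<noteq> {}"
  shows "side_vec W C \<bullet> z = (\<Sum>v\<in>C. z $ v) - card C / card W * (\<Sum>v\<in>W. z $ v)"
proof -
  have "side_vec W C \<bullet> z = (\<Sum>v\<in>UNIV. if v \<in> W then of_bool (v \<in> C) * z $ v - card C / card W * z $ v else 0)"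
    by (auto simp: inner_vec_def side_vec_def left_diff_distrib intro!: sum.cong)
  also have "\<dots> = (\<Sum>v\<in>W. of_bool (v \<in> C) * z $ v - card C / card W * z $ v)"
    by (simp add: sum.If_cases)
  also have "\<dots> = (\<Sum>v\<in>W. of_bool (v \<in> C) * z $ v) - card C / card W * (\<Sum>v\<in>W. z $ v)"
    by (simp add: sum_subtractf sum_distrib_left)
  also have "(\<Sum>v\<in>W. of_bool (v \<in> C) * z $ v) = (\<Sum>v\<in>C. z $ v)"
    using assms(1) by (intro sum.mono_neutral_cong_right) auto
  finally show ?thesis .
qed

lemma sum_side_vec:
  assumes "C \<subseteq> W" "W \<noteq> {}"
  shows "(\<Sum>v\<in>W. side_vec W C $ v) = 0"
proof -
  have "(\<Sum>v\<in>W. side_vec W C $ v) = (\<Sum>v\<in>W. of_bool (v \<in> C)) - real (card C)"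
    using assms by (simp add: side_vec_def sum_subtractf)
  also have "(\<Sum>v\<in>W. of_bool (v \<in> C)) = real (card C)"
    using assms(1) by (simp add: Int_absorb1)
  finally show ?thesis by simp
qed

lemma inner_side_vec_side_vec:
  assumes "C \<subseteq> W" "D \<subseteq> W" "W \<noteq> {}"
  shows "side_vec W C \<bullet> side_vec W D = card (C \<inter> D) - card C * card D / card W"
proof -
  have "(\<Sum>v\<in>C. side_vec W D $ v) = (\<Sum>v\<in>C. of_bool (v \<in> D) - card D / card W)"
    using assms(1) by (intro sum.cong) (auto simp: side_vec_def)
  also have "\<dots> = card (C \<inter> D) - card C * card D / card W"
    by (simp add: sum_subtractf Int_commute)
  finally show ?thesis
    using assms by (simp add: inner_side_vec sum_side_vec)
qed

text \<open>Multiplied by |W|, the inner product is the integer |C \<inter> D| |W - (C \<union> D)|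
  - |C - D| |D - C|. If one of the four intersections is empty, exactly one of the two products
  vanishes.\<close>

lemma side_vec_inner_bound:
  assumes "cross_free W C D" "C \<subset> W" "D \<subset> W" "C \<noteq> {}" "D \<noteq> {}"
  shows "\<bar>side_vec W C \<bullet> side_vec W D\<bar> \<ge> 1 / card W"
    and "C \<inter> D = {} \<Longrightarrow> side_vec W C \<bullet> side_vec W D < 0"
proof -
  define n c d p where "n = int (card W)" and "c = int (card C)" and "d = int (card D)"
    and "p = int (card (C \<inter> D))"
  have "card C < card W" "card D < card W" "card C > 0" "card D > 0"
    using assms(2-5) by (auto intro: psubset_card_mono simp: card_gt_0_iff)
  then have cd: "0 < c" "c < n" "0 < d" "d < n" by (simp_all add: n_def c_def d_def)
  have inn: "side_vec W C \<bullet> side_vec W D = real_of_int (n * p - c * d) / real_of_int n"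
  proof -
    have "C \<subseteq> W" "D \<subseteq> W" "W \<noteq> {}" "real (card W) \<noteq> 0" using assms cd by (auto simp: n_def)
    then show ?thesis
      by (simp add: inner_side_vec_side_vec n_def c_def d_def p_def diff_divide_distrib)
  qed
  have "n * p - c * d \<noteq> 0"
    using assms(1) unfolding cross_free_def
  proof (elim disjE)
    assume "C \<inter> D = {}"
    then show ?thesis using cd by (simp add: p_def)
  next
    assume "C \<subseteq> D"
    then have "p = c" by (simp add: p_def c_def Int_absorb2)
    then have "n * p - c * d = c * (n - d)" by (simp add: algebra_simps)
    then show ?thesis using cd by simp
  next
    assume "D \<subseteq> C"
    then have "p = d" by (simp add: p_def d_def Int_absorb1)
    then have "n * p - c * d = d * (n - c)" by (simp add: algebra_simps)
    then show ?thesis using cd by simp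
  next
    assume "C \<union> D = W"
    then have "n + p = c + d" unfolding n_def p_def c_def d_def
      using card_Un_Int[of C D] by simp
    then have p: "p = c + d - n" by simp
    have "n * p - c * d = - ((n - c) * (n - d))" unfolding p by (simp add: algebra_simps)
    then show ?thesis using cd by simp
  qed
  then have "1 \<le> \<bar>n * p - c * d\<bar>" by linarith
  then have "1 \<le> real_of_int \<bar>n * p - c * d\<bar>" by (simp only: of_int_1_le_iff)
  then have "1 / real_of_int n \<le> real_of_int \<bar>n * p - c * d\<bar> / real_of_int n"
    by (rule divide_right_mono) (use cd in simp)
  also have "\<dots> = \<bar>side_vec W C \<bullet> side_vec W D\<bar>"
    unfolding inn abs_divide of_int_abs using cd by simp
  finally show "\<bar>side_vec W C \<bullet> side_vec W D\<bar> \<ge> 1 / card W"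
    by (simp only: n_def of_int_of_nat_eq)
  show "side_vec W C \<bullet> side_vec W D < 0" if "C \<inter> D = {}"
  proof -
    have "real_of_int (n * p - c * d) < 0" using that cd by (simp add: p_def)
    then show ?thesis unfolding inn using cd by (intro divide_neg_pos) auto
  qed
qed

text \<open>The squared length of \<open>side_vec W C\<close>.\<close>

definition side_norm :: "'v set \<Rightarrow> 'v set \<Rightarrow> real" where
  "side_norm W C = card C * card (W - C) / card W"

text \<open>The scalar part of the next lemma: c, d are the sizes and s, t the sums of the two
  sides.\<close>

lemma two_means:
  fixes c d s t :: real
  assumes "c > 0" "d > 0"
  shows "s / c = (s + t) / (c + d) + (s / c - t / d) * (1 - c / (c + d))"
    and "t / d = (s + t) / (c + d) + (s / c - t / d) * (- (c / (c + d)))"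
    and "1 / (c * d / (c + d)) * (s - c / (c + d) * (s + t)) = s / c - t / d"
proof -
  have nz: "c \<noteq> 0" "d \<noteq> 0" "c + d \<noteq> 0" using assms by auto
  have 1: "1 - c / (c + d) = d / (c + d)" "s / c - t / d = (s * d - t * c) / (c * d)"
    using nz by (simp_all add: field_simps)
  show "s / c = (s + t) / (c + d) + (s / c - t / d) * (1 - c / (c + d))"
    unfolding 1 using nz by (simp add: divide_simps) (simp add: algebra_simps)
  show "t / d = (s + t) / (c + d) + (s / c - t / d) * (- (c / (c + d)))"
    unfolding 1 using nz by (simp add: divide_simps) (simp add: algebra_simps)
  show "1 / (c * d / (c + d)) * (s - c / (c + d) * (s + t)) = s / c - t / d"
    unfolding 1 using nz by (simp add: divide_simps) (simp add: algebra_simps)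
qed

text \<open>On W the left side is the orthogonal projection onto the functions constant on C and on
  W - C, that is, onto the span of the constants and \<open>side_vec W C\<close>.\<close>

lemma side_averages:
  fixes W C :: "'v::finite set"
  assumes "C \<subset> W" "C \<noteq> {}"
  shows "averaging_op C ** averaging_op (W - C)
    = averaging_op W + (1 / side_norm W C) *\<^sub>R outer (side_vec W C) (side_vec W C)"
proof -
  define c d n where "c = real (card C)" and "d = real (card (W - C))" and "n = real (card W)"
  have cdn: "n = c + d" "c > 0" "d > 0"
  proof -
    have "C \<subseteq> W" using assms(1) by auto
    then have "card (W - C) = card W - card C" "card C \<le> card W"
      by (auto simp: card_Diff_subset intro: card_mono)
    then show "n = c + d" unfolding c_def d_def n_def by simp
    show "c > 0" "d > 0" using assms by (auto simp: c_def d_def card_gt_0_iff)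
  qed
  have "averaging_op C *v (averaging_op (W - C) *v z)
      = averaging_op W *v z + (1 / side_norm W C) *\<^sub>R (outer (side_vec W C) (side_vec W C) *v z)" for z
  proof -
    define s t where "s = (\<Sum>v\<in>C. z $ v)" and "t = (\<Sum>v\<in>W - C. z $ v)"
    have W: "(\<Sum>v\<in>W. z $ v) = s + t"
      unfolding s_def t_def using assms(1) by (metis add.commute finite psubset_imp_subset sum.subset_diff)
    have sC: "(\<Sum>v\<in>C. (averaging_op (W - C) *v z) $ v) = s"
      unfolding s_def by (intro sum_averaging_op) auto
    have k: "(1 / side_norm W C) * (side_vec W C \<bullet> z) = s / c - t / d"
    proof -
      have CW: "C \<subseteq> W" "W \<noteq> {}" using assms by auto
      have "side_vec W C \<bullet> z = s - c / (c + d) * (s + t)"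
        unfolding inner_side_vec[OF CW] W s_def[symmetric] c_def[symmetric] n_def[symmetric] cdn(1) ..
      moreover have "side_norm W C = c * d / (c + d)"
        using cdn(1) unfolding side_norm_def c_def d_def n_def by simp
      ultimately show ?thesis using two_means(3)[OF cdn(2,3), of s t] by simp
    qed
    have R: "((1 / side_norm W C) *\<^sub>R (outer (side_vec W C) (side_vec W C) *v z)) $ v
        = (s / c - t / d) * side_vec W C $ v" for v
      using k by (simp add: outer_mult_vec)
    show ?thesis
      unfolding vec_eq_iff
    proof
      fix v
      consider "v \<in> C" | "v \<in> W" "v \<notin> C" | "v \<notin> W" using assms(1) by blast
      then show "(averaging_op C *v (averaging_op (W - C) *v z)) $ v
        = (averaging_op W *v z + (1 / side_norm W C) *\<^sub>R (outer (side_vec W C) (side_vec W C) *v z)) $ v"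
      proof cases
        case 1
        then have "v \<in> W" using assms(1) by auto
        have "(averaging_op C *v (averaging_op (W - C) *v z)) $ v = s / c"
          using 1 sC by (simp add: averaging_op_mult_vec[of C] c_def)
        moreover have "(averaging_op W *v z) $ v = (s + t) / n"
          using \<open>v \<in> W\<close> W by (simp add: averaging_op_mult_vec n_def)
        moreover have "side_vec W C $ v = 1 - c / n"
          using 1 \<open>v \<in> W\<close> by (simp add: side_vec_def c_def n_def)
        moreover have "s / c = (s + t) / n + (s / c - t / d) * (1 - c / n)"
          unfolding cdn(1) by (rule two_means(1)[OF cdn(2,3)])
        ultimately show ?thesis by (simp only: vector_add_component R)
      next
        case 2
        have "(averaging_op C *v (averaging_op (W - C) *v z)) $ v = t / d"
          using 2 by (simp add: averaging_op_mult_vec[of C] averaging_op_mult_vec[of "W - C"] d_def t_def)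
        moreover have "(averaging_op W *v z) $ v = (s + t) / n"
          using 2 W by (simp add: averaging_op_mult_vec n_def)
        moreover have "side_vec W C $ v = - (c / n)"
          using 2 by (simp add: side_vec_def c_def n_def)
        moreover have "t / d = (s + t) / n + (s / c - t / d) * (- (c / n))"
          unfolding cdn(1) by (rule two_means(2)[OF cdn(2,3)])
        ultimately show ?thesis by (simp only: vector_add_component R)
      next
        case 3
        then have "v \<notin> C" using assms(1) by auto
        then show ?thesis using 3 R[of v]
          by (simp add: averaging_op_mult_vec[of C] averaging_op_mult_vec[of "W - C"]
              averaging_op_mult_vec[of W] side_vec_def)
      qed
    qed
  qed
  then show ?thesis
    by (simp add: matrix_eq matrix_vector_mul_assoc [symmetric] matrix_vector_mult_add_rdistrib
        scaleR_matrix_vector_assoc [symmetric])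
qed

lemma averaging_op_side_vec:
  assumes "C \<subseteq> W" "W \<noteq> {}"
  shows "averaging_op W *v side_vec W C = 0"
  using sum_side_vec[OF assms] by (auto simp: vec_eq_iff averaging_op_mult_vec side_vec_def)

lemma inner_side_vec_averaging_op:
  assumes "C \<subseteq> W" "W \<noteq> {}"
  shows "side_vec W C \<bullet> (averaging_op W *v z) = 0"
proof -
  have "(\<Sum>v\<in>C. (averaging_op W *v z) $ v) = card C * ((\<Sum>v\<in>W. z $ v) / card W)"
    using assms(1) by (subst sum_constant [symmetric], intro sum.cong) (auto simp: averaging_op_mult_vec)
  moreover have "(\<Sum>v\<in>W. (averaging_op W *v z) $ v) = (\<Sum>v\<in>W. z $ v)"
    by (intro sum_averaging_op) simp
  ultimately show ?thesis using assms by (simp add: inner_side_vec)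
qed

text \<open>The full average annihilates side vectors from both sides, so mixed terms vanish and
  only the product of the rank-one parts remains, joined by one inner product.\<close>

lemma side_averages_mult:
  fixes W C X Y :: "'v::finite set"
  assumes "Y \<subset> W" "Y \<noteq> {}" "X \<subseteq> W" "C \<subseteq> W"
  shows "(averaging_op Y ** averaging_op (W - Y)) ** (averaging_op W + g *\<^sub>R outer (side_vec W X) (side_vec W C))
    = averaging_op W
      + (g * (side_vec W Y \<bullet> side_vec W X) / side_norm W Y) *\<^sub>R outer (side_vec W Y) (side_vec W C)"
proof -
  have W: "W \<noteq> {}" "Y \<subseteq> W" using assms by auto
  have AA: "averaging_op W *v (averaging_op W *v z) = averaging_op W *v z" for z
    by (simp add: matrix_vector_mul_assoc averaging_op_absorb)
  show ?thesis
    unfolding side_averages[OF assms(1,2)]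
    by (simp add: matrix_eq matrix_vector_mul_assoc [symmetric] matrix_vector_mult_add_rdistrib
        matrix_vector_right_distrib scaleR_matrix_vector_assoc [symmetric] outer_mult_vec
        inner_side_vec_averaging_op averaging_op_side_vec W assms AA matrix_vector_mult_scaleR
        inner_add_right)
qed

text \<open>In the words built below, C is the side averaged first and X the side averaged last; g
  collects the inner products and norms on the way.\<close>

definition rank_one_word :: "('v::finite \<Rightarrow> 'v \<Rightarrow> bool) \<Rightarrow> 'v set \<Rightarrow> nat \<Rightarrow> 'v set \<Rightarrow> 'v set \<Rightarrow> real \<Rightarrow> bool" where
  "rank_one_word E W k X C g \<longleftrightarrow> (\<exists>\<tau>\<in>words E W. length \<tau> = k \<and>
     strategy_op \<tau> = averaging_op W + g *\<^sub>R outer (side_vec W X) (side_vec W C))"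

lemma side_proper:
  assumes "side E W C"
  shows "C \<subset> W" "C \<noteq> {}" "[W - C, C] \<in> words E W" "W \<noteq> {}"
  using assms linked_nonempty[of E C] linked_nonempty[of E "W - C"] by (auto simp: side_def words_def)

lemma side_norm_bounds:
  assumes "side E (W :: 'v::finite set) C"
  shows "0 < side_norm W C" "side_norm W C \<le> card W"
proof -
  note C = side_proper[OF assms]
  have c: "0 < card C" "0 < card (W - C)" "card C \<le> card W" "card (W - C) \<le> card W"
    using C(1,2) by (auto simp: card_gt_0_iff intro: card_mono)
  then show "0 < side_norm W C" by (simp add: side_norm_def)
  have "real (card C) * real (card (W - C)) \<le> real (card W) * real (card W)"
    using c by (intro mult_mono) auto
  then show "side_norm W C \<le> card W" using c by (simp add: side_norm_def divide_le_eq)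
qed

lemma rank_one_word_start:
  assumes "side E W C"
  shows "rank_one_word E W 2 C C (1 / side_norm W C)"
  unfolding rank_one_word_def
  using side_proper[OF assms] side_averages[of C W]
  by (intro bexI[of _ "[W - C, C]"]) (auto simp: strategy_op_Cons)

lemma rank_one_word_step:
  assumes "rank_one_word E W k X C g" "side E W X" "side E W Y" "side E W C"
  shows "rank_one_word E W (k + 2) Y C (g * (side_vec W Y \<bullet> side_vec W X) / side_norm W Y)"
proof -
  obtain \<tau> where \<tau>: "\<tau> \<in> words E W" "length \<tau> = k"
    "strategy_op \<tau> = averaging_op W + g *\<^sub>R outer (side_vec W X) (side_vec W C)"
    using assms(1) unfolding rank_one_word_def by blast
  note Y = side_proper[OF assms(3)]
  have "X \<subseteq> W" "C \<subseteq> W" using assms by (auto simp: side_def)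
  then show ?thesis
    unfolding rank_one_word_def using \<tau> Y side_averages_mult[of Y W X C g]
    by (intro bexI[of _ "\<tau> @ [W - Y, Y]"]) (auto simp: strategy_op_append strategy_op_Cons)
qed

text \<open>The new factor is an inner product of sides that do not cross, at least 1/n in size,
  divided by a norm of at most n.\<close>

lemma rank_one_word_step_bound:
  assumes "rank_one_word E W k X C g" "side E W X" "side E W Y" "side E W C" "cross_free W Y X"
    and "\<bar>g\<bar> \<ge> 1 / real (card W) ^ m"
  obtains g' where "rank_one_word E W (k + 2) Y C g'" "\<bar>g'\<bar> \<ge> 1 / real (card W) ^ (m + 2)"
    "sgn g' = sgn g * sgn (side_vec W Y \<bullet> side_vec W X)"
proof -
  define i where "i = side_vec W Y \<bullet> side_vec W X"
  define n where "n = real (card W)"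
  note Y = side_proper[OF assms(3)] and X = side_proper[OF assms(2)]
  have n: "n > 0" using Y(4) by (simp add: n_def card_gt_0_iff)
  have i: "\<bar>i\<bar> \<ge> 1 / n" unfolding i_def n_def
    using X Y assms(5) by (intro side_vec_inner_bound) auto
  have s: "0 < side_norm W Y" "side_norm W Y \<le> n"
    using side_norm_bounds[OF assms(3)] by (auto simp: n_def)
  have "1 / n ^ (m + 2) = (1 / n ^ m) * (1 / n) / n" by (simp add: power_add power2_eq_square)
  also have "\<dots> \<le> \<bar>g\<bar> * \<bar>i\<bar> / side_norm W Y"
    using s i assms(6) n unfolding n_def[symmetric]
    by (intro frac_le mult_mono) auto
  finally have "1 / n ^ (m + 2) \<le> \<bar>g * i / side_norm W Y\<bar>" using s by (simp add: abs_mult)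
  moreover have "sgn (g * i / side_norm W Y) = sgn g * sgn i"
    using s by (simp add: sgn_mult sgn_divide)
  ultimately show thesis
    using that rank_one_word_step[OF assms(1-4)] unfolding i_def n_def by blast
qed

text \<open>Three pairwise disjoint sides have negative pairwise inner products, so two of them have
  inner products of equal sign with \<open>C\<close>. Passing from \<open>C\<close> to \<open>D\<close> through one or through two of
  them therefore realises both signs.\<close>

lemma rank_one_word_both_signs:
  assumes "side E W C" "side E W D" "\<And>X. X \<in> \<X> \<Longrightarrow> side E W X \<and> cross_free W X C \<and> cross_free W D X"
    and \<X>: "\<X> = {X, Y, Z}" "X \<inter> Y = {}" "X \<inter> Z = {}" "Y \<inter> Z = {}"
    and "s = 1 \<or> s = (-1 :: real)"
  obtains k g where "rank_one_word E W k D C g" "k \<le> 8" "\<bar>g\<bar> \<ge> 1 / real (card W) ^ 7" "sgn g = s"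
proof -
  define n where "n = real (card W)"
  note W = side_proper[OF assms(1)]
  have n: "n \<ge> 1" using W(4) by (simp add: n_def Suc_leI card_gt_0_iff)
  have g1: "rank_one_word E W 2 C C (1 / side_norm W C)" "1 / side_norm W C \<ge> 1 / n ^ 1" "sgn (1 / side_norm W C) = 1"
    using rank_one_word_start[OF assms(1)] side_norm_bounds[OF assms(1)]
    by (auto simp: n_def sgn_divide intro: divide_left_mono)
  have g1': "\<bar>1 / side_norm W C\<bar> \<ge> 1 / real (card W) ^ 1" using g1(2) unfolding n_def by linarith
  define S where "S X = sgn (side_vec W X \<bullet> side_vec W C)" for X
  define T where "T X = sgn (side_vec W D \<bullet> side_vec W X)" for X
  have ST: "\<bar>S X\<bar> = 1" "\<bar>T X\<bar> = 1" if "X \<in> \<X>" for X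
  proof -
    have X: "side E W X" "cross_free W X C" "cross_free W D X" using assms(3)[OF that] by auto
    note P = side_proper[OF X(1)] side_proper[OF assms(2)]
    have "\<bar>side_vec W X \<bullet> side_vec W C\<bar> \<ge> 1 / n" "\<bar>side_vec W D \<bullet> side_vec W X\<bar> \<ge> 1 / n"
      unfolding n_def using P W X by (auto intro: side_vec_inner_bound)
    moreover have "1 / n > 0" using n by simp
    ultimately have "side_vec W X \<bullet> side_vec W C \<noteq> 0" "side_vec W D \<bullet> side_vec W X \<noteq> 0" by auto
    then show "\<bar>S X\<bar> = 1" "\<bar>T X\<bar> = 1" by (auto simp: S_def T_def abs_sgn_eq)
  qed
  show thesis
  proof (cases "\<exists>X\<in>\<X>. S X * T X = s")
    case True
    then obtain X where X: "X \<in> \<X>" "S X * T X = s" by blast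
    then have sX: "side E W X" "cross_free W X C" "cross_free W D X" using assms(3) by auto
    obtain g2 where g2: "rank_one_word E W (2 + 2) X C g2" "\<bar>g2\<bar> \<ge> 1 / real (card W) ^ (1 + 2)"
        "sgn g2 = sgn (1 / side_norm W C) * sgn (side_vec W X \<bullet> side_vec W C)"
      by (rule rank_one_word_step_bound[OF g1(1) assms(1) sX(1) assms(1) sX(2) g1'])
    obtain g3 where g3': "rank_one_word E W (2 + 2 + 2) D C g3" "\<bar>g3\<bar> \<ge> 1 / real (card W) ^ (1 + 2 + 2)"
        "sgn g3 = sgn g2 * sgn (side_vec W D \<bullet> side_vec W X)"
      by (rule rank_one_word_step_bound[OF g2(1) sX(1) assms(2) assms(1) sX(3) g2(2)])
    then have g3: "rank_one_word E W 6 D C g3" "\<bar>g3\<bar> \<ge> 1 / real (card W) ^ 5" "sgn g3 = S X * T X"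
      unfolding g2(3) g1(3) S_def T_def by (simp_all add: numeral_eq_Suc)
    have "1 / n ^ 7 \<le> 1 / n ^ 5" using n by (intro divide_left_mono power_increasing) auto
    then show thesis using that[of 6 g3] g3 X(2) unfolding n_def by auto
  next
    case False
    \<comment> \<open>Every route through one side has the wrong sign, which ties the sign at D to
      the sign at C.\<close>
    have TS: "T X = - s * S X" if "X \<in> \<X>" for X
    proof -
      have "S X * T X \<noteq> s" using False that by blast
      then show ?thesis using ST[OF that] assms(8) by (auto simp: abs_if split: if_splits)
    qed
    \<comment> \<open>Pigeonhole on three signs; the negative inner product of U and V then supplies
      the missing sign.\<close>
    have "S X = S Y \<or> S X = S Z \<or> S Y = S Z"
      using ST[of X] ST[of Y] ST[of Z] \<X>(1) by (auto simp: abs_if split: if_splits)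
    then obtain U V where UV: "U \<in> \<X>" "V \<in> \<X>" "U \<inter> V = {}" "S U = S V"
      using \<X> by blast
    have U: "side E W U" "cross_free W U C" and V: "side E W V" "cross_free W D V"
      using assms(3) UV by auto
    have VU: "cross_free W V U" using UV(3) by (auto simp: cross_free_def)
    have neg: "sgn (side_vec W V \<bullet> side_vec W U) = - 1"
      using side_vec_inner_bound(2)[OF VU] side_proper[OF U(1)] side_proper[OF V(1)] UV(3)
      by (auto simp: Int_commute)
    obtain g2 where g2: "rank_one_word E W (2 + 2) U C g2" "\<bar>g2\<bar> \<ge> 1 / real (card W) ^ (1 + 2)"
        "sgn g2 = sgn (1 / side_norm W C) * sgn (side_vec W U \<bullet> side_vec W C)"
      by (rule rank_one_word_step_bound[OF g1(1) assms(1) U(1) assms(1) U(2) g1'])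
    obtain g3 where g3: "rank_one_word E W (2 + 2 + 2) V C g3" "\<bar>g3\<bar> \<ge> 1 / real (card W) ^ (1 + 2 + 2)"
        "sgn g3 = sgn g2 * sgn (side_vec W V \<bullet> side_vec W U)"
      by (rule rank_one_word_step_bound[OF g2(1) U(1) V(1) assms(1) VU g2(2)])
    obtain g4 where g4': "rank_one_word E W (2 + 2 + 2 + 2) D C g4"
        "\<bar>g4\<bar> \<ge> 1 / real (card W) ^ (1 + 2 + 2 + 2)"
        "sgn g4 = sgn g3 * sgn (side_vec W D \<bullet> side_vec W V)"
      by (rule rank_one_word_step_bound[OF g3(1) V(1) assms(2) assms(1) V(2) g3(2)])
    then have g4: "rank_one_word E W 8 D C g4" "\<bar>g4\<bar> \<ge> 1 / real (card W) ^ 7" "sgn g4 = - S U * T V"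
      unfolding g3(3) g2(3) g1(3) neg S_def T_def by (simp_all add: numeral_eq_Suc)
    have "- S U * T V = s * (S U * S U)" using TS[OF UV(2)] UV(4) by simp
    also have "S U * S U = 1" using ST(1)[OF UV(1)] by (metis abs_mult_self_eq mult_1)
    finally show thesis using that[of 8 g4] g4 by auto
  qed
qed

section \<open>Expansion of small deviations\<close>

text \<open>The target is the average of the points with a single term scaled by |I|; this is how
  the number of terms enters the radius.\<close>

lemma convex_add_sum_mem:
  fixes a :: "'i \<Rightarrow> 'a::real_vector"
  assumes "convex K" "finite I" "j \<in> K" "\<And>i. i \<in> I \<Longrightarrow> j + real (card I) *\<^sub>R a i \<in> K"
  shows "j + (\<Sum>i\<in>I. a i) \<in> K"
proof (cases "I = {}")
  case False
  define m where "m = real (card I)"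
  have m: "m > 0" using False assms(2) by (simp add: m_def card_gt_0_iff)
  have "(\<Sum>i\<in>I. (1 / m) *\<^sub>R (j + m *\<^sub>R a i)) \<in> K"
    using assms m by (intro convex_sum) (auto simp: m_def)
  also have "(\<Sum>i\<in>I. (1 / m) *\<^sub>R (j + m *\<^sub>R a i)) = (\<Sum>i\<in>I. (1 / m) *\<^sub>R j + a i)"
    using m by (simp add: scaleR_add_right)
  also have "\<dots> = j + (\<Sum>i\<in>I. a i)"
    using m by (simp add: sum.distrib scaleR_left.sum[symmetric] sum_constant_scaleR m_def)
  finally show ?thesis .
qed (use assms in simp)

lemma spanning_sides_sides:
  assumes "spanning_sides E W r F" "(C, a, b) \<in> set F"
  shows "side E W C \<and> a \<in> W \<and> b \<in> W"
proof -
  have "\<forall>(C, a, b) \<in> set F. side E W C \<and> a \<in> W \<and> b \<in> W"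
    using assms(1) unfolding spanning_sides_def by (elim conjE)
  from bspec[OF this assms(2)] show ?thesis by simp
qed

lemma spanning_sides_length: "spanning_sides E W r F \<Longrightarrow> length F \<le> card W"
  unfolding spanning_sides_def by (elim conjE)

text \<open>Summing the expansion over W determines f r, and substituting it turns the indicators of
  the sides into the centred \<open>side_vec\<close>.\<close>

lemma spanning_sides_zero_sum:
  fixes f :: "'v::finite \<Rightarrow> real"
  assumes "spanning_sides E W r F" "(\<Sum>v\<in>W. f v) = 0" "v \<in> W"
  shows "f v = (\<Sum>i<length F. side_vec W (fst (F ! i)) $ v * (f (fst (snd (F ! i))) - f (snd (snd (F ! i)))))"
proof -
  define C where "C i = fst (F ! i)" for i
  define d where "d i = f (fst (snd (F ! i))) - f (snd (snd (F ! i)))" for i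
  have W: "W \<noteq> {}" using assms(3) by auto
  then have n: "real (card W) > 0" by (simp add: card_gt_0_iff)
  have sub: "C i \<subseteq> W" if "i < length F" for i
  proof -
    have "F ! i \<in> set F" using that by simp
    then have "(C i, snd (F ! i)) \<in> set F" by (simp add: C_def)
    then show ?thesis
      using spanning_sides_sides[OF assms(1)] by (cases "snd (F ! i)") (auto simp: side_def)
  qed
  have f: "f v = f r + (\<Sum>i<length F. of_bool (v \<in> C i) * d i)" if "v \<in> W" for v
  proof -
    have "f v = f r + (\<Sum>(C, a, b)\<leftarrow>F. if v \<in> C then f a - f b else 0)"
    proof -
      have "\<forall>z :: 'v \<Rightarrow> real. \<forall>v\<in>W. z v = z r + (\<Sum>(C, a, b)\<leftarrow>F. if v \<in> C then z a - z b else 0)"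
        using assms(1) unfolding spanning_sides_def by (elim conjE)
      from this[THEN spec, of f] that show ?thesis by (rule bspec)
    qed
    also have "(\<Sum>(C, a, b)\<leftarrow>F. if v \<in> C then f a - f b else 0) = (\<Sum>i<length F. of_bool (v \<in> C i) * d i)"
      unfolding sum_list_sum_nth atLeast0LessThan length_map
      by (intro sum.cong) (auto simp: C_def d_def split: prod.splits)
    finally show ?thesis .
  qed
  have "0 = (\<Sum>v\<in>W. f r + (\<Sum>i<length F. of_bool (v \<in> C i) * d i))"
    using assms(2) f by simp
  also have "\<dots> = card W * f r + (\<Sum>i<length F. \<Sum>v\<in>W. of_bool (v \<in> C i) * d i)"
    unfolding sum.distrib sum.swap[of _ "{..<length F}" W] by simp
  also have "(\<Sum>i<length F. \<Sum>v\<in>W. of_bool (v \<in> C i) * d i) = (\<Sum>i<length F. card (C i) * d i)"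
  proof (intro sum.cong refl)
    fix i assume "i \<in> {..<length F}"
    then have "(\<Sum>v\<in>W. of_bool (v \<in> C i)) = real (card (C i))"
      using sub[of i] by (simp add: Int_absorb1)
    then show "(\<Sum>v\<in>W. of_bool (v \<in> C i) * d i) = card (C i) * d i"
      by (simp only: sum_distrib_right[symmetric])
  qed
  finally have "f r * card W = - (\<Sum>i<length F. card (C i) * d i)" by (simp add: mult.commute)
  then have "f r = - (\<Sum>i<length F. card (C i) * d i) / card W"
    using n by (simp only: nonzero_eq_divide_eq[of "real (card W)"] less_irrefl)
  also have "\<dots> = (\<Sum>i<length F. - (card (C i) / card W) * d i)"
    by (simp add: sum_divide_distrib sum_negf)
  finally have "f v = (\<Sum>i<length F. - (card (C i) / card W) * d i) + (\<Sum>i<length F. of_bool (v \<in> C i) * d i)"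
    using f[OF assms(3)] by simp
  also have "\<dots> = (\<Sum>i<length F. side_vec W (C i) $ v * d i)"
    using assms(3) by (simp add: side_vec_def left_diff_distrib sum_subtractf sum_negf)
  finally show ?thesis unfolding C_def d_def .
qed

text \<open>At most \<open>n\<^sup>2\<close> rank-one terms occur, with coefficients at most \<open>4/n\<^bsup>11\<^esup>\<close>, while coefficients up to
  \<open>1/n\<^bsup>7\<^esup>\<close> are realised by words.\<close>

lemma branching_neighbourhood:
  fixes W :: "'v::finite set" and N :: "real^'v^'v"
  assumes "branching E W"
    and out: "\<And>v w. v \<notin> W \<Longrightarrow> N $ v $ w = 0" "\<And>v w. v \<in> W \<Longrightarrow> w \<notin> W \<Longrightarrow> N $ v $ w = 0"
    and rows: "\<And>v. (\<Sum>u\<in>W. N $ v $ u) = 0" and cols: "\<And>w. (\<Sum>u\<in>W. N $ u $ w) = 0"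
    and small: "\<And>v w. v \<in> W \<Longrightarrow> w \<in> W \<Longrightarrow> \<bar>N $ v $ w\<bar> \<le> 1 / real (card W) ^ 11"
    and "card W \<ge> 2"
  shows "averaging_op W + N \<in> word_hull E W 8"
proof -
  obtain r F X Y Z where W: "linked E W" and F: "spanning_sides E W r F"
    and XYZ: "side E W X" "side E W Y" "side E W Z" "X \<inter> Y = {}" "X \<inter> Z = {}" "Y \<inter> Z = {}"
    and cf: "\<And>C a b. (C, a, b) \<in> set F \<Longrightarrow> cross_free W C X \<and> cross_free W C Y \<and> cross_free W C Z"
    using assms(1) by (rule branchingE) blast
  define n where "n = real (card W)"
  have n: "n \<ge> 2" using assms(7) by (simp add: n_def)
  define C a b where "C i = fst (F ! i)" and "a i = fst (snd (F ! i))" and "b i = snd (snd (F ! i))" for i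
  define I where "I = {..<length F} \<times> {..<length F}"
  have Fi: "side E W (C i)" "a i \<in> W" "b i \<in> W"
      "cross_free W (C i) X \<and> cross_free W (C i) Y \<and> cross_free W (C i) Z" if "i < length F" for i
  proof -
    have mem: "(C i, a i, b i) \<in> set F" using that by (simp add: C_def a_def b_def)
    then have "side E W (C i) \<and> a i \<in> W \<and> b i \<in> W"
      by (rule spanning_sides_sides[OF F])
    then show "side E W (C i)" "a i \<in> W" "b i \<in> W" by auto
    show "cross_free W (C i) X \<and> cross_free W (C i) Y \<and> cross_free W (C i) Z" by (rule cf[OF mem])
  qed
  \<comment> \<open>Expanding rows and columns in turn leaves second differences of N as
    coefficients.\<close>
  define c where "c = (\<lambda>(i, j). N $ a i $ a j - N $ a i $ b j - (N $ b i $ a j - N $ b i $ b j))"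
  have row: "N $ v $ w = (\<Sum>j<length F. side_vec W (C j) $ w * (N $ v $ a j - N $ v $ b j))" if "v \<in> W" for v w
  proof (cases "w \<in> W")
    case True
    then show ?thesis
      using spanning_sides_zero_sum[OF F rows[of v] True] by (simp add: C_def a_def b_def)
  qed (use that out(2) in \<open>simp add: side_vec_def\<close>)
  have col: "N $ v $ w = (\<Sum>i<length F. side_vec W (C i) $ v * (N $ a i $ w - N $ b i $ w))" for v w
  proof (cases "v \<in> W")
    case True
    then show ?thesis
      using spanning_sides_zero_sum[OF F cols[of w] True] by (simp add: C_def a_def b_def)
  qed (use out(1) in \<open>simp add: side_vec_def\<close>)
  have N: "N = (\<Sum>p\<in>I. c p *\<^sub>R outer (side_vec W (C (fst p))) (side_vec W (C (snd p))))"
    unfolding vec_eq_iff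
  proof (intro allI)
    fix v w
    have "N $ v $ w = (\<Sum>i<length F. side_vec W (C i) $ v * (\<Sum>j<length F. side_vec W (C j) $ w * c (i, j)))"
      unfolding col[of v w]
    proof (intro sum.cong refl arg_cong2[where f = "(*)"])
      fix i assume "i \<in> {..<length F}"
      then have "a i \<in> W" "b i \<in> W" using Fi by auto
      then show "N $ a i $ w - N $ b i $ w = (\<Sum>j<length F. side_vec W (C j) $ w * c (i, j))"
        unfolding row[OF \<open>a i \<in> W\<close>, of w] row[OF \<open>b i \<in> W\<close>, of w]
        by (simp add: c_def sum_subtractf[symmetric] right_diff_distrib[symmetric])
    qed
    also have "\<dots> = (\<Sum>p\<in>I. side_vec W (C (fst p)) $ v * (side_vec W (C (snd p)) $ w * c p))"
      unfolding I_def sum_distrib_left sum.cartesian_product by (simp add: case_prod_unfold)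
    also have "\<dots> = (\<Sum>p\<in>I. c p *\<^sub>R outer (side_vec W (C (fst p))) (side_vec W (C (snd p)))) $ v $ w"
      by (simp add: outer_def mult_ac)
    finally show "N $ v $ w = (\<Sum>p\<in>I. c p *\<^sub>R outer (side_vec W (C (fst p))) (side_vec W (C (snd p)))) $ v $ w" .
  qed
  have cW: "averaging_op W \<in> word_hull E W 8"
    using word_hull_mem[of "[W]" E W 8] W by (simp add: words_def)
  have "averaging_op W + (\<Sum>p\<in>I. c p *\<^sub>R outer (side_vec W (C (fst p))) (side_vec W (C (snd p)))) \<in> word_hull E W 8"
  proof (rule convex_add_sum_mem[OF convex_word_hull _ cW])
    show "finite I" by (simp add: I_def)
    fix p assume "p \<in> I"
    then obtain i j where p: "p = (i, j)" "i < length F" "j < length F" by (auto simp: I_def)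
    define R where "R = outer (side_vec W (C i)) (side_vec W (C j))"
    define x where "x = real (card I) * c p"
    have "length F \<le> card W" using F by (rule spanning_sides_length)
    then have "real (length F * length F) \<le> real (card W * card W)" by (intro of_nat_mono mult_mono) auto
    then have cI: "real (card I) \<le> n ^ 2" by (simp add: I_def n_def power2_eq_square)
    have e: "\<bar>N $ u $ w\<bar> \<le> 1 / n ^ 11" if "u \<in> W" "w \<in> W" for u w
      using small[OF that] by (simp add: n_def)
    have "\<bar>c p\<bar> \<le> 4 * (1 / n ^ 11)"
    proof -
      have "a i \<in> W" "a j \<in> W" "b i \<in> W" "b j \<in> W" using Fi p by auto
      then have "\<bar>N $ a i $ a j\<bar> \<le> 1 / n ^ 11" "\<bar>N $ a i $ b j\<bar> \<le> 1 / n ^ 11"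
          "\<bar>N $ b i $ a j\<bar> \<le> 1 / n ^ 11" "\<bar>N $ b i $ b j\<bar> \<le> 1 / n ^ 11"
        by (blast intro: e)+
      moreover have "c p = N $ a i $ a j - N $ a i $ b j - (N $ b i $ a j - N $ b i $ b j)"
        by (simp add: c_def p(1))
      ultimately show ?thesis by linarith
    qed
    also have "\<dots> \<le> n\<^sup>2 * (1 / n ^ 11)"
    proof (intro mult_right_mono)
      have "(2::real)\<^sup>2 \<le> n\<^sup>2" using n by (intro power_mono) auto
      then show "4 \<le> n\<^sup>2" by simp
    qed (use n in simp)
    finally have "\<bar>x\<bar> \<le> n ^ 2 * (n\<^sup>2 * (1 / n ^ 11))"
      unfolding x_def abs_mult using cI by (intro mult_mono) auto
    also have "\<dots> = 1 / n ^ 7"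
    proof -
      have "n ^ 11 = n ^ 4 * n ^ 7" "n\<^sup>2 * n\<^sup>2 = n ^ 4" by (simp_all flip: power_add)
      then have "n\<^sup>2 * (n\<^sup>2 * (1 / n ^ 11)) = n ^ 4 * 1 / (n ^ 4 * n ^ 7)"
        by (simp only: mult.assoc [symmetric] times_divide_eq_right)
      also have "\<dots> = 1 / n ^ 7" using n by (intro mult_divide_mult_cancel_left) simp
      finally show ?thesis .
    qed
    finally have x: "\<bar>x\<bar> \<le> 1 / n ^ 7" .
    define s :: real where "s = (if x < 0 then - 1 else 1)"
    \<comment> \<open>The words run from the side \<open>C j\<close>, which reads the input, to the
      side \<open>C i\<close>, which carries the output.\<close>
    obtain k g where g: "rank_one_word E W k (C i) (C j) g" "k \<le> 8" "\<bar>g\<bar> \<ge> 1 / real (card W) ^ 7" "sgn g = s"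
    proof (rule rank_one_word_both_signs[OF Fi(1)[OF p(3)] Fi(1)[OF p(2)] _ refl XYZ(4-6)])
      have "cross_free W X' (C j)" if "cross_free W (C j) X'" for X'
        using that by (auto simp: cross_free_def)
      then show "side E W X' \<and> cross_free W X' (C j) \<and> cross_free W (C i) X'" if "X' \<in> {X, Y, Z}" for X'
        using that XYZ(1-3) Fi(4)[OF p(2)] Fi(4)[OF p(3)] by blast
      show "s = 1 \<or> s = - 1" by (simp add: s_def)
    qed blast
    obtain \<tau> where "\<tau> \<in> words E W" "length \<tau> = k" "strategy_op \<tau> = averaging_op W + g *\<^sub>R R"
      using g(1) unfolding rank_one_word_def R_def by blast
    then have "averaging_op W + g *\<^sub>R R \<in> word_hull E W 8"
      using word_hull_mem[of \<tau> E W 8] g(2) by simp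
    have "g \<noteq> 0" using g(4) by (auto simp: s_def split: if_splits)
    \<comment> \<open>x has the sign of g and is no larger in size, so the target lies between the
      full average and the realised point.\<close>
    have "x / g \<ge> 0" using g(4) by (auto simp: s_def sgn_if zero_le_divide_iff split: if_splits)
    moreover have "x / g \<le> 1"
    proof -
      have "\<bar>x\<bar> \<le> \<bar>g\<bar>" using x g(3) unfolding n_def by linarith
      then have "\<bar>x / g\<bar> \<le> 1" using \<open>g \<noteq> 0\<close> by (simp add: abs_divide divide_le_eq)
      then show ?thesis by linarith
    qed
    ultimately have "(1 - x / g) *\<^sub>R averaging_op W + (x / g) *\<^sub>R (averaging_op W + g *\<^sub>R R) \<in> word_hull E W 8"
      using cW \<open>averaging_op W + g *\<^sub>R R \<in> _\<close> by (intro convexD[OF convex_word_hull]) auto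
    also have "(1 - x / g) *\<^sub>R averaging_op W + (x / g) *\<^sub>R (averaging_op W + g *\<^sub>R R) = averaging_op W + x *\<^sub>R R"
      using \<open>g \<noteq> 0\<close> by (simp add: scaleR_diff_left scaleR_add_right)
    finally show "averaging_op W + real (card I) *\<^sub>R (c p *\<^sub>R outer (side_vec W (C (fst p))) (side_vec W (C (snd p)))) \<in> word_hull E W 8"
      by (simp add: x_def R_def p(1))
  qed
  then show ?thesis using N by simp
qed

section \<open>Shortening words\<close>

lemma length_bound_simps:
  "length_bound (Suc 0) = 0" "length_bound 2 = 1"
  "n \<ge> 3 \<Longrightarrow> length_bound n = 2 * length_bound_q n * (length_bound (n - 1) + 1)"
  by (subst length_bound.simps; simp)+

lemma length_bound_q_ge: "n \<ge> 3 \<Longrightarrow> length_bound_q n \<ge> 4"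
proof -
  assume n: "n \<ge> 3"
  have "length_bound_r n \<noteq> 0" using length_bound_r_power[of n] n by (auto intro: Nat.gr0I)
  then have "1 \<le> n\<^sup>2 * length_bound_r n" using n by (simp add: Suc_leI)
  then show ?thesis by (simp add: length_bound_q_def)
qed

lemma length_bound_double: "n \<ge> 2 \<Longrightarrow> 2 * (length_bound n + 1) \<le> length_bound (Suc n)"
  using length_bound_simps(3)[of "Suc n"] length_bound_q_ge[of "Suc n"]
    mult_le_mono1[of 2 "2 * length_bound_q (Suc n)" "length_bound n + 1"] by simp

lemma length_bound_ge_8: "n \<ge> 3 \<Longrightarrow> 8 \<le> length_bound n"
  using length_bound_simps(3)[of n] length_bound_q_ge[of n]
    mult_le_mono2[of 1 "length_bound (n - 1) + 1" "2 * length_bound_q n"] by simp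

lemma length_bound_Suc_le: "length_bound n \<le> length_bound (Suc n)"
proof -
  consider "n = 0" | "n = 1" | "n \<ge> 2" by linarith
  then show ?thesis
  proof cases
    case 1
    then show ?thesis by (simp add: length_bound.simps[of 0])
  next
    case 2
    then show ?thesis by (simp add: length_bound_simps)
  next
    case 3
    from length_bound_double[OF this] show ?thesis by simp
  qed
qed

lemma length_bound_mono: "m \<le> n \<Longrightarrow> length_bound m \<le> length_bound n"
  by (rule lift_Suc_mono_le[of length_bound]) (rule length_bound_Suc_le)

text \<open>Two parts with a + b = n vertices together cost at most L_(n-1): for a, b \<ge> 2 one
  more vertex already doubles the bound of the larger part, and for a = 1 the summand L_1 = 0 drops
  out.\<close>

lemma length_bound_add:
  assumes "a \<ge> 1" "b \<ge> 1"
  shows "length_bound a + length_bound b \<le> length_bound (a + b - 1)"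
  using assms
proof (induction a b rule: linorder_wlog)
  case (le a b)
  show ?case
  proof (cases "a = 1")
    case True
    then show ?thesis by (simp add: length_bound_simps)
  next
    case False
    with le have "a \<ge> 2" "b \<ge> 2" by auto
    have "length_bound a + length_bound b \<le> 2 * (length_bound b + 1)"
      using length_bound_mono[OF le(1)] by simp
    also have "\<dots> \<le> length_bound (Suc b)" using length_bound_double[OF \<open>b \<ge> 2\<close>] .
    also have "\<dots> \<le> length_bound (a + b - 1)" using \<open>a \<ge> 2\<close> by (intro length_bound_mono) simp
    finally show ?thesis .
  qed
next
  case (sym a b)
  then show ?case by (simp add: add.commute)
qed

text \<open>Leaves room for the reduced path words, whose length is below 2^(n-1).\<close>

lemma power_le_length_bound:
  assumes "n \<ge> 1"
  shows "2 ^ (n - 1) \<le> length_bound n + 1"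
  using assms
proof (induction n rule: nat_induct_at_least)
  case base
  then show ?case by simp
next
  case (Suc n)
  show ?case
  proof (cases "n = 1")
    case True
    then show ?thesis using length_bound_simps(2) by (simp add: numeral_2_eq_2)
  next
    case False
    with Suc have "n \<ge> 2" by simp
    have "2 ^ (Suc n - 1) = 2 * (2::nat) ^ (n - 1)" using Suc.hyps by (cases n) auto
    also have "\<dots> \<le> 2 * (length_bound n + 1)" using Suc.IH by (intro mult_left_mono) auto
    also have "\<dots> \<le> length_bound (Suc n)" by (rule length_bound_double[OF \<open>n \<ge> 2\<close>])
    finally show ?thesis by simp
  qed
qed

section \<open>Uncrossed words and crossing blocks\<close>

text \<open>Letters inside H commute with those disjoint from H, so they can be sorted.\<close>

lemma strategy_op_split:
  fixes \<tau> :: "'v::finite set list"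
  assumes "\<And>S. S \<in> set \<tau> \<Longrightarrow> S \<subseteq> H \<or> S \<inter> H = {}"
  shows "strategy_op \<tau> = strategy_op (filter (\<lambda>S. S \<subseteq> H) \<tau>) ** strategy_op (filter (\<lambda>S. \<not> S \<subseteq> H) \<tau>)"
  using assms
proof (induction \<tau>)
  case (Cons S \<tau>)
  then have IH: "strategy_op \<tau> = strategy_op (filter (\<lambda>S. S \<subseteq> H) \<tau>) ** strategy_op (filter (\<lambda>S. \<not> S \<subseteq> H) \<tau>)"
    by simp
  show ?case
  proof (cases "S \<subseteq> H")
    case True
    have "S \<inter> T = {}" if "T \<in> set (filter (\<lambda>S. \<not> S \<subseteq> H) \<tau>)" for T
      using that Cons.prems[of T] True by auto
    then have "averaging_op S ** strategy_op (filter (\<lambda>S. \<not> S \<subseteq> H) \<tau>)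
        = strategy_op (filter (\<lambda>S. \<not> S \<subseteq> H) \<tau>) ** averaging_op S"
      by (intro averaging_op_strategy_op_commute) blast
    then show ?thesis using True by (simp add: strategy_op_Cons IH matrix_mul_assoc [symmetric])
  next
    case False
    then show ?thesis by (simp add: strategy_op_Cons IH matrix_mul_assoc [symmetric])
  qed
qed simp

lemma word_hull_uncrossed:
  fixes W :: "'v::finite set"
  assumes "\<not> crossing W \<tau>" "\<tau> \<in> words E W"
    and IH: "\<And>H \<sigma>. H \<subset> W \<Longrightarrow> H \<noteq> {} \<Longrightarrow> \<sigma> \<in> words E H \<Longrightarrow>
      strategy_op \<sigma> \<in> word_hull E H (length_bound (card H))"
  shows "strategy_op \<tau> \<in> word_hull E W (length_bound (card W - 1))"
proof -
  obtain H where H: "H \<subset> W" "H \<noteq> {}" and unc: "\<And>S. S \<in> set \<tau> \<Longrightarrow> S \<subseteq> H \<or> S \<inter> H = {}"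
    using assms(1) unfolding crossing_def by blast
  define \<tau>\<^sub>1 \<tau>\<^sub>2 where "\<tau>\<^sub>1 = filter (\<lambda>S. S \<subseteq> H) \<tau>" and "\<tau>\<^sub>2 = filter (\<lambda>S. \<not> S \<subseteq> H) \<tau>"
  have "\<tau>\<^sub>1 \<in> words E H" using assms(2) by (auto simp: words_def \<tau>\<^sub>1_def)
  have "\<tau>\<^sub>2 \<in> words E (W - H)"
  proof -
    have "linked E S \<and> S \<subseteq> W - H" if "S \<in> set \<tau>\<^sub>2" for S
    proof -
      have "S \<in> set \<tau>" "\<not> S \<subseteq> H" using that by (auto simp: \<tau>\<^sub>2_def)
      then have "S \<inter> H = {}" "linked E S" "S \<subseteq> W" using unc[of S] assms(2) by (auto simp: words_def)
      then show ?thesis by auto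
    qed
    then show ?thesis by (simp add: words_def)
  qed
  have HW: "W - H \<subset> W" "W - H \<noteq> {}" using H by auto
  have c: "card (W - H) = card W - card H" "card H < card W" "card H \<ge> 1"
    using H by (auto simp: card_Diff_subset psubset_imp_subset psubset_card_mono Suc_leI card_gt_0_iff)
  have "strategy_op \<tau>\<^sub>1 \<in> word_hull E W (length_bound (card H))"
    using IH[OF H \<open>\<tau>\<^sub>1 \<in> words E H\<close>] word_hull_mono[of H W _ _ E, OF _ order_refl] H(1) by blast
  moreover have "strategy_op \<tau>\<^sub>2 \<in> word_hull E W (length_bound (card (W - H)))"
    using IH[OF HW \<open>\<tau>\<^sub>2 \<in> words E (W - H)\<close>] word_hull_mono[of "W - H" W _ _ E, OF _ order_refl] by blast
  ultimately have "strategy_op \<tau>\<^sub>1 ** strategy_op \<tau>\<^sub>2 \<in> word_hull E W (length_bound (card H) + length_bound (card (W - H)))"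
    by (rule word_hull_mult)
  moreover have "length_bound (card H) + length_bound (card (W - H)) \<le> length_bound (card W - 1)"
    using length_bound_add[of "card H" "card (W - H)"] c by simp
  ultimately have "strategy_op \<tau>\<^sub>1 ** strategy_op \<tau>\<^sub>2 \<in> word_hull E W (length_bound (card W - 1))"
    using word_hull_mono[of W W] by blast
  moreover have "strategy_op \<tau> = strategy_op \<tau>\<^sub>1 ** strategy_op \<tau>\<^sub>2"
    unfolding \<tau>\<^sub>1_def \<tau>\<^sub>2_def by (rule strategy_op_split) (rule unc)
  ultimately show ?thesis by simp
qed

text \<open>The shortest crossing prefix: without its last letter it is uncrossed, so it costs one
  letter more than an uncrossed word.\<close>

lemma crossing_prefix:
  assumes "crossing W \<sigma>" "\<not> crossing W []"
  obtains \<tau> S \<sigma>' where "\<sigma> = \<tau> @ S # \<sigma>'" "crossing W (\<tau> @ [S])" "\<not> crossing W \<tau>"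
proof -
  have "\<exists>\<tau> S \<sigma>'. \<sigma> = \<tau> @ S # \<sigma>' \<and> crossing W (\<tau> @ [S]) \<and> \<not> crossing W \<tau>"
    using assms(1)
  proof (induction \<sigma> rule: rev_induct)
    case Nil
    then show ?case using assms(2) by simp
  next
    case (snoc S \<sigma>)
    show ?case
    proof (cases "crossing W \<sigma>")
      case True
      from snoc.IH[OF this] obtain \<tau> T \<sigma>' where "\<sigma> = \<tau> @ T # \<sigma>'" "crossing W (\<tau> @ [T])" "\<not> crossing W \<tau>"
        by blast
      then show ?thesis by (intro exI[of _ \<tau>] exI[of _ T] exI[of _ "\<sigma>' @ [S]"]) simp
    next
      case False
      then show ?thesis using snoc.prems by blast
    qed
  qed
  then show thesis using that by blast
qed

text \<open>Shortest crossing prefixes are cut off greedily. Either k blocks are obtained, kept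
  unaltered so that the contraction applies to the word itself, or the word ends after fewer than k
  blocks and an uncrossed rest, and each of these at most k pieces costs at most l + 1.\<close>

lemma crossing_blocks_or_short:
  fixes W :: "'v::finite set"
  assumes unc: "\<And>\<tau>. \<tau> \<in> words E W \<Longrightarrow> \<not> crossing W \<tau> \<Longrightarrow> strategy_op \<tau> \<in> word_hull E W l"
    and "\<not> crossing W []" "\<sigma> \<in> words E W"
  shows "(\<exists>bs \<rho>. \<sigma> = concat bs @ \<rho> \<and> length bs = k \<and> (\<forall>b\<in>set bs. crossing W b)) \<or>
    strategy_op \<sigma> \<in> word_hull E W (k * (l + 1))"
  using assms(3)
proof (induction k arbitrary: \<sigma>)
  case 0
  show ?case by (intro disjI1 exI[of _ "[]"] exI[of _ \<sigma>]) simp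
next
  case (Suc k)
  show ?case
  proof (cases "crossing W \<sigma>")
    case False
    have "word_hull E W l \<subseteq> word_hull E W (Suc k * (l + 1))" by (intro word_hull_mono) auto
    then show ?thesis using unc[OF Suc.prems False] by blast
  next
    case True
    then obtain \<tau> S \<sigma>' where \<sigma>: "\<sigma> = \<tau> @ S # \<sigma>'" "crossing W (\<tau> @ [S])" "\<not> crossing W \<tau>"
      using assms(2) by (rule crossing_prefix)
    have \<sigma>2: "\<sigma> = (\<tau> @ [S]) @ \<sigma>'" using \<sigma>(1) by simp
    have w: "\<tau> \<in> words E W" "[S] \<in> words E W" "\<sigma>' \<in> words E W"
      using Suc.prems unfolding \<sigma>(1) words_def by simp_all
    from Suc.IH[OF w(3)] show ?thesis
    proof
      assume "\<exists>bs \<rho>. \<sigma>' = concat bs @ \<rho> \<and> length bs = k \<and> (\<forall>b\<in>set bs. crossing W b)"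
      then obtain bs \<rho> where "\<sigma>' = concat bs @ \<rho>" "length bs = k" "\<forall>b\<in>set bs. crossing W b" by blast
      then have "\<sigma> = concat ((\<tau> @ [S]) # bs) @ \<rho>" "length ((\<tau> @ [S]) # bs) = Suc k"
          "\<forall>b\<in>set ((\<tau> @ [S]) # bs). crossing W b"
        using \<sigma>(2) unfolding \<sigma>2 by simp_all
      then show ?thesis by (intro disjI1 exI[of _ "(\<tau> @ [S]) # bs"] exI[of _ \<rho>] conjI)
    next
      assume *: "strategy_op \<sigma>' \<in> word_hull E W (k * (l + 1))"
      have "strategy_op [S] \<in> word_hull E W 1" by (rule word_hull_mem[OF w(2)]) simp
      then have "strategy_op [S] ** strategy_op \<tau> \<in> word_hull E W (1 + l)"
        using unc[OF w(1) \<sigma>(3)] by (rule word_hull_mult)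
      with * have "strategy_op \<sigma>' ** (strategy_op [S] ** strategy_op \<tau>) \<in> word_hull E W (k * (l + 1) + (1 + l))"
        by (rule word_hull_mult)
      moreover have "strategy_op \<sigma> = strategy_op \<sigma>' ** (strategy_op [S] ** strategy_op \<tau>)"
        unfolding \<sigma>2 by (simp only: strategy_op_append)
      moreover have "k * (l + 1) + (1 + l) = Suc k * (l + 1)" by simp
      ultimately have "strategy_op \<sigma> \<in> word_hull E W (Suc k * (l + 1))" by (simp only:)
      then show ?thesis ..
    qed
  qed
qed

lemma path_word_in_word_hull:
  fixes \<sigma> :: "'v::finite set list"
  assumes "path_order E ps" "symp E" "\<sigma> \<in> words E (set ps)" "ps \<noteq> []"
  shows "strategy_op \<sigma> \<in> word_hull E (set ps) (length_bound (card (set ps)))"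
proof -
  define Qs where "Qs = map (\<lambda>p. {p}) ps"
  have dist: "distinct ps" using assms(1) by (simp add: path_order_def)
  have "disjoint_blocks Qs"
    using dist unfolding Qs_def by (induction ps) auto
  have id: "strategy_op Qs = mat 1"
    unfolding Qs_def by (induction ps) (auto simp: strategy_op_Cons)
  have contig: "contiguous_union Qs S" if "S \<in> set \<sigma>" for S
    using linked_subset_path_contiguous[OF assms(1), of S] assms(3) that by (simp add: words_def Qs_def)
  have "strategy_op \<sigma> \<in> reduced_hull Qs"
    using contiguous_word_in_reduced_hull[OF \<open>disjoint_blocks Qs\<close> contig] by (simp add: id)
  also have "reduced_hull Qs \<subseteq> word_hull E (set ps) (length_bound (card (set ps)))"
    unfolding reduced_hull_def word_hull_def
  proof (intro hull_mono image_subsetI)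
    fix \<tau> assume \<tau>: "\<tau> \<in> reduced_words Qs"
    have "linked E S \<and> S \<subseteq> set ps" if "S \<in> set \<tau>" for S
      using contiguous_path_linked[OF assms(1,2)] contiguous_union_reduced_words[OF \<tau> that]
      unfolding Qs_def by blast
    then have "\<tau> \<in> words E (set ps)" by (simp add: words_def)
    moreover have "length \<tau> \<le> length_bound (card (set ps))"
    proof -
      have "length Qs = card (set ps)" "card (set ps) \<ge> 1"
        using dist assms(4) by (auto simp: Qs_def distinct_card Suc_leI)
      then show ?thesis
        using length_reduced_words[OF \<tau>] power_le_length_bound[of "card (set ps)"] by simp
    qed
    ultimately show "strategy_op \<tau> ** strategy_op Qs
        \<in> strategy_op ` {\<sigma> \<in> words E (set ps). length \<sigma> \<le> length_bound (card (set ps))}"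
      by (simp add: id)
  qed
  finally show ?thesis .
qed

text \<open>A connected letter cannot straddle a cut without edges, so a disconnected W falls under
  the uncrossed case.\<close>

lemma unlinked_not_crossing:
  assumes "\<not> linked E W" "W \<noteq> {}" "\<sigma> \<in> words E W"
  shows "\<not> crossing W \<sigma>"
proof
  assume c: "crossing W \<sigma>"
  obtain H where H: "H \<subset> W" "H \<noteq> {}" and no: "\<And>u v. u \<in> H \<Longrightarrow> v \<in> W - H \<Longrightarrow> \<not> E u v"
    using assms(1,2) unfolding linked_def by blast
  obtain S where S: "S \<in> set \<sigma>" "S \<inter> H \<noteq> {}" "\<not> S \<subseteq> H"
    using c H unfolding crossing_def by blast
  have "linked E S" "S \<subseteq> W" using S(1) assms(3) by (auto simp: words_def)
  moreover have "S \<inter> H \<subset> S" using S by blast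
  ultimately obtain u v where "u \<in> S \<inter> H" "v \<in> S - S \<inter> H" "E u v"
    using linkedD[of E S "S \<inter> H"] S(2) by blast
  then show False using no[of u v] \<open>S \<subseteq> W\<close> by blast
qed

lemma branching_card:
  fixes W :: "'v::finite set"
  assumes "branching E W"
  shows "card W \<ge> 3"
proof -
  obtain X Y Z where XYZ: "side E W X" "side E W Y" "side E W Z" "X \<inter> Y = {}" "X \<inter> Z = {}" "Y \<inter> Z = {}"
    using assms by (rule branchingE) blast
  obtain x y z where "x \<in> X" "y \<in> Y" "z \<in> Z"
    using side_proper(2)[OF XYZ(1)] side_proper(2)[OF XYZ(2)] side_proper(2)[OF XYZ(3)] by blast
  then have "card {x, y, z} = 3" "{x, y, z} \<subseteq> W"
    using XYZ by (auto simp: side_def card_insert_if)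
  then show ?thesis by (metis card_mono finite)
qed

text \<open>W may be disconnected, because the parts H and W - H of an uncrossed word need not be
  connected.\<close>

theorem word_in_word_hull:
  fixes W :: "'v::finite set"
  assumes "symp E" "\<And>x. \<not> E x x" "W \<noteq> {}" "\<sigma> \<in> words E W"
  shows "strategy_op \<sigma> \<in> word_hull E W (length_bound (card W))"
  using assms(3,4)
proof (induction "card W" arbitrary: W \<sigma> rule: less_induct)
  case less
  define n where "n = card W"
  have unc: "strategy_op \<tau> \<in> word_hull E W (length_bound (n - 1))"
    if "\<tau> \<in> words E W" "\<not> crossing W \<tau>" for \<tau>
    unfolding n_def
  proof (rule word_hull_uncrossed[OF that(2,1)])
    fix H \<sigma> assume "H \<subset> W" "H \<noteq> {}" "\<sigma> \<in> words E H"
    then show "strategy_op \<sigma> \<in> word_hull E H (length_bound (card H))"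
      by (intro less.hyps) (auto intro: psubset_card_mono)
  qed
  have up: "word_hull E W d \<subseteq> word_hull E W (length_bound n)" if "d \<le> length_bound n" for d
    using that by (intro word_hull_mono) auto
  show ?case
  proof (cases "linked E W")
    case False
    have "length_bound (n - 1) \<le> length_bound n" by (intro length_bound_mono) simp
    then show ?thesis
      using unc[OF less.prems(2) unlinked_not_crossing[OF False less.prems]] up n_def by blast
  next
    case True
    then consider ps where "path_order E ps" "set ps = W" | "branching E W"
      using path_or_branching[OF True _ assms(1,2)] by auto
    then show ?thesis
    proof cases
      case 1
      have "strategy_op \<sigma> \<in> word_hull E (set ps) (length_bound (card (set ps)))"
        using less.prems 1 assms(1) by (intro path_word_in_word_hull) auto
      then show ?thesis using 1(2) by simp
    next
      case 2
      have n: "n \<ge> 3" using branching_card[OF 2] by (simp add: n_def)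
      obtain w where "w \<in> W" using less.prems(1) by blast
      moreover have "{w} \<noteq> W" using n by (auto simp: n_def)
      ultimately have "{w} \<subset> W" by blast
      then have nil: "\<not> crossing W []" unfolding crossing_def by auto
      from crossing_blocks_or_short[OF unc nil less.prems(2), of "2 * length_bound_q n"]
      show ?thesis
      proof
        assume "strategy_op \<sigma> \<in> word_hull E W (2 * length_bound_q n * (length_bound (n - 1) + 1))"
        then show ?thesis using length_bound_simps(3)[OF n] by (simp add: n_def)
      next
        assume "\<exists>bs \<rho>. \<sigma> = concat bs @ \<rho> \<and> length bs = 2 * length_bound_q n \<and> (\<forall>b\<in>set bs. crossing W b)"
        then obtain bs \<rho> where \<sigma>: "\<sigma> = concat bs @ \<rho>" "length bs = 2 * length_bound_q n"
          "\<And>b. b \<in> set bs \<Longrightarrow> crossing W b" by blast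
        have sub: "S \<subseteq> W" if "S \<in> set (concat bs @ \<rho>)" for S
          using less.prems(2) that unfolding \<sigma>(1) words_def by blast
        have sub': "S \<subseteq> W" if "S \<in> set \<sigma>" for S using sub that \<sigma>(1) by simp
        define N where "N = strategy_op \<sigma> - averaging_op W"
        have dev: "\<And>v w. v \<notin> W \<Longrightarrow> N $ v $ w = 0" "\<And>v w. v \<in> W \<Longrightarrow> w \<notin> W \<Longrightarrow> N $ v $ w = 0"
          "\<And>v. (\<Sum>u\<in>W. N $ v $ u) = 0" "\<And>w. (\<Sum>u\<in>W. N $ u $ w) = 0"
          unfolding N_def using sub' by (blast intro: strategy_op_deviation)+
        have "averaging_op W + N \<in> word_hull E W 8"
        proof (rule branching_neighbourhood[OF 2])
          fix v w assume vw: "v \<in> W" "w \<in> W"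
          have "\<bar>N $ v $ w\<bar> \<le> (1 - 2 / real ((card W)\<^sup>2)) ^ length_bound_q n"
            unfolding N_def \<sigma>(1)
            using \<sigma>(3) n sub \<sigma>(2) vw by (intro deviation_entry_bound) (auto simp: n_def)
          also have "\<dots> \<le> 1 / real (card W) ^ 11"
            using contraction_rate[of n] n by (simp add: n_def)
          finally show "\<bar>N $ v $ w\<bar> \<le> 1 / real (card W) ^ 11" .
        next
          show "card W \<ge> 2" using n by (simp add: n_def)
        qed (rule dev; assumption)+
        then show ?thesis using up[OF length_bound_ge_8[OF n]] by (auto simp: N_def n_def)
      qed
    qed
  qed
qed

section \<open>From words to strategies of a graph\<close>

lemma finite_strategy_ops: "finite (strategy_ops (G :: ('v::finite, 'e) pre_digraph) d)"
proof -
  have "finite {\<sigma> :: 'v set list. set \<sigma> \<subseteq> UNIV \<and> length \<sigma> \<le> d}"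
    by (rule finite_lists_length_le) simp
  then have "finite (strategy_op ` {\<sigma> :: 'v set list. length \<sigma> \<le> d})" by simp
  then show ?thesis by (rule rev_finite_subset) (auto simp: strategy_ops_def)
qed

lemma strategy_op_rational: "strategy_op \<sigma> $ i $ j \<in> \<rat>"
proof -
  have "(strategy_op \<sigma> *v z) $ v \<in> \<rat>" if "\<And>v. z $ v \<in> \<rat>" for z :: "real^'a" and v
    using that
  proof (induction \<sigma> arbitrary: z)
    case (Cons S \<sigma>)
    have "(averaging_op S *v z) $ u \<in> \<rat>" for u
      using Cons.prems by (auto simp: averaging_op_mult_vec intro!: Rats_divide Rats_sum)
    from Cons.IH[OF this] show ?case by (simp add: strategy_op_Cons matrix_vector_mul_assoc)
  qed simp
  moreover have "(axis j 1 :: real^'a) $ v \<in> \<rat>" for v by (simp add: axis_def)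
  ultimately show ?thesis unfolding matrix_entry by blast
qed

theorem strategy_hull_eq_bounded:
  fixes G :: "('v::finite, 'e) pre_digraph"
  assumes "graph G" "verts G = UNIV"
  shows "strategy_hull G = bounded_strategy_hull G (length_bound (card (verts G)))"
proof
  interpret graph G by fact
  define E where "E u v \<longleftrightarrow> (u, v) \<in> arcs_ends G" for u v
  have "symp E" using graph_symmetric by (auto simp: E_def symp_def)
  have irr: "\<not> E x x" for x using adj_not_same by (auto simp: E_def)
  have str: "strategy G \<sigma> \<longleftrightarrow> \<sigma> \<in> words E UNIV" for \<sigma>
    unfolding strategy_def words_def connected_vertex_set_iff_linked[OF assms] E_def by simp
  have hull: "bounded_strategy_hull G d = word_hull E UNIV d" for d
    unfolding bounded_strategy_hull_def strategy_ops_def word_hull_def str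
    by (rule arg_cong[where f = "\<lambda>X. convex hull X"]) auto
  show "strategy_hull G \<subseteq> bounded_strategy_hull G (length_bound (card (verts G)))"
    unfolding strategy_hull_def
  proof (rule hull_minimal)
    show "convex (bounded_strategy_hull G (length_bound (card (verts G))))"
      by (simp add: bounded_strategy_hull_def)
    show "(\<Union>d. strategy_ops G d) \<subseteq> bounded_strategy_hull G (length_bound (card (verts G)))"
    proof
      fix M assume "M \<in> (\<Union>d. strategy_ops G d)"
      then obtain \<sigma> where "M = strategy_op \<sigma>" "\<sigma> \<in> words E UNIV"
        unfolding strategy_ops_def str by blast
      then show "M \<in> bounded_strategy_hull G (length_bound (card (verts G)))"
        using word_in_word_hull[OF \<open>symp E\<close> irr _ \<open>\<sigma> \<in> words E UNIV\<close>] unfolding hull assms(2) by simp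
    qed
  qed
  show "bounded_strategy_hull G (length_bound (card (verts G))) \<subseteq> strategy_hull G"
    unfolding bounded_strategy_hull_def strategy_hull_def by (intro hull_mono) blast
qed

section \<open>The size of the bound\<close>

lemma length_bound_r_ge_1:
  assumes "n \<ge> 2"
  shows "length_bound_r n \<ge> 1"
proof -
  have "log 2 (real n) > 0" using assms by simp
  then have "\<lceil>log 2 (real n)\<rceil> > 0" by simp
  then show ?thesis unfolding length_bound_r_def by linarith
qed

lemma ceiling_log_eq: "n \<ge> 1 \<Longrightarrow> real_of_int \<lceil>log 2 (real n)\<rceil> = real (length_bound_r n)"
proof -
  assume "n \<ge> 1"
  then have "log 2 (real n) \<ge> 0" by simp
  then have "\<lceil>log 2 (real n)\<rceil> \<ge> 0" by linarith
  then show ?thesis by (simp add: length_bound_r_def)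
qed

lemma length_bound_r_mono: "1 \<le> m \<Longrightarrow> m \<le> n \<Longrightarrow> length_bound_r m \<le> length_bound_r n"
  unfolding length_bound_r_def by (intro nat_mono ceiling_mono) simp

lemma explicit_length_bound_alt:
  "n \<ge> 2 \<Longrightarrow> explicit_length_bound n
     = 16 ^ (n - 2) * (fact n / 2)\<^sup>2 * real (length_bound_r n) ^ (n - 2)"
  unfolding explicit_length_bound_def by (simp add: ceiling_log_eq)

text \<open>Bounding L_n + 1 by 2 L_n, which is why L_n \<ge> 1 is carried along, turns the factor 8
  of the recursion into 16; earlier values of r are raised to the last one, and (n!/2)^2 is the
  product of k^2 for k from 3 to n.\<close>

lemma length_bound_le_explicit:
  assumes "n \<ge> 2"
  shows "length_bound n \<ge> 1 \<and> real (length_bound n) \<le> explicit_length_bound n"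
  using assms
proof (induction n rule: nat_induct_at_least)
  case base
  show ?case by (simp add: length_bound_simps explicit_length_bound_def)
next
  case (Suc n)
  define r where "r = length_bound_r (Suc n)"
  define s where "s = length_bound_r n"
  have r: "r \<ge> 1" "s \<le> r"
    using Suc.hyps length_bound_r_ge_1[of "Suc n"] length_bound_r_mono[of n "Suc n"]
    by (simp_all add: r_def s_def)
  have L: "length_bound (Suc n) = 8 * (Suc n)\<^sup>2 * r * (length_bound n + 1)"
    using length_bound_simps(3)[of "Suc n"] Suc.hyps by (simp add: length_bound_q_def r_def)
  have "length_bound (Suc n) > 0" unfolding L using r by (simp only: nat_0_less_mult_iff) simp
  then have "length_bound (Suc n) \<ge> 1" by simp
  moreover have "real (length_bound (Suc n)) \<le> explicit_length_bound (Suc n)"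
  proof -
    have "length_bound (Suc n) \<le> 8 * (Suc n)\<^sup>2 * r * (2 * length_bound n)"
      unfolding L using Suc.IH by (intro mult_left_mono) auto
    then have "real (length_bound (Suc n)) \<le> real (8 * (Suc n)\<^sup>2 * r * (2 * length_bound n))"
      by (rule of_nat_mono)
    also have "\<dots> = 16 * (real (Suc n))\<^sup>2 * real r * real (length_bound n)"
      by simp
    also have "\<dots> \<le> 16 * (real (Suc n))\<^sup>2 * real r * (16 ^ (n - 2) * (fact n / 2)\<^sup>2 * real s ^ (n - 2))"
      using Suc.IH Suc.hyps by (intro mult_left_mono) (auto simp: explicit_length_bound_alt s_def)
    also have "\<dots> \<le> 16 * (real (Suc n))\<^sup>2 * real r * (16 ^ (n - 2) * (fact n / 2)\<^sup>2 * real r ^ (n - 2))"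
      using r by (intro mult_left_mono power_mono) auto
    also have "\<dots> = explicit_length_bound (Suc n)"
    proof -
      have e: "Suc n - 2 = Suc (n - 2)" using Suc.hyps by simp
      have "explicit_length_bound (Suc n)
          = 16 ^ Suc (n - 2) * (fact (Suc n) / 2)\<^sup>2 * real r ^ Suc (n - 2)"
        using explicit_length_bound_alt[of "Suc n"] Suc.hyps unfolding e r_def by simp
      also have "(fact (Suc n) / 2 :: real) = real (Suc n) * (fact n / 2)" by simp
      finally show ?thesis by (simp only: power_mult_distrib power_Suc mult_ac)
    qed
    finally show ?thesis .
  qed
  ultimately show ?case by simp
qed

section \<open>Asymptotics of the explicit bound\<close>

text \<open>A weak Stirling formula with error O(n); the induction step of the lower bound is n ln
  (1 + 1/n) \<le> 1.\<close>

lemma ln_fact_bounds: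
  assumes "n \<ge> 1"
  shows "real n * ln (real n) - real n \<le> ln (fact n)" "ln (fact n) \<le> real n * ln (real n)"
proof -
  show "real n * ln (real n) - real n \<le> ln (fact n)"
    using assms
  proof (induction n rule: nat_induct_at_least)
    case (Suc n)
    have n: "real n > 0" using Suc.hyps by simp
    have "ln (1 + 1 / real n) \<le> 1 / real n" by (rule ln_add_one_self_le_self) simp
    moreover have "1 + 1 / real n = real (Suc n) / real n" using n by (simp add: field_simps)
    ultimately have "ln (real (Suc n)) - ln (real n) \<le> 1 / real n" using n by (simp add: ln_div)
    then have "real n * (ln (real (Suc n)) - ln (real n)) \<le> real n * (1 / real n)"
      using n by (intro mult_left_mono) auto
    then have "real n * ln (real (Suc n)) - real n * ln (real n) \<le> 1"
      using n by (simp add: right_diff_distrib)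
    moreover have "ln (fact (Suc n)) = ln (real (Suc n)) + ln (fact n)"
      by (simp add: ln_mult del: of_nat_Suc)
    moreover have "real (Suc n) * ln (real (Suc n)) = real n * ln (real (Suc n)) + ln (real (Suc n))"
      by (simp add: algebra_simps)
    moreover have "real (Suc n) = real n + 1" by simp
    ultimately show ?case using Suc.IH by linarith
  qed simp
  have "(fact n :: real) \<le> real n ^ n" using fact_le_power[of n] by simp
  then have "ln (fact n) \<le> ln (real n ^ n)" using assms by (subst ln_le_cancel_iff) auto
  then show "ln (fact n) \<le> real n * ln (real n)" using assms by (simp add: ln_realpow)
qed

text \<open>For x \<ge> 1 rounding up at most doubles x, and passing from base 2 to the natural
  logarithm shifts the iterated logarithm by ln (ln 2).\<close>

lemma ln_length_bound_r:
  assumes "n \<ge> 3"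
  shows "\<bar>ln (real (length_bound_r n)) - ln (ln (real n))\<bar> \<le> \<bar>ln (ln 2)\<bar> + ln 2"
proof -
  define x where "x = log 2 (real n)"
  have "log 2 2 \<le> log 2 (real n)" using assms by (subst log_le_cancel_iff) auto
  then have x: "x \<ge> 1" by (simp add: x_def)
  have "real (length_bound_r n) = real_of_int \<lceil>x\<rceil>"
    using ceiling_log_eq[of n] assms by (simp add: x_def)
  then have r: "x \<le> real (length_bound_r n)" "real (length_bound_r n) \<le> x + 1"
    by (auto simp: le_of_int_ceiling of_int_ceiling_le_add_one)
  have lx: "ln x = ln (ln (real n)) - ln (ln 2)"
    unfolding x_def log_def using assms by (simp add: ln_div)
  have "ln x \<le> ln (real (length_bound_r n))" using r x by (subst ln_le_cancel_iff) auto
  moreover have "ln (real (length_bound_r n)) \<le> ln (2 * x)" using r x by (subst ln_le_cancel_iff) auto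
  moreover have "ln (2 * x) = ln 2 + ln x" using x by (simp add: ln_mult)
  moreover have "ln (2::real) \<ge> 0" by simp
  ultimately show ?thesis using lx by linarith
qed

text \<open>Defined as the exact difference, so that the exponential formula is immediate and the
  content lies in the O(n) bound.\<close>

definition log_error :: "nat \<Rightarrow> real" where
  "log_error n = ln (explicit_length_bound n) - 2 * real n * ln (real n) - real n * ln (ln (real n))"

lemma explicit_length_bound_pos:
  assumes "n \<ge> 2"
  shows "explicit_length_bound n > 0"
  using length_bound_r_ge_1[OF assms] by (simp add: explicit_length_bound_alt[OF assms])

lemma log_error_bound:
  assumes "n \<ge> 3"
  shows "\<bar>log_error n\<bar> \<le> (ln 16 + 6 + \<bar>ln (ln 2)\<bar> + ln 2) * real n"
proof -
  define m where "m = real (n - 2)"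
  have m: "m = real n - 2" "0 \<le> m" "m \<le> real n" using assms by (auto simp: m_def)
  define c where "c = \<bar>ln (ln 2)\<bar> + ln (2::real)"
  define r where "r = real (length_bound_r n)"
  have r: "r \<ge> 1" using length_bound_r_ge_1[of n] assms by (simp add: r_def)
  define f where "f = ln (fact n) - real n * ln (real n)"
  define h where "h = ln r - ln (ln (real n))"
  have f: "- real n \<le> f" "f \<le> 0" using ln_fact_bounds[of n] assms by (auto simp: f_def)
  have h: "\<bar>h\<bar> \<le> c" using ln_length_bound_r[OF assms] by (simp add: h_def r_def c_def)
  have fact: "ln ((fact n / 2)\<^sup>2) = 2 * (ln (fact n) - ln (2::real))"
  proof -
    have "ln (fact n / 2 :: real) = ln (fact n) - ln 2" by (rule ln_divide_pos) simp_all
    then show ?thesis by (simp only: ln_realpow of_nat_numeral)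
  qed
  have "ln (explicit_length_bound n) = ln (16 ^ (n - 2)) + ln ((fact n / 2)\<^sup>2) + ln (r ^ (n - 2))"
    using assms r by (simp add: explicit_length_bound_alt r_def ln_mult)
  also have "\<dots> = m * ln 16 + 2 * (ln (fact n) - ln 2) + m * ln r"
    unfolding fact m_def by (simp only: ln_realpow)
  finally have "log_error n = m * ln 16 + 2 * f - 2 * ln 2 + (m * ln r - real n * ln (ln (real n)))"
    by (simp add: log_error_def f_def)
  \<comment> \<open>The exponent n - 2 instead of n leaves behind 2 ln (ln n).\<close>
  also have "m * ln r - real n * ln (ln (real n)) = m * h - 2 * ln (ln (real n))"
    by (simp add: h_def m(1) algebra_simps)
  finally have eq: "log_error n = m * ln 16 + 2 * f - 2 * ln 2 + (m * h - 2 * ln (ln (real n)))" .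
  have lnn: "1 \<le> ln (real n)"
  proof -
    have "exp 1 \<le> real n" using exp_le assms by linarith
    then show ?thesis using assms by (simp add: ln_ge_iff)
  qed
  have ll: "0 \<le> ln (ln (real n))" "ln (ln (real n)) \<le> real n"
  proof -
    show "0 \<le> ln (ln (real n))" using lnn by simp
    have "ln (ln (real n)) \<le> ln (real n)" using lnn by (intro ln_bound) simp
    also have "\<dots> \<le> real n" using assms by (intro ln_bound) simp
    finally show "ln (ln (real n)) \<le> real n" .
  qed
  have "\<bar>m * h\<bar> \<le> real n * c" unfolding abs_mult using m h by (intro mult_mono) auto
  moreover have "0 \<le> m * ln 16" "m * ln 16 \<le> real n * ln 16" using m by (auto intro: mult_right_mono)
  moreover have "ln (2::real) \<le> 1" "0 \<le> ln (2::real)" using ln_2_less_1 by auto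
  moreover have "real n \<ge> 1" using assms by simp
  \<comment> \<open>The three terms 2 n stem from the factorial, from halving it, and from 2 ln (ln
    n).\<close>
  ultimately have "\<bar>log_error n\<bar> \<le> real n * ln 16 + 2 * real n + 2 * real n + (real n * c + 2 * real n)"
    unfolding eq using f ll by linarith
  also have "\<dots> = (ln 16 + 6 + c) * real n" by (simp add: algebra_simps)
  finally show ?thesis by (simp add: c_def add.assoc)
qed

lemma log_error_bigo: "log_error \<in> O(\<lambda>n. real n)"
  using log_error_bound by (intro bigoI[where c = "ln 16 + 6 + \<bar>ln (ln 2)\<bar> + ln 2"])
    (auto simp: eventually_at_top_linorder)

lemma explicit_length_bound_eq_exp:
  assumes "n \<ge> 2"
  shows "explicit_length_bound n
    = exp (2 * real n * ln (real n) + real n * ln (ln (real n)) + log_error n)"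
  using explicit_length_bound_pos[OF assms] by (simp add: log_error_def)

text \<open>The lower-order part of the exponent divided by n ln n.\<close>

definition exponent_error :: "nat \<Rightarrow> real" where
  "exponent_error n = ln (ln (real n)) / ln (real n) + log_error n / (real n * ln (real n))"

lemma exponent_error_smallo: "exponent_error \<in> o(\<lambda>n. 1)"
proof -
  define c where "c = ln 16 + 6 + \<bar>ln (ln 2)\<bar> + ln (2::real)"
  have "((\<lambda>n. ln (ln (real n)) / ln (real n)) \<longlongrightarrow> 0) sequentially" by real_asymp
  moreover have "((\<lambda>n. log_error n / (real n * ln (real n))) \<longlongrightarrow> 0) sequentially"
  proof (rule Lim_null_comparison)
    show "((\<lambda>n. c / ln (real n)) \<longlongrightarrow> 0) sequentially" by real_asymp
    show "\<forall>\<^sub>F n in sequentially. norm (log_error n / (real n * ln (real n))) \<le> c / ln (real n)"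
      using eventually_ge_at_top[of 3]
    proof eventually_elim
      case (elim n)
      have n: "real n > 0" "ln (real n) > 0" using elim by auto
      have "norm (log_error n / (real n * ln (real n))) = \<bar>log_error n\<bar> / (real n * ln (real n))"
        using n by (simp add: abs_mult)
      also have "\<dots> \<le> c * real n / (real n * ln (real n))"
        using log_error_bound[OF elim] n unfolding c_def by (intro divide_right_mono) auto
      also have "\<dots> = c / ln (real n)" using n by simp
      finally show ?case .
    qed
  qed
  ultimately have "(exponent_error \<longlongrightarrow> 0 + 0) sequentially"
    unfolding exponent_error_def by (rule tendsto_add)
  then show ?thesis by (intro smalloI_tendsto) auto
qed

lemma length_bound_le_powr:
  assumes "n \<ge> 2"
  shows "real (length_bound n) \<le> real n powr ((2 + exponent_error n) * real n)"
proof -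
  have n: "real n > 0" "ln (real n) > 0" using assms by auto
  have "real (length_bound n) \<le> explicit_length_bound n"
    using length_bound_le_explicit[OF assms] by simp
  also have "\<dots> = exp (2 * real n * ln (real n) + real n * ln (ln (real n)) + log_error n)"
    by (rule explicit_length_bound_eq_exp[OF assms])
  also have "2 * real n * ln (real n) + real n * ln (ln (real n)) + log_error n
      = (2 + exponent_error n) * real n * ln (real n)"
    using n by (simp add: exponent_error_def field_simps)
  finally show ?thesis using n by (simp add: powr_def)
qed

theorem theorem1p1:
  shows "(\<forall>n \<ge> 1. \<forall>G :: ('v::finite, 'e) pre_digraph.
            graph G \<and> verts G = UNIV \<and> card (verts G) = n \<longrightarrow>
            strategy_hull G = bounded_strategy_hull G (length_bound n)) \<and>
         (\<forall>n \<ge> 2. real (length_bound n) \<le> explicit_length_bound n) \<and>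
         (\<exists>\<epsilon> :: nat \<Rightarrow> real. \<epsilon> \<in> O(\<lambda>n. real n) \<and>
            (\<forall>\<^sub>F n in sequentially. explicit_length_bound n =
               exp (2 * real n * ln (real n) + real n * ln (ln (real n)) + \<epsilon> n))) \<and>
         (\<exists>\<delta> :: nat \<Rightarrow> real. \<delta> \<in> o(\<lambda>n. 1) \<and>
            (\<forall>\<^sub>F n in sequentially. real (length_bound n) \<le> real n powr ((2 + \<delta> n) * real n))) \<and>
         (\<forall>G :: ('v, 'e) pre_digraph.
            graph G \<and> verts G = UNIV \<longrightarrow> rational_polytope (strategy_hull G))"
proof (intro conjI allI impI)
  fix n :: nat and G :: "('v, 'e) pre_digraph"
  assume "graph G \<and> verts G = UNIV \<and> card (verts G) = n"
  then have "graph G" "verts G = UNIV" "card (verts G) = n" by auto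
  with strategy_hull_eq_bounded[of G] show "strategy_hull G = bounded_strategy_hull G (length_bound n)"
    by simp
next
  fix n :: nat
  assume "2 \<le> n"
  then show "real (length_bound n) \<le> explicit_length_bound n"
    by (rule length_bound_le_explicit[THEN conjunct2])
next
  have "\<forall>\<^sub>F n in sequentially. explicit_length_bound n =
      exp (2 * real n * ln (real n) + real n * ln (ln (real n)) + log_error n)"
    using eventually_ge_at_top[of 2] by eventually_elim (rule explicit_length_bound_eq_exp)
  with log_error_bigo show "\<exists>\<epsilon> :: nat \<Rightarrow> real. \<epsilon> \<in> O(\<lambda>n. real n) \<and>
      (\<forall>\<^sub>F n in sequentially. explicit_length_bound n =
        exp (2 * real n * ln (real n) + real n * ln (ln (real n)) + \<epsilon> n))"
    by blast
next
  have "\<forall>\<^sub>F n in sequentially. real (length_bound n) \<le> real n powr ((2 + exponent_error n) * real n)"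
    using eventually_ge_at_top[of 2] by eventually_elim (rule length_bound_le_powr)
  with exponent_error_smallo show "\<exists>\<delta> :: nat \<Rightarrow> real. \<delta> \<in> o(\<lambda>n. 1) \<and>
      (\<forall>\<^sub>F n in sequentially. real (length_bound n) \<le> real n powr ((2 + \<delta> n) * real n))"
    by blast
next
  fix G :: "('v, 'e) pre_digraph"
  assume "graph G \<and> verts G = UNIV"
  then have "strategy_hull G = convex hull (strategy_ops G (length_bound (card (verts G))))"
    unfolding bounded_strategy_hull_def[symmetric] by (intro strategy_hull_eq_bounded) auto
  moreover have "\<forall>M \<in> strategy_ops G d. \<forall>i j. M $ i $ j \<in> \<rat>" for d
  proof
    fix M assume "M \<in> strategy_ops G d"
    then obtain \<sigma> where "M = strategy_op \<sigma>" unfolding strategy_ops_def by blast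
    then show "\<forall>i j. M $ i $ j \<in> \<rat>" using strategy_op_rational[of \<sigma>] by simp
  qed
  ultimately show "rational_polytope (strategy_hull G)"
    unfolding rational_polytope_def 
    by (intro exI[of _ "strategy_ops G (length_bound (card (verts G)))"] conjI finite_strategy_ops)
qed

end
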